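(* Let $\mathbb{F}$ be an algebraically closed field of characteristic $0$, let $n\ge 1$ be an integer, and let $\mathfrak{ba}_n$ be the Heisenberg Lie superalgebra over $\mathbb{F}$ with basis $\{x_1,\ldots,x_n\mid y_1,\ldots,y_n;z\}$ ($x_i$ even, $y_i$ and $z$ odd) whose non-zero brackets of basis elements are given by $[x_i,y_i]=z$ ($1\le i\le n$). Let $\mathfrak{G}_n$ be the associative superalgebra with $2n$ homogeneous generators $\{\xi_1,\ldots,\xi_n\mid\eta_1,\ldots,\eta_n\}$ ($\xi_i$ even, $\eta_i$ odd) and defining relations $$\xi_i\xi_j+\xi_j\xi_i=0,\quad \xi_i\eta_j+\eta_j\xi_i=0,\quad \eta_i\eta_j-\eta_j\eta_i=0\qquad(1\le i,j\le n),\qquad \sum_{k=1}^n\eta_k\xi_k=0,$$ $\mathbb{Z}$-graded by $\|\xi_i\|=\|\eta_j\|=1$. Let $\mathcal{V}$ be the infinite-dimensional superspace with $\mathbb{Z}_2$-homogeneous basis $\{v_i\mid i\in\mathbb{Z},\ i\ge 1\}$, $|v_i|=\bar{i}$, viewed as a $\mathbb{Z}$-graded associative superalgebra with trivial multiplication and with $\mathbb{Z}$-grading given by $\|v_i\|=n+i$. Then, as $\mathbb{Z}$-graded superalgebras, $H^\bullet(\mathfrak{ba}_n)$ is isomorphic to the direct sum of superalgebras $\mathfrak{G}_n\oplus\mathcal{V}$. In particular, $$\dim H^k(\mathfrak{ba}_n)=\mathfrak{d}^k(n,n)-\mathfrak{d}^{k-2}(n,n)+\sum_{i=2}^{\lf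loor\frac{k-2}{2}\rfloor}(-1)^{i-1}\big(\mathfrak{d}^{k-2i}(n,n)-\delta_{k-2i,n}\big)+\sum_{i=1}^{k-1}\delta_{k-i,n}+\delta_{k-2,n}.$$
   Context: For a homogeneous element $x$, $|x|\in\mathbb{Z}_2$ denotes its parity and $\|x\|\in\mathbb{Z}$ its $\mathbb{Z}$-degree; $\delta_{a,b}$ is the Kronecker delta; empty sums are $0$. For a superspace $V$, the super-exterior algebra is $\bigwedge V=T(V)/J(V)$, where $T(V)$ is the tensor algebra (with $\mathbb{Z}_2$-grading induced from $V$ and $\mathbb{Z}$-grading given by $\|v\|=1$ for $v\in V$) and $J(V)$ is the two-sided ideal generated by all $u\otimes v+(-1)^{|u||v|}v\otimes u$ with $u,v\in V$ homogeneous. It is graded-supercommutative: $ab=(-1)^{\|a\|\|b\|}(-1)^{|a||b|}ba$. $\mathfrak{d}^k(r,s)$ denotes the dimension of the $k$-homogeneous subspace of the super-exterior algebra with $r$ even and $s$ odd generators: $\mathfrak{d}^k(r,s)=\sum_{i=0}^k\binom{r}{k-i}\binom{s+i-1}{i}$ for $k\ge 0$, and it is $0$ for $k<0$. For a finite-dimensional Lie superalgebra $\mathfrak{g}$ over a field of characteristic $0$, $H^\bullet(\mathfrak{g})=\bigoplus_k H^k(\mathfrak{g})$ is the cohomology with coefficients in the trivial module, i.e. the cohomology of the cochain complex $(\bigwedge^\bullet\mathfrak{g}^*,\mathrm{d})$, where $\mathrm{d}$ is induced by the dual $\bigwedge^1\mathfrak{g}^*\to\bigwedge^2\mathfrak{g}^*$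 of the bracket and extended by $\mathrm{d}(ab)=\mathrm{d}(a)b+(-1)^{\|a\|}a\,\mathrm{d}(b)$. For $\mathfrak{ba}_n$, with the dual basis marked by $*$, $\mathrm{d}x_i^*=\mathrm{d}y_i^*=0$ and $\mathrm{d}z^*=\sum_{j=1}^n x_j^*\wedge y_j^*$. The associative superalgebra structure on $H^\bullet(\mathfrak{g})$ is the one induced by the product of the cochain space $\bigwedge^\bullet\mathfrak{g}^*$, with the $\mathbb{Z}$-grading by cohomological degree.
   Formalization: In the dimension formula the alternating sum is corrected to ∑_{i=2}^{⌊k/2⌋}(-1)^i(…), since the printed one fails for n=1, k=4; in 𝔊_n⊕𝒱 the unit of 𝔊_n is the unit of the whole sum, and only elements of positive degree multiply componentwise. *)

theory Defs
  imports
    "HOL-Computational_Algebra.Polynomial"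
    "HOL-Library.Poly_Mapping"
    "HOL-Library.Z2"
    "HOL-Algebra.Module"
    "HOL-Algebra.QuotRing"
    "HOL-Algebra.Embedded_Algebras"
begin

section \<open>\<open>\<int>\<close>-graded superalgebras\<close>

text \<open>
  Algebras over the field given by the type \<open>'f\<close>. \<open>zgr A k\<close> and \<open>pgr A p\<close> are the
  components of \<open>\<int>\<close>-degree \<open>k\<close> and of parity \<open>p\<close> (parities live in \<open>\<int>\<^sub>2\<close>, the type \<open>bit\<close>).
\<close>

record ('f, 'v) galg = "('f, 'v) module" +
  zgr :: "int \<Rightarrow> 'v set"
  pgr :: "bit \<Rightarrow> 'v set"

definition ksign :: "bit \<Rightarrow> bit \<Rightarrow> 'r::ring_1" where
  "ksign p q = (if p = 1 \<and> q = 1 then - 1 else 1)"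

definition quot_alg :: "('f, 'v, 'm) galg_scheme \<Rightarrow> 'v set \<Rightarrow> ('f, 'v set) galg" where
  "quot_alg A I =
    \<lparr> carrier = carrier (A Quot I), mult = mult (A Quot I), one = one (A Quot I),
      zero = zero (A Quot I), add = add (A Quot I),
      smult = (\<lambda>c X. \<Union>x\<in>X. I +>\<^bsub>A\<^esub> (c \<odot>\<^bsub>A\<^esub> x)),
      zgr = (\<lambda>k. (\<lambda>x. I +>\<^bsub>A\<^esub> x) ` zgr A k),
      pgr = (\<lambda>p. (\<lambda>x. I +>\<^bsub>A\<^esub> x) ` pgr A p) \<rparr>"

definition sub_alg :: "('f, 'v) galg \<Rightarrow> 'v set \<Rightarrow> ('f, 'v) galg" where
  "sub_alg A S =
    A\<lparr> carrier := S, zgr := (\<lambda>k. zgr A k \<inter> S), pgr := (\<lambda>p. pgr A p \<inter> S) \<rparr>"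

definition galg_iso :: "('f, 'v) galg \<Rightarrow> ('f, 'w) galg \<Rightarrow> bool" where
  "galg_iso A B \<longleftrightarrow> (\<exists>\<phi> \<in> ring_iso A B.
      (\<forall>c. \<forall>x \<in> carrier A. \<phi> (c \<odot>\<^bsub>A\<^esub> x) = c \<odot>\<^bsub>B\<^esub> \<phi> x) \<and>
      (\<forall>k. \<phi> ` zgr A k = zgr B k) \<and> (\<forall>p. \<phi> ` pgr A p = pgr B p))"

definition scalars :: "('f, 'v) galg \<Rightarrow> 'v set" where
  "scalars A = range (\<lambda>c. c \<odot>\<^bsub>A\<^esub> \<one>\<^bsub>A\<^esub>)"

text \<open>
  Direct sum of a unital algebra \<open>A\<close> whose degree \<open>0\<close> part is \<open>\<bbbF>1\<close> and an algebra \<open>V\<close> without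
  unit, concentrated in positive degrees. The unit of \<open>A\<close> is the unit of the sum, and elements of
  positive degree multiply componentwise:
  \<open>(a, v)(b, w) = (ab, \<epsilon>(a)w + \<epsilon>(b)v + vw)\<close> with \<open>\<epsilon>\<close> the augmentation of \<open>A\<close>.
  (The purely componentwise product would have no unit, so it could not be the cohomology
  algebra, which has the unit \<open>1 \<in> H\<^sup>0\<close>.)
\<close>

definition aug :: "('f, 'v) galg \<Rightarrow> 'v \<Rightarrow> 'f" where
  "aug A a = (THE c. a \<ominus>\<^bsub>A\<^esub> c \<odot>\<^bsub>A\<^esub> \<one>\<^bsub>A\<^esub> \<in> Idl\<^bsub>A\<^esub> (\<Union>k\<in>{0<..}. zgr A k))"

definition dsum :: "('f, 'v) galg \<Rightarrow> ('f, 'w) galg \<Rightarrow> ('f, 'v \<times> 'w) galg" where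
  "dsum A V =
    \<lparr> carrier = carrier A \<times> carrier V,
      mult = (\<lambda>(a, v) (b, w). (a \<otimes>\<^bsub>A\<^esub> b,
                (aug A a \<odot>\<^bsub>V\<^esub> w \<oplus>\<^bsub>V\<^esub> aug A b \<odot>\<^bsub>V\<^esub> v) \<oplus>\<^bsub>V\<^esub> (v \<otimes>\<^bsub>V\<^esub> w))),
      one = (\<one>\<^bsub>A\<^esub>, \<zero>\<^bsub>V\<^esub>),
      zero = (\<zero>\<^bsub>A\<^esub>, \<zero>\<^bsub>V\<^esub>),
      add = (\<lambda>(a, v) (b, w). (a \<oplus>\<^bsub>A\<^esub> b, v \<oplus>\<^bsub>V\<^esub> w)),
      smult = (\<lambda>c (a, v). (c \<odot>\<^bsub>A\<^esub> a, c \<odot>\<^bsub>V\<^esub> v)),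
      zgr = (\<lambda>k. zgr A k \<times> zgr V k),
      pgr = (\<lambda>p. pgr A p \<times> pgr V p) \<rparr>"


section \<open>Tensor algebra and super-exterior algebra\<close>

text \<open>
  The lists over \<open>'b\<close> with concatenation are the free monoid, so \<open>'b list \<Rightarrow>\<^sub>0 'f\<close> with the
  convolution product of \<^theory>\<open>HOL-Library.Poly_Mapping\<close> is the free associative algebra
  over \<open>'f\<close> on \<open>'b\<close>. It is the tensor algebra of the vector space with basis \<open>'b\<close>.
\<close>

instantiation list :: (type) monoid_add
begin
definition zero_list :: "'a list" where "zero_list = []"
definition plus_list :: "'a list \<Rightarrow> 'a list \<Rightarrow> 'a list" where "plus_list = (@)"
instance by standard (simp_all add: zero_list_def plus_list_def)
end

abbreviation wd :: "'b list \<Rightarrow> 'b list \<Rightarrow>\<^sub>0 'f::comm_ring_1" where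
  "wd w \<equiv> Poly_Mapping.single w 1"

abbreviation cst :: "'f \<Rightarrow> 'b list \<Rightarrow>\<^sub>0 'f::comm_ring_1" where
  "cst c \<equiv> Poly_Mapping.single [] c"

definition tensor_alg :: "'b set \<Rightarrow> ('b \<Rightarrow> bit) \<Rightarrow> ('f::field, 'b list \<Rightarrow>\<^sub>0 'f) galg" where
  "tensor_alg B par =
    \<lparr> carrier = {t. \<forall>w\<in>Poly_Mapping.keys t. set w \<subseteq> B},
      mult = (*), one = 1, zero = 0, add = (+),
      smult = (\<lambda>c t. cst c * t),
      zgr = (\<lambda>k. {t. \<forall>w\<in>Poly_Mapping.keys t. set w \<subseteq> B \<and> int (length w) = k}),
      pgr = (\<lambda>p. {t. \<forall>w\<in>Poly_Mapping.keys t. set w \<subseteq> B \<and> sum_list (map par w) = p}) \<rparr>"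

text \<open>The superspace itself is the degree \<open>1\<close> part of its tensor algebra.\<close>

definition ext_ideal :: "'b set \<Rightarrow> ('b \<Rightarrow> bit) \<Rightarrow> ('b list \<Rightarrow>\<^sub>0 'f::field) set" where
  "ext_ideal B par = (let T = tensor_alg B par in
     Idl\<^bsub>T\<^esub> {u * v + ksign p q * (v * u) | p q u v.
        u \<in> zgr T 1 \<inter> pgr T p \<and> v \<in> zgr T 1 \<inter> pgr T q})"

definition ext_alg :: "'b set \<Rightarrow> ('b \<Rightarrow> bit) \<Rightarrow> ('f::field, ('b list \<Rightarrow>\<^sub>0 'f) set) galg" where
  "ext_alg B par = quot_alg (tensor_alg B par) (ext_ideal B par)"


section \<open>Lie superalgebras and their cohomology\<close>

text \<open>
  A finite-dimensional Lie superalgebra is given by a homogeneous basis and the structure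
  constants: \<open>brk g a b c\<close> is the coefficient of \<open>c\<close> in \<open>[a, b]\<close>.
\<close>

record ('f, 'b) lsa =
  bas :: "'b set"
  par :: "'b \<Rightarrow> bit"
  brk :: "'b \<Rightarrow> 'b \<Rightarrow> 'b \<Rightarrow> 'f"

definition lie_superalgebra :: "('f::field, 'b) lsa \<Rightarrow> bool" where
  "lie_superalgebra g \<longleftrightarrow> finite (bas g) \<and>
     (\<forall>a\<in>bas g. \<forall>b\<in>bas g. \<forall>c\<in>bas g. brk g a b c \<noteq> 0 \<longrightarrow> par g c = par g a + par g b) \<and>
     (\<forall>a\<in>bas g. \<forall>b\<in>bas g. \<forall>c\<in>bas g.
        brk g a b c = - ksign (par g a) (par g b) * brk g b a c) \<and>
     (\<forall>a\<in>bas g. \<forall>b\<in>bas g. \<forall>c\<in>bas g. \<forall>e\<in>bas g.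
        (\<Sum>m\<in>bas g. brk g b c m * brk g a m e) =
        (\<Sum>m\<in>bas g. brk g a b m * brk g m c e) +
        ksign (par g a) (par g b) * (\<Sum>m\<in>bas g. brk g a c m * brk g b m e))"

text \<open>
  The letter \<open>b\<close> in the tensor algebra of the dual space stands for the dual basis vector \<open>b\<^sup>*\<close>.
  The dual of the bracket is \<open>d c\<^sup>* = 1/2 \<Sum> [a, b]\<^sub>c a\<^sup>* \<and> b\<^sup>*\<close>, the sum ranging over all
  ordered pairs of basis vectors; \<open>d_gen\<close> is this representative in the tensor algebra and
  \<open>d_word\<close>, \<open>d_tensor\<close> extend it by the Leibniz rule and linearly. \<open>d_ext\<close> is the induced map on
  the super-exterior algebra.
\<close>

definition d_gen :: "('f::field_char_0, 'b) lsa \<Rightarrow> 'b \<Rightarrow> 'b list \<Rightarrow>\<^sub>0 'f" where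
  "d_gen g c = (\<Sum>a\<in>bas g. \<Sum>b\<in>bas g. Poly_Mapping.single [a, b] (brk g a b c / 2))"

primrec d_word :: "('f::field_char_0, 'b) lsa \<Rightarrow> 'b list \<Rightarrow> 'b list \<Rightarrow>\<^sub>0 'f" where
  "d_word g [] = 0"
| "d_word g (b # w) = d_gen g b * wd w - wd [b] * d_word g w"

definition d_tensor ::
    "('f::field_char_0, 'b) lsa \<Rightarrow> ('b list \<Rightarrow>\<^sub>0 'f) \<Rightarrow> ('b list \<Rightarrow>\<^sub>0 'f)" where
  "d_tensor g t = (\<Sum>w\<in>Poly_Mapping.keys t. cst (Poly_Mapping.lookup t w) * d_word g w)"

definition cochains :: "('f::field_char_0, 'b) lsa \<Rightarrow> ('f, ('b list \<Rightarrow>\<^sub>0 'f) set) galg" where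
  "cochains g = ext_alg (bas g) (par g)"

definition d_ext ::
    "('f::field_char_0, 'b) lsa \<Rightarrow> ('b list \<Rightarrow>\<^sub>0 'f) set \<Rightarrow> ('b list \<Rightarrow>\<^sub>0 'f) set" where
  "d_ext g X =
    (\<Union>t\<in>X. ext_ideal (bas g) (par g) +>\<^bsub>tensor_alg (bas g) (par g)\<^esub> d_tensor g t)"

definition cohomology ::
    "('f::field_char_0, 'b) lsa \<Rightarrow> ('f, ('b list \<Rightarrow>\<^sub>0 'f) set set) galg" where
  "cohomology g =
    quot_alg (sub_alg (cochains g) {X \<in> carrier (cochains g). d_ext g X = \<zero>\<^bsub>cochains g\<^esub>})
      (d_ext g ` carrier (cochains g))"

lemma d_word_append:
  "d_word g (v @ w) = d_word g v * wd w + (- 1) ^ length v * (wd v * d_word g w)"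
proof (induction v)
  case Nil
  have "wd [] = (1 :: 'a list \<Rightarrow>\<^sub>0 'b)"
    by (metis single_one zero_list_def)
  then show ?case by simp
next
  case (Cons b v)
  have wd_app: "wd (x @ y) = (wd x * wd y :: 'a list \<Rightarrow>\<^sub>0 'b)" for x y
    by (simp add: mult_single plus_list_def)
  have comm: "wd [b] * ((- 1) ^ k * y) = (- 1) ^ k * (wd [b] * y)"
    for k :: nat and y :: "'a list \<Rightarrow>\<^sub>0 'b"
    by (cases "even k") simp_all
  have "wd (b # v) = (wd [b] * wd v :: 'a list \<Rightarrow>\<^sub>0 'b)"
    using wd_app[of "[b]" v] by simp
  then show ?case
    by (simp add: Cons.IH wd_app comm algebra_simps)
qed


section \<open>The Heisenberg Lie superalgebra \<open>ba\<^sub>n\<close>\<close>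

datatype ba_basis = X nat | Y nat | Z

definition ba :: "nat \<Rightarrow> ('f::field, ba_basis) lsa" where
  "ba n =
    \<lparr> bas = X ` {1..n} \<union> Y ` {1..n} \<union> {Z},
      par = (\<lambda>b. case b of X i \<Rightarrow> 0 | Y i \<Rightarrow> 1 | Z \<Rightarrow> 1),
      brk = (\<lambda>a b c. case (a, b, c) of
          (X i, Y j, Z) \<Rightarrow> (if i = j then 1 else 0)
        | (Y j, X i, Z) \<Rightarrow> (if i = j then - 1 else 0)
        | _ \<Rightarrow> 0) \<rparr>"

lemma lie_superalgebra_ba: "lie_superalgebra (ba n :: ('f::field, ba_basis) lsa)"
proof -
  have 1: "brk (ba n) a b m * brk (ba n) m c e = (0::'f)" for a b c m e
    by (cases m) (auto simp: ba_def split: ba_basis.splits)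
  have 2: "brk (ba n) b c m * brk (ba n) a m e = (0::'f)" for a b c m e
    by (cases m) (auto simp: ba_def split: ba_basis.splits)
  show ?thesis
    unfolding lie_superalgebra_def 1 2
    by (auto simp: ba_def ksign_def split: ba_basis.splits)
qed

text \<open>Modulo \<open>ext_ideal\<close>, the value at \<open>Z\<close> is \<open>\<Sum> x\<^sub>i\<^sup>* \<and> y\<^sub>i\<^sup>*\<close>.\<close>

lemma d_gen_ba:
  "d_gen (ba n) (X i) = 0" "d_gen (ba n) (Y i) = 0"
  "d_gen (ba n) Z =
    (\<Sum>i=1..n. cst (1/2) * (wd [X i] * wd [Y i] - wd [Y i] * wd [X i])
       :: ba_basis list \<Rightarrow>\<^sub>0 'f::field_char_0)"
proof -
  show "d_gen (ba n) (X i) = 0" "d_gen (ba n) (Y i) = 0"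
    by (auto simp: d_gen_def ba_def split: ba_basis.splits intro!: sum.neutral)
  define P where "P a b = (Poly_Mapping.single [a, b] (brk (ba n) a b Z / 2)
    :: ba_basis list \<Rightarrow>\<^sub>0 'f)" for a b
  have inner: "(\<Sum>b\<in>bas (ba n :: ('f, _) lsa). P a b) =
      (\<Sum>j=1..n. P a (X j)) + (\<Sum>j=1..n. P a (Y j)) + P a Z" for a
  proof -
    have "(\<Sum>b\<in>X ` {1..n} \<union> Y ` {1..n} \<union> {Z}. P a b) =
        (\<Sum>b\<in>X ` {1..n}. P a b) + (\<Sum>b\<in>Y ` {1..n}. P a b) + P a Z"
      by (subst sum.union_disjoint; (subst sum.union_disjoint)?) auto
    then show ?thesis
      by (simp add: ba_def sum.reindex inj_on_def)
  qed
  have outer: "(\<Sum>a\<in>bas (ba n :: ('f, _) lsa). Q a) =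
      (\<Sum>j=1..n. Q (X j)) + (\<Sum>j=1..n. Q (Y j)) + Q Z" for Q :: "_ \<Rightarrow> ba_basis list \<Rightarrow>\<^sub>0 'f"
  proof -
    have "(\<Sum>b\<in>X ` {1..n} \<union> Y ` {1..n} \<union> {Z}. Q b) =
        (\<Sum>b\<in>X ` {1..n}. Q b) + (\<Sum>b\<in>Y ` {1..n}. Q b) + Q Z"
      by (subst sum.union_disjoint; (subst sum.union_disjoint)?) auto
    then show ?thesis
      by (simp add: ba_def sum.reindex inj_on_def)
  qed
  have P: "P (X i) (X j) = 0" "P (Y i) (Y j) = 0" "P a Z = 0" "P Z a = 0"
    "P (X i) (Y j) = (if i = j then Poly_Mapping.single [X i, Y i] (1/2) else 0)"
    "P (Y i) (X j) = (if i = j then - Poly_Mapping.single [Y i, X i] (1/2) else 0)" for i j a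
    by (auto simp: P_def ba_def single_uminus split: ba_basis.splits)
  have "d_gen (ba n) Z = (\<Sum>a\<in>bas (ba n :: ('f, _) lsa). \<Sum>b\<in>bas (ba n :: ('f, _) lsa). P a b)"
    by (simp add: d_gen_def P_def)
  also have "\<dots> = (\<Sum>i=1..n. Poly_Mapping.single [X i, Y i] (1/2) - Poly_Mapping.single [Y i, X i] (1/2))"
    by (simp add: inner outer P sum.delta sum_subtractf sum_negf)
  also have "\<dots> = (\<Sum>i=1..n. cst (1/2) * (wd [X i] * wd [Y i] - wd [Y i] * wd [X i]))"
    by (simp add: mult_single plus_list_def right_diff_distrib)
  finally show "d_gen (ba n) Z =
    (\<Sum>i=1..n. cst (1/2) * (wd [X i] * wd [Y i] - wd [Y i] * wd [X i])
       :: ba_basis list \<Rightarrow>\<^sub>0 'f)" .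
qed


section \<open>The algebras \<open>G\<^sub>n\<close> and \<open>V\<close>\<close>

datatype gen = Xi nat | Eta nat

abbreviation xi :: "nat \<Rightarrow> gen list \<Rightarrow>\<^sub>0 'f::field" where "xi i \<equiv> wd [Xi i]"
abbreviation eta :: "nat \<Rightarrow> gen list \<Rightarrow>\<^sub>0 'f::field" where "eta i \<equiv> wd [Eta i]"

definition G_relations :: "nat \<Rightarrow> (gen list \<Rightarrow>\<^sub>0 'f::field) set" where
  "G_relations n =
     {xi i * xi j + xi j * xi i | i j. i \<in> {1..n} \<and> j \<in> {1..n}} \<union>
     {xi i * eta j + eta j * xi i | i j. i \<in> {1..n} \<and> j \<in> {1..n}} \<union>
     {eta i * eta j - eta j * eta i | i j. i \<in> {1..n} \<and> j \<in> {1..n}} \<union>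
     {\<Sum>k=1..n. eta k * xi k}"

definition G_alg :: "nat \<Rightarrow> ('f::field, (gen list \<Rightarrow>\<^sub>0 'f) set) galg" where
  "G_alg n = (let T = tensor_alg (Xi ` {1..n} \<union> Eta ` {1..n})
                        (\<lambda>g. case g of Xi i \<Rightarrow> 0 | Eta i \<Rightarrow> 1)
              in quot_alg T (Idl\<^bsub>T\<^esub> (G_relations n)))"

text \<open>\<open>v\<^sub>i\<close> is \<open>Poly_Mapping.single i 1\<close>. The algebra has no unit, so the field \<open>one\<close> is junk.\<close>

definition V_alg :: "nat \<Rightarrow> ('f::field, nat \<Rightarrow>\<^sub>0 'f) galg" where
  "V_alg n =
    \<lparr> carrier = {v. \<forall>i\<in>Poly_Mapping.keys v. 1 \<le> i},
      mult = (\<lambda>_ _. 0), one = undefined, zero = 0, add = (+),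
      smult = (\<lambda>c v. Poly_Mapping.map ((*) c) v),
      zgr = (\<lambda>k. {v. \<forall>i\<in>Poly_Mapping.keys v. 1 \<le> i \<and> int n + int i = k}),
      pgr = (\<lambda>p. {v. \<forall>i\<in>Poly_Mapping.keys v. 1 \<le> i \<and> of_nat i = p}) \<rparr>"


section \<open>Numerical functions\<close>

text \<open>
  The subtraction \<open>s + i - 1\<close> truncates only for \<open>s = i = 0\<close>, where the binomial coefficient
  is \<open>1\<close> as it should be.
\<close>

definition sdim :: "int \<Rightarrow> nat \<Rightarrow> nat \<Rightarrow> int" where
  "sdim k r s = (if k < 0 then 0
     else \<Sum>i=0..nat k. int ((r choose (nat k - i)) * ((s + i - 1) choose i)))"

definition kdelta :: "int \<Rightarrow> int \<Rightarrow> int" where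
  "kdelta a b = (if a = b then 1 else 0)"

end

theory Submission
  imports Defs "HOL-Library.Function_Algebras"
begin

text \<open>
  The cochain algebra \<open>C\<close> is generated by \<open>x\<^sub>i\<close>, \<open>y\<^sub>i\<close>, \<open>z\<close> (stars omitted). It is exterior in the
  \<open>x\<^sub>i\<close> and polynomial in the \<open>y\<^sub>i\<close> and \<open>z\<close>. Let \<open>A\<close> be the subalgebra generated by the \<open>x\<^sub>i\<close> and
  \<open>y\<^sub>i\<close>, let \<open>\<omega> = \<Sum> x\<^sub>j y\<^sub>j = d z\<close> and let \<open>\<tau> = x\<^sub>1 \<cdots> x\<^sub>n\<close>. As \<open>d\<close> is a derivation that vanishes on
  \<open>A\<close>, it is the operator \<open>\<omega> \<partial>/\<partial>z\<close>. In characteristic \<open>0\<close> the derivative \<open>\<partial>/\<partial>z\<close> is onto, so the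
  coboundaries are \<open>\<omega> C\<close>, and a cochain is a cocycle iff \<open>\<omega>\<close> kills the part of it that
  contains \<open>z\<close>.

  Since \<open>\<omega>\<close> has even degree and odd parity, \<open>\<omega>\<^sup>2 = 0\<close>; multiplication by \<open>\<omega>\<close> is the differential
  of the Koszul complex of \<open>y\<^sub>1, \<dots>, y\<^sub>n\<close>. It is exact up to the multiples of \<open>\<tau>\<close> by a power of \<open>z\<close>:
  with \<open>h = \<Sum> \<partial>/\<partial>y\<^sub>j \<partial>/\<partial>x\<^sub>j\<close>, the operator \<open>h \<omega> + \<omega> h\<close> multiplies each monomial by the number of
  its factors \<open>y\<close> plus the number of the \<open>x\<^sub>i\<close> that do not occur in it (lemma
  \<open>homotopy_identity\<close>), and this is nonzero except for \<open>\<tau> z\<^sup>k\<close>. Hence the cohomology is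
  \<open>A / \<omega> A\<close> plus the span of the classes \<open>\<tau> z\<^sup>k\<close>, \<open>k \<ge> 1\<close>. The first summand is \<open>G\<^sub>n\<close> by the
  defining relations of \<open>G\<^sub>n\<close>, the second is \<open>V\<close>: a product of \<open>\<tau> z\<^sup>k\<close> with a letter \<open>x\<^sub>i\<close> or \<open>y\<^sub>i\<close> is
  killed by \<open>\<omega>\<close> and has no term \<open>\<tau> z\<^sup>l\<close>, so it is a coboundary (lemma \<open>exact_full\<close>).

  Membership in the ideals that define the algebras is decided in a model. The free algebra acts
  on the functions on exponent vectors by multiplication operators with the signs of the
  super-exterior algebra, and \<open>ev t\<close> is the value of \<open>t\<close> on the empty monomial. The ideal of the
  exterior algebra is the kernel of \<open>ev\<close> (lemma \<open>ext_ideal_eq\<close>): modulo the quadratic relations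
  every word is a multiple of a normally ordered one, and \<open>ev\<close> sends the normally ordered words
  to a basis. Likewise the ideal of \<open>G\<^sub>n\<close> is the preimage of the multiples of \<open>\<omega>\<close> (lemma
  \<open>G_ideal_eq\<close>).

  For the dimensions let \<open>A\<^sub>k\<close> be the degree \<open>k\<close> part of \<open>A\<close>. Then \<open>H\<^sup>k\<close> is \<open>A\<^sub>k / \<omega> A\<^bsub>k-2\<^esub>\<close>, plus one
  dimension if \<open>k > n\<close>. The kernel of \<open>\<omega>\<close> on \<open>A\<^sub>k\<close> is \<open>\<omega> A\<^bsub>k-2\<^esub>\<close>, plus the line of \<open>\<tau>\<close> if \<open>k = n\<close>, so the
  numbers \<open>dim \<omega> A\<^sub>k\<close> satisfy a recursion whose solution is the alternating sum.
\<close>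

section \<open>Algebras presented as quotients\<close>

text \<open>
  All algebras of the theorem are subquotients \<open>R / N\<close> of a free algebra, with \<open>cl\<close> sending an
  element of \<open>R\<close> to its class. The iterated construction of the cohomology, cosets of cosets of
  tensors, is reduced to one such quotient by the lemmas \<open>quot\<close> and \<open>sub\<close>.
\<close>

locale presentation =
  fixes A :: "('f::field, 'v) galg" and R N :: "'r::ring_1 set" and sc :: "'f \<Rightarrow> 'r"
    and zg :: "int \<Rightarrow> 'r set" and pg :: "bit \<Rightarrow> 'r set" and cl :: "'r \<Rightarrow> 'v"
  assumes R_one: "1 \<in> R" and R_diff: "\<And>x y. x \<in> R \<Longrightarrow> y \<in> R \<Longrightarrow> x - y \<in> R"
    and R_mult: "\<And>x y. x \<in> R \<Longrightarrow> y \<in> R \<Longrightarrow> x * y \<in> R" and R_sc: "\<And>c. sc c \<in> R"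
    and N_sub: "N \<subseteq> R" and N_zero: "0 \<in> N" and N_diff: "\<And>x y. x \<in> N \<Longrightarrow> y \<in> N \<Longrightarrow> x - y \<in> N"
    and N_left: "\<And>r x. r \<in> R \<Longrightarrow> x \<in> N \<Longrightarrow> r * x \<in> N"
    and N_right: "\<And>r x. r \<in> R \<Longrightarrow> x \<in> N \<Longrightarrow> x * r \<in> N"
    and carrier_eq: "carrier A = cl ` R"
    and cl_eq: "\<And>x y. x \<in> R \<Longrightarrow> y \<in> R \<Longrightarrow> cl x = cl y \<longleftrightarrow> x - y \<in> N"
    and mult_cl: "\<And>x y. x \<in> R \<Longrightarrow> y \<in> R \<Longrightarrow> cl x \<otimes>\<^bsub>A\<^esub> cl y = cl (x * y)"
    and add_cl: "\<And>x y. x \<in> R \<Longrightarrow> y \<in> R \<Longrightarrow> cl x \<oplus>\<^bsub>A\<^esub> cl y = cl (x + y)"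
    and one_cl: "\<one>\<^bsub>A\<^esub> = cl 1" and zero_cl: "\<zero>\<^bsub>A\<^esub> = cl 0"
    and smult_cl: "\<And>c x. x \<in> R \<Longrightarrow> c \<odot>\<^bsub>A\<^esub> cl x = cl (sc c * x)"
    and zgr_eq: "\<And>k. zgr A k = cl ` (R \<inter> zg k)"
    and pgr_eq: "\<And>p. pgr A p = cl ` (R \<inter> pg p)"
begin

lemma R_zero: "0 \<in> R" using R_diff[OF R_one R_one] by simp
lemma R_minus: "x \<in> R \<Longrightarrow> - x \<in> R" using R_diff[OF R_zero, of x] by simp
lemma R_add: "x \<in> R \<Longrightarrow> y \<in> R \<Longrightarrow> x + y \<in> R" using R_diff[of x "- y"] R_minus[of y] by simp
lemma ring: "ring A"
proof (rule ringI)
  show "abelian_group A"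
  proof (rule abelian_groupI)
    fix x assume "x \<in> carrier A"
    then obtain a where a: "a \<in> R" "x = cl a" by (auto simp: carrier_eq)
    show "\<exists>y\<in>carrier A. y \<oplus>\<^bsub>A\<^esub> x = \<zero>\<^bsub>A\<^esub>"
      by (rule bexI[of _ "cl (- a)"]) (use a in \<open>auto simp: add_cl R_minus zero_cl carrier_eq\<close>)
  qed (auto simp: carrier_eq add_cl R_add zero_cl R_zero algebra_simps)
  show "monoid A"
    by (rule monoidI) (auto simp: carrier_eq mult_cl R_mult one_cl R_one algebra_simps)
qed (auto simp: carrier_eq add_cl mult_cl R_add R_mult algebra_simps)

lemma minus_cl: assumes "x \<in> R" "y \<in> R" shows "cl x \<ominus>\<^bsub>A\<^esub> cl y = cl (x - y)"
proof -
  interpret ring A by (rule ring)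
  have "\<ominus>\<^bsub>A\<^esub> cl y = cl (- y)"
    by (rule minus_equality) (use assms in \<open>auto simp: add_cl R_minus zero_cl carrier_eq\<close>)
  then show ?thesis using assms by (simp add: a_minus_def add_cl R_minus)
qed

text \<open>
  Bounds a generated ideal from above: every ideal of \<open>R\<close> that contains \<open>N\<close> and the generators
  does so.
\<close>

lemma ideal_image:
  assumes "N' \<subseteq> R" "0 \<in> N'" "\<And>x y. x \<in> N' \<Longrightarrow> y \<in> N' \<Longrightarrow> x - y \<in> N'"
    "\<And>r x. r \<in> R \<Longrightarrow> x \<in> N' \<Longrightarrow> r * x \<in> N'" "\<And>r x. r \<in> R \<Longrightarrow> x \<in> N' \<Longrightarrow> x * r \<in> N'"
  shows "ideal (cl ` N') A"
proof -
  interpret ring A by (rule ring)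
  have m: "- x \<in> N'" if "x \<in> N'" for x using assms(3)[OF assms(2) that] by simp
  have a: "x + y \<in> N'" if "x \<in> N'" "y \<in> N'" for x y using assms(3)[OF that(1) m[OF that(2)]] by simp
  have inv: "inv\<^bsub>add_monoid A\<^esub> cl x = cl (- x)" if "x \<in> N'" for x
  proof -
    have "\<ominus>\<^bsub>A\<^esub> cl x = cl (- x)"
      by (rule minus_equality) (use assms that in \<open>auto simp: add_cl R_minus zero_cl carrier_eq subset_iff\<close>)
    then show ?thesis by (simp add: a_inv_def)
  qed
  show ?thesis
  proof (rule idealI)
    show "subgroup (cl ` N') (add_monoid A)"
    proof (rule subgroup.intro)
      show "inv\<^bsub>add_monoid A\<^esub> x \<in> cl ` N'" if "x \<in> cl ` N'" for x using that m inv by auto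
    qed (use assms a in \<open>auto simp: carrier_eq subset_iff add_cl zero_cl\<close>)
  qed (use assms ring in \<open>auto simp: carrier_eq subset_iff mult_cl\<close>)
qed

text \<open>
  A coset of \<open>cl ` N'\<close> consists of the old classes of all \<open>y\<close> with \<open>y - x \<in> N'\<close>. Hence it depends on
  \<open>x\<close> modulo \<open>N'\<close> only, and the operations on cosets are those on representatives.
\<close>

lemma quot:
  assumes N': "N' \<subseteq> R" "N \<subseteq> N'" "\<And>x y. x \<in> N' \<Longrightarrow> y \<in> N' \<Longrightarrow> x - y \<in> N'"
    "\<And>r x. r \<in> R \<Longrightarrow> x \<in> N' \<Longrightarrow> r * x \<in> N'" "\<And>r x. r \<in> R \<Longrightarrow> x \<in> N' \<Longrightarrow> x * r \<in> N'"
  shows "presentation (quot_alg A (cl ` N')) R N' sc zg pg (\<lambda>x. cl ` N' +>\<^bsub>A\<^esub> cl x)"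
proof -
  let ?q = "\<lambda>x. cl ` N' +>\<^bsub>A\<^esub> cl x"
  have z: "0 \<in> N'" using N_zero N' by auto
  have m: "- x \<in> N'" if "x \<in> N'" for x using N'(3)[OF z that] by simp
  have a: "x + y \<in> N'" if "x \<in> N'" "y \<in> N'" for x y using N'(3)[OF that(1) m[OF that(2)]] by simp
  have q: "?q x = cl ` {y \<in> R. y - x \<in> N'}" if "x \<in> R" for x
  proof -
    have "?q x = (\<lambda>i. cl (i + x)) ` N'"
      using that N' by (auto simp: a_r_coset_def' add_cl subset_iff)
    also have "\<dots> = cl ` (\<lambda>i. i + x) ` N'" by (simp add: image_image)
    also have "(\<lambda>i. i + x) ` N' = {y \<in> R. y - x \<in> N'}"
    proof (intro equalityI subsetI)
      fix y assume "y \<in> (\<lambda>i. i + x) ` N'" then show "y \<in> {y \<in> R. y - x \<in> N'}"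
        using N' that R_add by auto
    next
      fix y assume "y \<in> {y \<in> R. y - x \<in> N'}"
      then have "y - x \<in> N'" "y = (y - x) + x" by auto
      then show "y \<in> (\<lambda>i. i + x) ` N'" by blast
    qed
    finally show ?thesis .
  qed
  have mem: "cl y \<in> ?q x \<longleftrightarrow> y - x \<in> N'" if xy: "x \<in> R" "y \<in> R" for x y
  proof
    assume "cl y \<in> ?q x"
    then obtain y' where "cl y = cl y'" "y' \<in> R" "y' - x \<in> N'" using q[OF xy(1)] by auto
    then have "y - y' \<in> N'" "y' - x \<in> N'" using cl_eq xy N' by auto
    then have "(y - y') + (y' - x) \<in> N'" by (rule a)
    then show "y - x \<in> N'" by simp
  qed (use q xy in auto)
  have qeq: "?q x = ?q y \<longleftrightarrow> x - y \<in> N'" if xy: "x \<in> R" "y \<in> R" for x y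
  proof
    assume "?q x = ?q y"
    moreover have "cl x \<in> ?q x" using mem[of x x] xy z by auto
    ultimately show "x - y \<in> N'" using mem xy by auto
  next
    assume d: "x - y \<in> N'"
    have "w - x \<in> N' \<longleftrightarrow> w - y \<in> N'" for w
      using a[of "w - x" "x - y"] N'(3)[of "w - y" "x - y"] d by auto
    then show "?q x = ?q y" using q xy by auto
  qed
  have qrep: "\<exists>b\<in>R. u = cl b \<and> b - x \<in> N'" if "u \<in> ?q x" "x \<in> R" for u x
    using that q by auto
  have self: "cl x \<in> ?q x" if "x \<in> R" for x using mem[of x x] that z by auto
  show ?thesis
  proof
    show "carrier (quot_alg A (cl ` N')) = ?q ` R"
      by (auto simp: quot_alg_def FactRing_def A_RCOSETS_def' carrier_eq)
    show "?q x = ?q y \<longleftrightarrow> x - y \<in> N'" if "x \<in> R" "y \<in> R" for x y using qeq that .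
    show "?q x \<otimes>\<^bsub>quot_alg A (cl ` N')\<^esub> ?q y = ?q (x * y)" if xy: "x \<in> R" "y \<in> R" for x y
    proof -
      have "cl ` N' +>\<^bsub>A\<^esub> (u \<otimes>\<^bsub>A\<^esub> v) = ?q (x * y)" if uv: "u \<in> ?q x" "v \<in> ?q y" for u v
      proof -
        obtain b c where b: "b \<in> R" "u = cl b" "b - x \<in> N'" and c: "c \<in> R" "v = cl c" "c - y \<in> N'"
          using qrep uv xy by metis
        have "(b - x) * c + x * (c - y) \<in> N'" using a N' b c xy by auto
        then have "b * c - x * y \<in> N'" by (simp add: algebra_simps)
        then show ?thesis using b c xy qeq by (simp add: mult_cl R_mult)
      qed
      then have "(\<Union>u\<in>?q x. \<Union>v\<in>?q y. cl ` N' +>\<^bsub>A\<^esub> (u \<otimes>\<^bsub>A\<^esub> v)) = ?q (x * y)"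
        using self xy by blast
      then show ?thesis by (simp add: quot_alg_def FactRing_def rcoset_mult_def)
    qed
    show "?q x \<oplus>\<^bsub>quot_alg A (cl ` N')\<^esub> ?q y = ?q (x + y)" if xy: "x \<in> R" "y \<in> R" for x y
    proof -
      have 1: "(x' + y') - (x + y) \<in> N'" if "x' - x \<in> N'" "y' - y \<in> N'" for x' y'
        using a[OF that] by (simp add: algebra_simps)
      have 2: "\<exists>x' y'. x' \<in> R \<and> x' - x \<in> N' \<and> y' \<in> R \<and> y' - y \<in> N' \<and> w = x' + y'"
        if "w \<in> R" "w - (x + y) \<in> N'" for w
        by (rule exI[of _ "w - y"], rule exI[of _ y]) (use that xy z R_diff in \<open>auto simp: algebra_simps\<close>)
      have "?q x <+>\<^bsub>A\<^esub> ?q y = ?q (x + y)"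
        unfolding q[OF xy(1)] q[OF xy(2)] q[OF R_add[OF xy]] set_add_def'
        using 1 2 by (auto simp: add_cl R_add intro!: imageI) (metis (mono_tags, lifting) add_cl image_eqI mem_Collect_eq)
      then show ?thesis by (simp add: quot_alg_def FactRing_def)
    qed
    show "\<one>\<^bsub>quot_alg A (cl ` N')\<^esub> = ?q 1" by (simp add: quot_alg_def FactRing_def one_cl)
    have "cl ` N' = ?q 0" using q[OF R_zero] N'(1) by (auto simp: subset_iff)
    then show "\<zero>\<^bsub>quot_alg A (cl ` N')\<^esub> = ?q 0" by (simp add: quot_alg_def FactRing_def)
    show "c \<odot>\<^bsub>quot_alg A (cl ` N')\<^esub> ?q x = ?q (sc c * x)" if x: "x \<in> R" for c x
    proof -
      have "cl ` N' +>\<^bsub>A\<^esub> (c \<odot>\<^bsub>A\<^esub> u) = ?q (sc c * x)" if u: "u \<in> ?q x" for u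
      proof -
        obtain b where b: "b \<in> R" "u = cl b" "b - x \<in> N'" using qrep u x by metis
        have "sc c * (b - x) \<in> N'" using N' R_sc b by auto
        then have "sc c * b - sc c * x \<in> N'" by (simp add: algebra_simps)
        then show ?thesis using b x qeq by (simp add: smult_cl R_mult R_sc)
      qed
      then have "(\<Union>u\<in>?q x. cl ` N' +>\<^bsub>A\<^esub> (c \<odot>\<^bsub>A\<^esub> u)) = ?q (sc c * x)" using self x by blast
      then show ?thesis by (simp add: quot_alg_def)
    qed
    show "zgr (quot_alg A (cl ` N')) k = ?q ` (R \<inter> zg k)" for k
      by (auto simp: quot_alg_def zgr_eq)
    show "pgr (quot_alg A (cl ` N')) p = ?q ` (R \<inter> pg p)" for p
      by (auto simp: quot_alg_def pgr_eq)
  qed (use R_one R_diff R_mult R_sc N' z in auto)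
qed

text \<open>
  The graded parts of a subalgebra are intersections of images under \<open>cl\<close>. They are images of
  intersections because \<open>R'\<close> is a union of classes.
\<close>

lemma sub:
  assumes R': "R' \<subseteq> R" "N \<subseteq> R'" "1 \<in> R'" "\<And>c. sc c \<in> R'"
    "\<And>x y. x \<in> R' \<Longrightarrow> y \<in> R' \<Longrightarrow> x - y \<in> R'" "\<And>x y. x \<in> R' \<Longrightarrow> y \<in> R' \<Longrightarrow> x * y \<in> R'"
  shows "presentation (sub_alg A (cl ` R')) R' N sc zg pg cl"
proof -
  have z: "0 \<in> R'" using N_zero R' by auto
  have sat: "x \<in> R'" if "x \<in> R" "y \<in> R'" "cl x = cl y" for x y
  proof -
    have "x - y \<in> R'" using cl_eq that R' by auto
    then have "(x - y) - (0 - y) \<in> R'" using R'(5) that z by blast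
    then show ?thesis by simp
  qed
  have g: "cl ` (R \<inter> G) \<inter> cl ` R' = cl ` (R' \<inter> G)" for G using sat R'(1) by auto
  show ?thesis
    by standard (use R' N_zero N_diff N_left N_right in \<open>auto simp: sub_alg_def cl_eq mult_cl add_cl
      one_cl zero_cl smult_cl zgr_eq pgr_eq g subset_iff\<close>)
qed

end

abbreviation keys :: "('k \<Rightarrow>\<^sub>0 'a::zero) \<Rightarrow> 'k set" where
  "keys \<equiv> Poly_Mapping.keys"

abbreviation lookup :: "('k \<Rightarrow>\<^sub>0 'a::zero) \<Rightarrow> 'k \<Rightarrow> 'a" where
  "lookup \<equiv> Poly_Mapping.lookup"

abbreviation single :: "'k \<Rightarrow> 'a \<Rightarrow> ('k \<Rightarrow>\<^sub>0 'a::zero)" where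
  "single \<equiv> Poly_Mapping.single"

section \<open>The polynomial model of a super-exterior algebra\<close>

text \<open>
  The coefficient is an argument of \<open>F\<close>, so that the linear extension needs no scalar action on
  the target.
\<close>

definition ext_sum :: "('k \<Rightarrow> 'a::zero \<Rightarrow> 'm::comm_monoid_add) \<Rightarrow> ('k \<Rightarrow>\<^sub>0 'a) \<Rightarrow> 'm" where
  "ext_sum F t = (\<Sum>k\<in>keys t. F k (lookup t k))"

lemma ext_sum_superset:
  assumes "finite S" "keys t \<subseteq> S" "\<And>k. F k 0 = 0"
  shows "ext_sum F t = (\<Sum>k\<in>S. F k (lookup t k))"
  unfolding ext_sum_def by (rule sum.mono_neutral_left) (use assms in \<open>auto simp: in_keys_iff\<close>)

lemma ext_sum_add:
  fixes F :: "'k \<Rightarrow> 'a::monoid_add \<Rightarrow> 'm::ab_group_add"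
  assumes "\<And>k a b. F k (a + b) = F k a + F k b"
  shows "ext_sum F (s + t) = ext_sum F s + ext_sum F t"
proof -
  have z: "F k 0 = 0" for k using assms[of k 0 0] by simp
  let ?S = "keys s \<union> keys t"
  have "keys (s + t) \<subseteq> ?S" by (rule Poly_Mapping.keys_add)
  then show ?thesis
    by (simp add: ext_sum_superset[of ?S _ F] z lookup_add assms sum.distrib)
qed

lemma ext_sum_single: "F k 0 = 0 \<Longrightarrow> ext_sum F (single k a) = F k a"
  by (cases "a = 0") (simp_all add: ext_sum_def)

lemma additive_zero: "(\<And>s t. F (s + t) = F s + F t) \<Longrightarrow> F (0::'a::monoid_add) = (0::'b::ab_group_add)"
  by (metis add.right_neutral add_cancel_right_right)

lemma additive_sum:
  assumes "\<And>s t. F (s + t) = F s + (F t :: 'b::ab_group_add)"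
  shows "F (sum h S) = (\<Sum>i\<in>S. F (h i :: 'a::comm_monoid_add))"
  by (induction S rule: infinite_finite_induct) (simp_all add: assms additive_zero[of F])

lemma sum_singles: "(\<Sum>k\<in>keys t. single k (lookup t k)) = t"
  by (rule poly_mapping_eqI) (simp add: lookup_sum lookup_single when_def in_keys_iff)

text \<open>
  Applied to one variable at a time, this reduces identities between multilinear expressions to
  words.
\<close>

lemma additive_eqI:
  fixes F G :: "('k \<Rightarrow>\<^sub>0 'a::comm_monoid_add) \<Rightarrow> 'm::ab_group_add"
  assumes F: "\<And>s t. F (s + t) = F s + F t" and G: "\<And>s t. G (s + t) = G s + G t"
    and eq: "\<And>k a. k \<in> keys t \<Longrightarrow> F (single k a) = G (single k a)"
  shows "F t = G t"
proof -
  have "F t = (\<Sum>k\<in>keys t. F (single k (lookup t k)))"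
    by (subst sum_singles[of t, symmetric], subst additive_sum[of F]) (simp_all add: F)
  also have "\<dots> = (\<Sum>k\<in>keys t. G (single k (lookup t k)))"
    using eq by simp
  also have "\<dots> = G t"
    by (subst (2) sum_singles[of t, symmetric], subst additive_sum[of G]) (simp_all add: G)
  finally show ?thesis .
qed

definition fscale :: "'f::field \<Rightarrow> ('k \<Rightarrow> 'f) \<Rightarrow> 'k \<Rightarrow> 'f" where
  "fscale c f = (\<lambda>m. c * f m)"

lemma fscale_simps [simp]:
  "fscale c (f + g) = fscale c f + fscale c g" "fscale (c + d) f = fscale c f + fscale d f"
  "fscale c (fscale d f) = fscale (c * d) f" "fscale 1 f = f" "fscale 0 f = 0" "fscale c 0 = 0"
  "fscale c (f - g) = fscale c f - fscale c g" "fscale c (- f) = - fscale c f" "fscale (- c) f = - fscale c f"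
  by (auto simp: fscale_def fun_eq_iff algebra_simps)

interpretation vs: vector_space "fscale :: 'f::field \<Rightarrow> ('k \<Rightarrow> 'f) \<Rightarrow> 'k \<Rightarrow> 'f"
  by standard simp_all

lemma sum_apply: "(\<Sum>i\<in>S. h i) x = (\<Sum>i\<in>S. h i x :: 'a::comm_monoid_add)"
  by (induction S rule: infinite_finite_induct) simp_all

lemma cst_mult_single [simp]:
  "cst c * single w a = single w (c * a)"
  by (simp add: mult_single plus_list_def)

lemma cst_one [simp]: "cst 1 = 1" by (metis single_one zero_list_def)

lemma cst_minus_one: "cst (- 1) = - 1" by (simp add: single_uminus)

lemma keys_mult_list:
  "keys (s * t) \<subseteq> {u @ v | u v. u \<in> keys s \<and> v \<in> keys t}"
  using keys_mult[of s t] by (simp add: plus_list_def)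

text \<open>
  The super-exterior algebra on the letters \<open>bs\<close> is modelled by functions that give the
  coefficient of each monomial. A monomial is its exponent vector, and its factors are taken in
  the order of \<open>bs\<close>. In terms of coefficients an operator is a pullback along a shift of exponents,
  so that the relations between operators hold pointwise and for arbitrary functions.
\<close>

locale super_exterior =
  fixes bs :: "'b list" and par :: "'b \<Rightarrow> bit"
  assumes distinct_bs: "distinct bs"
begin

text \<open>
  The sign in \<open>b c = \<plusminus> c b\<close>.
\<close>

definition tau :: "'b \<Rightarrow> 'b \<Rightarrow> 'f::field_char_0" where
  "tau b c = - ksign (par b) (par c)"

definition pre :: "'b \<Rightarrow> 'b set" where
  "pre b = set (takeWhile (\<lambda>c. c \<noteq> b) bs)"

text \<open>
  The sign that a factor \<open>b\<close> picks up on its way from the left end of a monomial to its place.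
\<close>

definition esign :: "'b \<Rightarrow> ('b \<Rightarrow> nat) \<Rightarrow> 'f::field_char_0" where
  "esign b m = (\<Prod>c\<in>pre b. tau b c ^ m c)"

text \<open>
  Left multiplication by \<open>b\<close>. An even letter cannot occur twice, because even letters anticommute.
\<close>

definition lmul :: "'b \<Rightarrow> (('b \<Rightarrow> nat) \<Rightarrow> 'f::field_char_0) \<Rightarrow> ('b \<Rightarrow> nat) \<Rightarrow> 'f" where
  "lmul b f = (\<lambda>m. if m b = 0 \<or> par b = 0 \<and> 1 < m b then 0
     else esign b m * f (m(b := m b - 1)))"

text \<open>
  The left partial derivative with respect to \<open>b\<close>.
\<close>

definition pdv :: "'b \<Rightarrow> (('b \<Rightarrow> nat) \<Rightarrow> 'f::field_char_0) \<Rightarrow> ('b \<Rightarrow> nat) \<Rightarrow> 'f" where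
  "pdv b f = (\<lambda>m. if par b = 0 \<and> 0 < m b then 0
     else of_nat (Suc (m b)) * esign b m * f (m(b := Suc (m b))))"

definition actw :: "'b list \<Rightarrow> (('b \<Rightarrow> nat) \<Rightarrow> 'f::field_char_0) \<Rightarrow> ('b \<Rightarrow> nat) \<Rightarrow> 'f" where
  "actw w f = foldr lmul w f"

definition act :: "('b list \<Rightarrow>\<^sub>0 'f::field_char_0) \<Rightarrow> (('b \<Rightarrow> nat) \<Rightarrow> 'f) \<Rightarrow> ('b \<Rightarrow> nat) \<Rightarrow> 'f" where
  "act t f = ext_sum (\<lambda>w c. fscale c (actw w f)) t"

definition mons :: "('b \<Rightarrow> nat) set" where
  "mons = {m. (\<forall>b. b \<notin> set bs \<longrightarrow> m b = 0) \<and> (\<forall>b. par b = 0 \<longrightarrow> m b \<le> 1)}"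

definition forms :: "(('b \<Rightarrow> nat) \<Rightarrow> 'f::field_char_0) set" where
  "forms = {f. finite {m. f m \<noteq> 0} \<and> (\<forall>m. f m \<noteq> 0 \<longrightarrow> m \<in> mons)}"

definition basisf :: "('b \<Rightarrow> nat) \<Rightarrow> ('b \<Rightarrow> nat) \<Rightarrow> 'f::field_char_0" where
  "basisf m = (\<lambda>m'. if m' = m then 1 else 0)"

definition ev :: "('b list \<Rightarrow>\<^sub>0 'f::field_char_0) \<Rightarrow> ('b \<Rightarrow> nat) \<Rightarrow> 'f" where
  "ev t = act t (basisf (\<lambda>_. 0))"

text \<open>
  The normally ordered word of a monomial, and below the corresponding element of the free algebra.
\<close>

definition nw :: "('b \<Rightarrow> nat) \<Rightarrow> 'b list" where
  "nw m = concat (map (\<lambda>b. replicate (m b) b) bs)"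

definition nf :: "(('b \<Rightarrow> nat) \<Rightarrow> 'f::field_char_0) \<Rightarrow> 'b list \<Rightarrow>\<^sub>0 'f" where
  "nf f = (\<Sum>m | f m \<noteq> 0. single (nw m) (f m))"

lemma tau_cases: "tau b c = (1::'f::field_char_0) \<or> tau b c = (- 1::'f)"
  by (auto simp: tau_def ksign_def)

lemma tau_sq [simp]: "tau b c * tau b c = (1::'f::field_char_0)"
  using tau_cases[of b c, where 'f = 'f] by auto

lemma tau_comm: "tau b c = tau c b" by (auto simp: tau_def ksign_def)

lemma finite_pre [simp]: "finite (pre b)" by (simp add: pre_def)

lemma not_pre_self [simp]: "b \<notin> pre b" by (auto simp: pre_def dest: set_takeWhileD)

lemma pre_total:
  assumes "b \<in> set bs" "c \<in> set bs" "b \<noteq> c" shows "c \<in> pre b \<longleftrightarrow> b \<notin> pre c"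
  using assms distinct_bs unfolding pre_def by (induction bs) (auto dest: set_takeWhileD)

lemma esign_sq [simp]: "esign b m * esign b m = (1::'f::field_char_0)"
  unfolding esign_def prod.distrib[symmetric] power_mult_distrib[symmetric] by simp

lemma esign_sq' [simp]: "esign b m * (esign b m * x) = (x::'f::field_char_0)"
  by (simp add: mult.assoc[symmetric])

lemma esign_nz [simp]: "esign b m \<noteq> (0::'f::field_char_0)"
  using esign_sq[of b m, where 'f = 'f] by force

lemma esign_upd_self [simp]: "esign b (m(b := k)) = esign b m"
  unfolding esign_def by (rule prod.cong) auto

lemma esign_upd_Suc:
  "esign b (m(c := Suc (m c))) = (if c \<in> pre b then tau b c else 1) * esign b m"
proof (cases "c \<in> pre b")
  case True
  then show ?thesis by (auto simp: esign_def prod.remove[of _ c] intro!: prod.cong)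
next
  case False
  then show ?thesis by (auto simp: esign_def intro!: prod.cong)
qed

lemma esign_dec:
  assumes "0 < m c"
  shows "esign b (m(c := m c - Suc 0)) = (if c \<in> pre b then tau b c else 1) * (esign b m :: 'f::field_char_0)"
proof -
  let ?m = "m(c := m c - Suc 0)"
  have "?m(c := Suc (?m c)) = m" using assms by auto
  then have "esign b m = (if c \<in> pre b then tau b c else 1) * (esign b ?m :: 'f)"
    using esign_upd_Suc[of b ?m c, where 'a='f] by simp
  then show ?thesis by auto
qed

lemma esign_dec_one:
  assumes "0 < m c" "\<not> Suc 0 < m c"
  shows "esign b (m(c := 0)) = (if c \<in> pre b then tau b c else 1) * (esign b m :: 'f::field_char_0)"
proof -
  have "m c - Suc 0 = 0" using assms by simp
  then show ?thesis using esign_dec[of m c b, where 'f = 'f] assms by simp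
qed

lemma esign_inc_zero:
  "m c = 0 \<Longrightarrow> esign b (m(c := Suc 0)) = (if c \<in> pre b then tau b c else 1) * (esign b m :: 'f::field_char_0)"
  using esign_upd_Suc[of b m c, where 'a = 'f] by simp

lemma esign_zero [simp]: "(\<And>c. c \<in> pre b \<Longrightarrow> m c = 0) \<Longrightarrow> esign b m = 1"
  by (simp add: esign_def)

lemma lmul_linear [simp]:
  "lmul b (f + g) = lmul b f + lmul b g" "lmul b (f - g) = lmul b f - lmul b g"
  "lmul b (fscale c f) = fscale c (lmul b f)" "lmul b 0 = 0" "lmul b (- f) = - lmul b f"
  by (auto simp: lmul_def fun_eq_iff fscale_def algebra_simps)

lemma pdv_linear [simp]:
  "pdv b (f + g) = pdv b f + pdv b g" "pdv b (f - g) = pdv b f - pdv b g"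
  "pdv b (fscale c f) = fscale c (pdv b f)" "pdv b 0 = 0" "pdv b (- f) = - pdv b f"
  by (auto simp: pdv_def fun_eq_iff fscale_def algebra_simps)

lemma lmul_sum: "lmul b (sum h S) = (\<Sum>i\<in>S. lmul b (h i))"
  by (rule additive_sum[of "lmul b"]) simp

lemma pdv_sum: "pdv b (sum h S) = (\<Sum>i\<in>S. pdv b (h i))"
  by (rule additive_sum[of "pdv b"]) simp

text \<open>
  Each of \<open>b\<close>, \<open>c\<close> has to pass the other one iff it comes later in the order. Exactly one of them does,
  so the two orders of multiplication differ by one factor \<open>tau b c\<close>.
\<close>

lemma lmul_commute:
  assumes "b \<in> set bs" "c \<in> set bs" "b \<noteq> c"
  shows "lmul b (lmul c f) = fscale (tau b c) (lmul c (lmul b f))"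
proof
  fix m
  show "lmul b (lmul c f) m = fscale (tau b c) (lmul c (lmul b f)) m"
    using assms pre_total[of b c]
    by (auto simp: lmul_def fscale_def esign_dec esign_dec_one fun_upd_twist tau_comm[of c b])
qed

lemma lmul_even_sq: "par b = 0 \<Longrightarrow> lmul b (lmul b f) = 0"
  by (auto simp: lmul_def fun_eq_iff)

lemma pdv_lmul_commute:
  assumes "b \<in> set bs" "c \<in> set bs" "b \<noteq> c"
  shows "pdv b (lmul c f) = fscale (tau b c) (lmul c (pdv b f))"
proof
  fix m
  show "pdv b (lmul c f) m = fscale (tau b c) (lmul c (pdv b f)) m"
    using assms pre_total[of b c]
    by (auto simp: lmul_def pdv_def fscale_def esign_dec esign_dec_one esign_inc_zero esign_upd_Suc fun_upd_twist tau_comm[of c b])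
qed

lemma lmul_pdv:
  assumes "f \<in> forms" shows "lmul b (pdv b f) m = of_nat (m b) * f m"
proof (cases "f m = 0")
  case True
  then show ?thesis by (cases "m b") (auto simp: lmul_def pdv_def fun_upd_idem)
next
  case False
  then have "m \<in> mons" using assms by (auto simp: forms_def)
  then have "par b = 0 \<Longrightarrow> m b \<le> 1" by (auto simp: mons_def)
  then show ?thesis by (cases "m b") (auto simp: lmul_def pdv_def fun_upd_idem)
qed

text \<open>
  Both \<open>pdv b (lmul b f)\<close> and \<open>lmul b (pdv b f)\<close> vanish on exponents above \<open>1\<close> of an even letter,
  whence the restriction to \<open>forms\<close>.
\<close>

lemma pdv_lmul_even:
  assumes "f \<in> forms" "par b = 0" shows "pdv b (lmul b f) = f - lmul b (pdv b f)"
proof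
  fix m
  show "pdv b (lmul b f) m = (f - lmul b (pdv b f)) m"
  proof (cases "f m = 0")
    case True
    then show ?thesis by (cases "m b") (auto simp: lmul_def pdv_def fun_upd_idem)
  next
    case False
    then have "m \<in> mons" using assms by (auto simp: forms_def)
    then have "m b \<le> 1" using assms by (auto simp: mons_def)
    then consider "m b = 0" | "m b = 1" by linarith
    then show ?thesis
    proof cases
      case 1
      then have "m(b := 0) = m" by auto
      then show ?thesis using 1 assms(2) by (simp add: lmul_def pdv_def)
    next
      case 2
      then have "m(b := Suc 0) = m" by auto
      then show ?thesis using 2 assms(2) by (simp add: lmul_def pdv_def)
    qed
  qed
qed

lemma pdv_lmul_odd:
  assumes "par b = 1" shows "pdv b (lmul b f) = f + lmul b (pdv b f)"
  by (rule ext) (use assms in \<open>auto simp: lmul_def pdv_def algebra_simps\<close>)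

lemma lmul_nz:
  assumes "lmul b f m \<noteq> 0"
  shows "0 < m b" "par b = 0 \<Longrightarrow> m b = 1" "f (m(b := m b - 1)) \<noteq> 0"
  using assms by (auto simp: lmul_def split: if_splits)

lemma pdv_nz:
  assumes "pdv b f m \<noteq> 0"
  shows "par b = 0 \<Longrightarrow> m b = 0" "f (m(b := Suc (m b))) \<noteq> 0"
  using assms by (auto simp: pdv_def split: if_splits)

lemma mons_upd:
  assumes "m(b := k) \<in> mons" "b \<in> set bs" "par b = 0 \<Longrightarrow> j \<le> 1"
  shows "m(b := j) \<in> mons"
  unfolding mons_def
proof (intro CollectI conjI allI impI)
  fix c
  show "(m(b := j)) c = 0" if "c \<notin> set bs"
    using assms that by (cases "c = b") (auto simp: mons_def dest!: spec[of _ c])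
  show "(m(b := j)) c \<le> 1" if "par c = 0"
    using assms that by (cases "c = b") (auto simp: mons_def dest!: spec[of _ c])
qed

lemma lmul_forms:
  assumes "f \<in> forms" "b \<in> set bs" shows "lmul b f \<in> forms"
proof -
  have "{m. lmul b f m \<noteq> 0} \<subseteq> (\<lambda>m. m(b := Suc (m b))) ` {m. f m \<noteq> 0}"
  proof
    fix m assume "m \<in> {m. lmul b f m \<noteq> 0}"
    then have "0 < m b" "f (m(b := m b - 1)) \<noteq> 0" using lmul_nz[of b f m] by auto
    then show "m \<in> (\<lambda>m. m(b := Suc (m b))) ` {m. f m \<noteq> 0}"
      by (intro image_eqI[of _ _ "m(b := m b - 1)"]) auto
  qed
  moreover have "m \<in> mons" if "lmul b f m \<noteq> 0" for m
  proof -
    have "m(b := m b - 1) \<in> mons" using lmul_nz[OF that] assms by (auto simp: forms_def)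
    then show ?thesis using lmul_nz(2)[OF that] assms(2) mons_upd[of m b "m b - 1" "m b"] by simp
  qed
  ultimately show ?thesis using assms(1) by (auto simp: forms_def intro: finite_subset)
qed

lemma pdv_forms:
  assumes "f \<in> forms" shows "pdv b f \<in> forms"
proof -
  have "{m. pdv b f m \<noteq> 0} \<subseteq> (\<lambda>m. m(b := m b - 1)) ` {m. f m \<noteq> 0}"
  proof
    fix m assume "m \<in> {m. pdv b f m \<noteq> 0}"
    then show "m \<in> (\<lambda>m. m(b := m b - 1)) ` {m. f m \<noteq> 0}"
      using pdv_nz[of b f m] by (intro image_eqI[of _ _ "m(b := Suc (m b))"]) auto
  qed
  moreover have "m \<in> mons" if "pdv b f m \<noteq> 0" for m
  proof -
    have "m(b := Suc (m b)) \<in> mons" using pdv_nz[OF that] assms by (auto simp: forms_def)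
    then show ?thesis using pdv_nz(1)[OF that] mons_upd[of m b "Suc (m b)" "m b"]
      by (cases "b \<in> set bs") (simp, auto simp: mons_def dest: spec[of _ b])
  qed
  ultimately show ?thesis using assms(1) by (auto simp: forms_def intro: finite_subset)
qed

lemma forms_add: assumes "f \<in> forms" "g \<in> forms" shows "f + g \<in> forms"
proof -
  have "{m. (f + g) m \<noteq> 0} \<subseteq> {m. f m \<noteq> 0} \<union> {m. g m \<noteq> 0}" by auto
  then show ?thesis using assms by (auto simp: forms_def intro: finite_subset)
qed

lemma forms_scale: assumes "f \<in> forms" shows "fscale c f \<in> forms"
proof -
  have "{m. fscale c f m \<noteq> 0} \<subseteq> {m. f m \<noteq> 0}" by (auto simp: fscale_def)
  then show ?thesis using assms by (auto simp: forms_def fscale_def intro: finite_subset)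
qed

lemma forms_zero [simp]: "0 \<in> forms" by (simp add: forms_def)

lemma forms_subspace: "vs.subspace forms"
  by (simp add: vs.subspace_def forms_add forms_scale)

lemma forms_minus: "f \<in> forms \<Longrightarrow> - f \<in> forms" using forms_scale[of f "- 1"] by simp

lemma forms_diff: "f \<in> forms \<Longrightarrow> g \<in> forms \<Longrightarrow> f - g \<in> forms"
  using forms_add[of f "- g"] forms_minus[of g] by simp

lemma forms_sum: "(\<And>i. i \<in> S \<Longrightarrow> h i \<in> forms) \<Longrightarrow> sum h S \<in> forms"
  by (rule vs.subspace_sum[OF forms_subspace])

lemma basisf_forms: "m \<in> mons \<Longrightarrow> basisf m \<in> forms"
  by (auto simp: forms_def basisf_def)

lemma zero_mons: "(\<lambda>_. 0) \<in> mons" by (simp add: mons_def)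

lemma forms_restrict: "f \<in> forms \<Longrightarrow> (\<lambda>m. if P m then f m else 0) \<in> forms"
  by (auto simp: forms_def intro: rev_finite_subset)

subsection \<open>The action of the tensor algebra\<close>

lemma actw_simps [simp]: "actw [] f = f" "actw (b # w) f = lmul b (actw w f)"
  "actw (u @ v) f = actw u (actw v f)"
  by (simp_all add: actw_def)

lemma actw_linear [simp]:
  "actw w (f + g) = actw w f + actw w g" "actw w (f - g) = actw w f - actw w g"
  "actw w (fscale c f) = fscale c (actw w f)" "actw w 0 = 0" "actw w (- f) = - actw w f"
  by (induction w) simp_all

lemma act_add [simp]: "act (s + t) f = act s f + act t f"
  unfolding act_def by (rule ext_sum_add) simp

lemma act_single [simp]: "act (single w c) f = fscale c (actw w f)"
  unfolding act_def by (rule ext_sum_single) simp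

lemma act_zero [simp]: "act 0 f = 0"
  by (rule additive_zero[of "\<lambda>t. act t f"]) simp

lemma act_minus [simp]: "act (- t) f = - act t f"
  using act_add[of "- t" t f] by (simp add: eq_neg_iff_add_eq_0)

lemma act_diff [simp]: "act (s - t) f = act s f - act t f"
  using act_add[of s "- t" f] by simp

lemma act_sum: "act (sum h S) f = (\<Sum>i\<in>S. act (h i) f)"
  by (rule additive_sum[of "\<lambda>t. act t f"]) simp

lemma act_linear [simp]:
  "act t (f + g) = act t f + act t g" "act t (f - g) = act t f - act t g"
  "act t (fscale c f) = fscale c (act t f)" "act t 0 = 0" "act t (- f) = - act t f"
proof -
  show 1: "act t (f + g) = act t f + act t g" for f g
    by (rule additive_eqI[of "\<lambda>t. act t (f + g)" "\<lambda>t. act t f + act t g"]) simp_all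
  show 2: "act t (fscale c f) = fscale c (act t f)" for c f
    by (rule additive_eqI[of "\<lambda>t. act t (fscale c f)" "\<lambda>t. fscale c (act t f)"])
      (simp_all add: mult.commute)
  show "act t 0 = 0" using 2[of 0] by simp
  show 3: "act t (- f) = - act t f" for f using 2[of "- 1" f] by simp
  show "act t (f - g) = act t f - act t g" using 1[of f "- g"] 3[of g] by simp
qed

text \<open>
  Multiplication of words is concatenation, and a concatenated word acts by composition.
\<close>

lemma act_mult [simp]: "act (s * t) f = act s (act t f)"
proof (rule additive_eqI[of "\<lambda>s. act (s * t) f" "\<lambda>s. act s (act t f)"])
  show "act (single w a * t) f = act (single w a) (act t f)" for w a
    by (rule additive_eqI[of "\<lambda>t. act (single w a * t) f"
          "\<lambda>t. act (single w a) (act t f)"])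
      (simp_all add: algebra_simps mult_single plus_list_def)
qed (simp_all add: algebra_simps)

lemma act_one [simp]: "act 1 f = f"
  using act_single[of "[]" 1 f] by (simp del: act_single)

lemma act_ksign [simp]: "act (ksign p q) f = fscale (ksign p q) f"
  by (simp add: ksign_def)

lemma actw_forms: "set w \<subseteq> set bs \<Longrightarrow> f \<in> forms \<Longrightarrow> actw w f \<in> forms"
  by (induction w) (simp_all add: lmul_forms)

lemma act_eq_sum:
  "act t f = (\<Sum>w\<in>keys t. fscale (lookup t w) (actw w f))"
  by (simp add: act_def ext_sum_def)

lemma act_in_subspace:
  assumes "vs.subspace V" "\<And>w. w \<in> keys t \<Longrightarrow> actw w f \<in> V"
  shows "act t f \<in> V"
  unfolding act_eq_sum by (intro vs.subspace_sum vs.subspace_scale assms)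

lemma act_forms:
  "\<forall>w\<in>keys t. set w \<subseteq> set bs \<Longrightarrow> f \<in> forms \<Longrightarrow> act t f \<in> forms"
  by (rule act_in_subspace[OF forms_subspace]) (auto intro: actw_forms)

lemma actw_support:
  "actw w f m \<noteq> 0 \<Longrightarrow> \<exists>m'. f m' \<noteq> 0 \<and> m = (\<lambda>b. m' b + count_list w b)"
proof (induction w arbitrary: m)
  case (Cons b w)
  note nz = lmul_nz[of b "actw w f" m]
  have l: "lmul b (actw w f) m \<noteq> 0" using Cons.prems by simp
  obtain m' where m': "f m' \<noteq> 0" "m(b := m b - 1) = (\<lambda>b. m' b + count_list w b)"
    using Cons.IH[OF nz(3)[OF l]] by blast
  have "m c = m' c + count_list (b # w) c" for c
    using fun_cong[OF m'(2), of c] nz(1)[OF l] by (cases "c = b") auto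
  then show ?case using m'(1) by blast
qed auto

text \<open>
  Acting by a word adds its letters to the exponents. Statements on degrees
  and on the letters that occur are read off from this.
\<close>

lemma act_support:
  assumes "act t f m \<noteq> 0"
  shows "\<exists>w\<in>keys t. \<exists>m'. f m' \<noteq> 0 \<and> m = (\<lambda>b. m' b + count_list w b)"
proof -
  obtain w where "w \<in> keys t" "fscale (lookup t w) (actw w f) m \<noteq> 0"
    using assms unfolding act_eq_sum sum_apply by (meson sum.not_neutral_contains_not_neutral)
  then show ?thesis using actw_support[of w f m] by (auto simp: fscale_def)
qed

lemma ev_forms: "\<forall>w\<in>keys t. set w \<subseteq> set bs \<Longrightarrow> ev t \<in> forms"
  unfolding ev_def by (rule act_forms) (auto intro: basisf_forms zero_mons)

lemma ev_linear [simp]: "ev (s + t) = ev s + ev t" "ev (s - t) = ev s - ev t" "ev (- t) = - ev t"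
  "ev 0 = 0" "ev (s * t) = act s (ev t)"
  by (simp_all add: ev_def)

subsection \<open>Normal ordering\<close>

lemma count_nw: "m \<in> mons \<Longrightarrow> count_list (nw m) b = m b"
proof -
  assume m: "m \<in> mons"
  have rep: "count_list (replicate k a) b = (if a = b then k else 0)" for k a
    by (induction k) auto
  have "distinct cs \<Longrightarrow> count_list (concat (map (\<lambda>b. replicate (m b) b) cs)) b
      = (if b \<in> set cs then m b else 0)" for cs
    by (induction cs) (auto simp: rep)
  from this[OF distinct_bs] show ?thesis using m by (auto simp: nw_def mons_def)
qed

lemma set_nw: "set (nw m) \<subseteq> set bs"
  by (auto simp: nw_def)

text \<open>
  Degree and parity of a word are functions of its multiset of letters, so that this transports
  both gradings to the model.
\<close>

lemma ev_support:
  assumes "ev t m \<noteq> 0" "\<forall>w\<in>keys t. set w \<subseteq> set bs"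
  shows "\<exists>w\<in>keys t. mset w = mset (nw m)"
proof -
  obtain w where w: "w \<in> keys t" "m = count_list w"
    using act_support[of t "basisf (\<lambda>_. 0)" m] assms(1)
    by (auto simp: ev_def basisf_def split: if_splits)
  have "m \<in> mons" using ev_forms[OF assms(2)] assms(1) by (auto simp: forms_def)
  then have "mset w = mset (nw m)" using w(2) by (auto simp: multiset_eq_iff count_mset count_nw)
  then show ?thesis using w(1) by blast
qed

text \<open>
  No sign arises, because the letters that precede \<open>b\<close> do not occur in \<open>m\<close>.
\<close>

lemma actw_replicate:
  assumes "m b = 0" "\<And>c. c \<in> pre b \<Longrightarrow> m c = 0" "par b = 0 \<Longrightarrow> k \<le> 1"
  shows "actw (replicate k b) (basisf m) = (basisf (m(b := k)) :: _ \<Rightarrow> 'f::field_char_0)"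
  using assms(3)
proof (induction k)
  case 0
  then show ?case using assms(1) by (simp add: fun_upd_idem)
next
  case (Suc k)
  have 1: "esign b m' = 1" if "m'(b := m' b - 1) = m(b := k)" for m'
  proof (rule esign_zero)
    fix c assume "c \<in> pre b"
    moreover from this have "c \<noteq> b" using not_pre_self by blast
    ultimately show "m' c = 0" using fun_cong[OF that, of c] assms(2)[of c] by simp
  qed
  have 2: "m' = m(b := Suc k) \<longleftrightarrow> 0 < m' b \<and> m'(b := m' b - 1) = m(b := k)" for m'
    by (auto simp: fun_eq_iff)
  have "lmul b (basisf (m(b := k))) m' = (basisf (m(b := Suc k)) m' :: 'f)" for m'
  proof (cases "0 < m' b \<and> m'(b := m' b - 1) = m(b := k)")
    case True
    from fun_cong[OF conjunct2[OF True], of b] True Suc.prems have "par b = 0 \<Longrightarrow> m' b = 1" by simp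
    moreover have "esign b m' = (1 :: 'f)" using True by (intro 1) blast
    moreover have "m' = m(b := Suc k)" using True 2[of m'] by blast
    ultimately show ?thesis using True by (auto simp: lmul_def basisf_def simp del: fun_upd_apply One_nat_def)
  next
    case False
    then show ?thesis using 2[of m'] by (auto simp: lmul_def basisf_def simp del: fun_upd_apply One_nat_def)
  qed
  then have "lmul b (basisf (m(b := k))) = (basisf (m(b := Suc k)) :: _ \<Rightarrow> 'f)" by (rule ext)
  then show ?case using Suc by (simp del: fun_upd_apply)
qed

text \<open>
  The word acts from its right end, so that each letter is multiplied to letters that come later
  in the order.
\<close>

lemma actw_nw:
  assumes "m \<in> mons" shows "actw (nw m) (basisf (\<lambda>_. 0)) = (basisf m :: _ \<Rightarrow> 'f::field_char_0)"
proof -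
  have "bs = us @ cs \<Longrightarrow> actw (concat (map (\<lambda>b. replicate (m b) b) cs)) (basisf (\<lambda>_. 0)) =
      (basisf (\<lambda>b. if b \<in> set cs then m b else 0) :: _ \<Rightarrow> 'f)" for us cs
  proof (induction cs arbitrary: us)
    case (Cons c cs)
    have d: "c \<notin> set us" "c \<notin> set cs" "set us \<inter> set cs = {}"
      using distinct_bs Cons.prems by auto
    have "takeWhile (\<lambda>a. a \<noteq> c) bs = us"
      unfolding Cons.prems using d by (subst takeWhile_append2) auto
    then have p: "pre c = set us" by (simp add: pre_def)
    have "actw (concat (map (\<lambda>b. replicate (m b) b) (c # cs))) (basisf (\<lambda>_. 0)) =
        (actw (replicate (m c) c) (basisf (\<lambda>b. if b \<in> set cs then m b else 0)) :: _ \<Rightarrow> 'f)"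
      using Cons.IH[of "us @ [c]"] unfolding append_assoc append_Cons append_Nil
      by (simp only: Cons.prems[symmetric]) simp
    also have "\<dots> = basisf ((\<lambda>b. if b \<in> set cs then m b else 0)(c := m c))"
      by (rule actw_replicate) (use d p assms in \<open>auto simp: mons_def\<close>)
    also have "(\<lambda>b. if b \<in> set cs then m b else 0)(c := m c) = (\<lambda>b. if b \<in> set (c # cs) then m b else 0)"
      by auto
    finally show ?case .
  qed auto
  from this[of "[]" bs] have "actw (nw m) (basisf (\<lambda>_. 0)) = (basisf (\<lambda>b. if b \<in> set bs then m b else 0) :: _ \<Rightarrow> 'f)"
    by (simp add: nw_def)
  also have "(\<lambda>b. if b \<in> set bs then m b else 0) = m" using assms by (auto simp: mons_def)
  finally show ?thesis .
qed

lemma nf_superset: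
  assumes "finite S" "{m. f m \<noteq> 0} \<subseteq> S"
  shows "nf f = (\<Sum>m\<in>S. single (nw m) (f m))"
  unfolding nf_def by (rule sum.mono_neutral_left) (use assms in auto)

lemma nf_add: assumes "f \<in> forms" "g \<in> forms" shows "nf (f + g) = nf f + nf g"
proof -
  let ?S = "{m. f m \<noteq> 0} \<union> {m. g m \<noteq> 0}"
  have "finite ?S" using assms by (auto simp: forms_def)
  moreover have "{m. (f + g) m \<noteq> 0} \<subseteq> ?S" by auto
  ultimately show ?thesis
    by (simp add: nf_superset[of ?S] single_add sum.distrib)
qed

lemma nf_scale: assumes "f \<in> forms" shows "nf (fscale c f) = cst c * nf f"
proof -
  have "finite {m. f m \<noteq> 0}" using assms by (auto simp: forms_def)
  moreover have "{m. fscale c f m \<noteq> 0} \<subseteq> {m. f m \<noteq> 0}" by (auto simp: fscale_def)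
  ultimately show ?thesis
    by (simp add: nf_superset[of "{m. f m \<noteq> 0}"] sum_distrib_left fscale_def)
qed

lemma nf_zero [simp]: "nf 0 = 0" by (simp add: nf_def)

lemma nf_diff: assumes "f \<in> forms" "g \<in> forms" shows "nf (f - g) = nf f - nf g"
  using nf_add[of "f - g" g] assms by (simp add: forms_diff algebra_simps)

lemma nf_sum: "(\<And>i. i \<in> S \<Longrightarrow> h i \<in> forms) \<Longrightarrow> nf (sum h S) = (\<Sum>i\<in>S. nf (h i))"
  by (induction S rule: infinite_finite_induct) (simp_all add: nf_add forms_sum)

lemma keys_nf: "keys (nf f) \<subseteq> nw ` {m. f m \<noteq> 0}"
proof -
  have "keys (nf f) \<subseteq> (\<Union>m\<in>{m. f m \<noteq> 0}. keys (single (nw m) (f m)))"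
    unfolding nf_def by (rule keys_sum)
  then show ?thesis by (auto split: if_splits)
qed

lemma keys_nf_bs: "\<forall>w\<in>keys (nf f). set w \<subseteq> set bs"
  using keys_nf[of f] set_nw by blast

lemma ev_nf: assumes "f \<in> forms" shows "ev (nf f) = f"
proof -
  have fin: "finite {m. f m \<noteq> 0}" using assms by (auto simp: forms_def)
  have "ev (nf f) = (\<Sum>m | f m \<noteq> 0. fscale (f m) (basisf m))"
    unfolding nf_def ev_def act_sum
    by (rule sum.cong) (use assms in \<open>auto simp: actw_nw forms_def\<close>)
  also have "\<dots> = f"
    by (rule ext) (use fin in \<open>auto simp: sum_apply fscale_def basisf_def if_distrib[of "(*) _"] cong: if_cong\<close>)
  finally show ?thesis .
qed

end

text \<open>
  An ideal that contains the relations of the super-exterior algebra permits normal ordering. The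
  ideal of the exterior algebra and the larger one of \<open>G\<^sub>n\<close> are both of this kind.
\<close>

locale exterior_ideal = super_exterior bs par for bs :: "'b list" and par :: "'b \<Rightarrow> bit" +
  fixes I :: "('b list \<Rightarrow>\<^sub>0 'f::field_char_0) set"
  assumes I_sub: "I \<subseteq> {t. \<forall>w\<in>keys t. set w \<subseteq> set bs}"
    and I_zero: "0 \<in> I" and I_add: "\<And>x y. x \<in> I \<Longrightarrow> y \<in> I \<Longrightarrow> x + y \<in> I"
    and I_left: "\<And>r x. \<forall>w\<in>keys r. set w \<subseteq> set bs \<Longrightarrow> x \<in> I \<Longrightarrow> r * x \<in> I"
    and I_right: "\<And>r x. \<forall>w\<in>keys r. set w \<subseteq> set bs \<Longrightarrow> x \<in> I \<Longrightarrow> x * r \<in> I"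
    and I_rel: "\<And>b c. b \<in> set bs \<Longrightarrow> c \<in> set bs \<Longrightarrow>
      wd [b] * wd [c] + ksign (par b) (par c) * (wd [c] * wd [b]) \<in> I"
begin

lemma I_cst: "x \<in> I \<Longrightarrow> cst c * x \<in> I" by (rule I_left) auto

lemma I_minus: "x \<in> I \<Longrightarrow> - x \<in> I"
  using I_cst[of x "- 1"] by (simp add: cst_minus_one)

lemma I_diff: "x \<in> I \<Longrightarrow> y \<in> I \<Longrightarrow> x - y \<in> I"
  using I_add[of x "- y"] I_minus[of y] by simp

lemma I_sum: "(\<And>i. i \<in> S \<Longrightarrow> h i \<in> I) \<Longrightarrow> sum h S \<in> I"
  by (induction S rule: infinite_finite_induct) (auto intro: I_add I_zero)

lemma I_comm:
  assumes "b \<in> set bs" "c \<in> set bs"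
  shows "wd [b] * wd [c] - cst (tau b c) * (wd [c] * wd [b]) \<in> I"
  using I_rel[OF assms] by (auto simp: tau_def ksign_def cst_minus_one split: if_splits)

text \<open>
  The relation between \<open>b\<close> and itself reads \<open>2 b\<^sup>2 = 0\<close>.
\<close>

lemma I_even_sq:
  assumes "b \<in> set bs" "par b = 0" shows "wd [b] * wd [b] \<in> I"
proof -
  have "wd [b] * wd [b] + wd [b] * wd [b] \<in> I"
    using I_rel[OF assms(1,1)] assms(2) by (simp add: ksign_def)
  from I_cst[OF this, of "1 / 2"] show ?thesis
    by (simp add: mult_single plus_list_def distrib_left single_add[symmetric])
qed

lemma I_comm_word:
  assumes "b \<in> set bs" "set u \<subseteq> set bs"
  shows "wd [b] * wd u - cst (prod_list (map (tau b) u)) * (wd u * wd [b]) \<in> I"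
  using assms(2)
proof (induction u)
  case Nil
  then show ?case by (simp add: I_zero mult_single plus_list_def)
next
  case (Cons c u)
  let ?P = "prod_list (map (tau b) u) :: 'f"
  have 1: "(wd [b] * wd [c] - cst (tau b c) * (wd [c] * wd [b])) * wd u \<in> I"
    by (rule I_right) (use I_comm assms Cons in auto)
  have 2: "cst (tau b c) * (wd [c] * (wd [b] * wd u - cst ?P * (wd u * wd [b]))) \<in> I"
    by (intro I_cst I_left) (use Cons in auto)
  from I_add[OF 1 2] show ?case
    by (simp add: algebra_simps mult_single plus_list_def)
qed

lemma esign_eq_prod_list:
  assumes "bs = us @ b # vs"
  shows "esign b m = prod_list (map (tau b) (concat (map (\<lambda>c. replicate (m c) c) us)))"
proof -
  have d: "distinct us" "b \<notin> set us" using distinct_bs assms by auto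
  have "takeWhile (\<lambda>a. a \<noteq> b) bs = us"
    unfolding assms using d by (subst takeWhile_append2) auto
  then have "esign b m = (\<Prod>c\<in>set us. tau b c ^ m c)" by (simp add: esign_def pre_def)
  also have "\<dots> = prod_list (map (\<lambda>c. tau b c ^ m c) us)"
    by (rule prod.distinct_set_conv_list[OF d(1)])
  also have "\<dots> = prod_list (map (tau b) (concat (map (\<lambda>c. replicate (m c) c) us)))"
    by (induction us) (simp_all add: prod_list_replicate)
  finally show ?thesis .
qed

text \<open>
  The letter \<open>b\<close> moves past the letters that precede it in the order. There it meets the block of
  the letters \<open>b\<close>, which it enlarges if \<open>b\<close> is odd or the block is empty, and kills otherwise.
\<close>

lemma I_mult_nw:
  assumes "b \<in> set bs"
  shows "wd [b] * wd (nw m) - (if par b = 0 \<and> 0 < m b then 0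
    else cst (esign b m) * wd (nw (m(b := Suc (m b))))) \<in> I"
proof -
  obtain us vs where bs: "bs = us @ b # vs" using assms by (meson split_list)
  let ?N = "\<lambda>m cs. concat (map (\<lambda>c. replicate (m c) c) cs)"
  have d: "b \<notin> set us" "b \<notin> set vs" using distinct_bs bs by auto
  have nw: "nw m = ?N m us @ replicate (m b) b @ ?N m vs" for m
    unfolding nw_def by (subst bs) simp
  have upd: "\<And>k. ?N (m(b := k)) us = ?N m us" "\<And>k. ?N (m(b := k)) vs = ?N m vs"
    using d by (auto intro!: arg_cong[of _ _ concat])
  have nwu: "nw (m(b := Suc (m b))) = ?N m us @ replicate (Suc (m b)) b @ ?N m vs"
    by (simp only: nw upd fun_upd_same)
  let ?U = "?N m us" and ?V = "?N m vs"
  have sub: "set ?U \<subseteq> set bs" "set ?V \<subseteq> set bs" by (auto simp: bs)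
  have 1: "(wd [b] * wd ?U - cst (esign b m) * (wd ?U * wd [b])) * wd (replicate (m b) b @ ?V) \<in> I"
    using I_comm_word[OF assms sub(1)] sub assms
    by (intro I_right) (auto simp: esign_eq_prod_list[OF bs])
  have r: "\<forall>w\<in>keys (wd u :: 'b list \<Rightarrow>\<^sub>0 'f). set w \<subseteq> set bs" if "set u \<subseteq> set bs" for u
    using that by simp
  show ?thesis
  proof (cases "par b = 0 \<and> 0 < m b")
    case True
    then obtain k where k: "m b = Suc k" using gr0_conv_Suc by auto
    have "wd ?U * ((wd [b] * wd [b]) * wd (replicate k b @ ?V)) \<in> I"
      by (rule I_left[OF r], use sub assms in force, rule I_right[OF r], use sub assms in force)
        (use I_even_sq assms True in auto)
    from I_add[OF 1 I_cst[OF this, of "esign b m"]] show ?thesis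
      using True k by (simp add: algebra_simps mult_single plus_list_def nw[of m])
  next
    case False
    then show ?thesis using 1
      by (auto simp: algebra_simps mult_single plus_list_def nw[of m] nwu simp del: fun_upd_apply)
  qed
qed

text \<open>
  By \<open>I_mult_nw\<close>, multiplication of normally ordered words by a letter agrees modulo \<open>I\<close> with the
  operator \<open>lmul\<close> on exponents, so that a word can be ordered from its right end.
\<close>

lemma I_word_nf:
  assumes "set w \<subseteq> set bs" shows "wd w - nf (ev (wd w)) \<in> I"
  using assms
proof (induction w)
  case Nil
  have n: "nw (\<lambda>_. 0) = []" by (simp add: nw_def)
  have "nf (ev (wd [])) = (\<Sum>m\<in>{\<lambda>_. 0}. single (nw m) (ev (wd []) m) :: _ \<Rightarrow>\<^sub>0 'f)"
    by (rule nf_superset) (auto simp: ev_def basisf_def split: if_splits)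
  then show ?case using n by (simp add: I_zero ev_def basisf_def)
next
  case (Cons b w)
  define f where "f = ev (wd w :: 'b list \<Rightarrow>\<^sub>0 'f)"
  let ?S = "{m. f m \<noteq> 0}" and ?u = "\<lambda>m. m(b := Suc (m b))"
  have b: "b \<in> set bs" and w: "set w \<subseteq> set bs" using Cons.prems by auto
  have f: "f \<in> forms" unfolding f_def by (rule ev_forms) (use w in simp)
  then have fin: "finite ?S" by (simp add: forms_def)
  have evb: "ev (wd (b # w)) = lmul b f" by (simp add: f_def ev_def)
  have inj: "inj_on ?u ?S"
  proof (rule inj_onI)
    fix m m' :: "'b \<Rightarrow> nat" assume "?u m = ?u m'"
    then show "m = m'" by (metis fun_upd_eqD fun_upd_triv fun_upd_upd nat.inject)
  qed
  have sup: "{m. lmul b f m \<noteq> 0} \<subseteq> ?u ` ?S"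
  proof
    fix m assume "m \<in> {m. lmul b f m \<noteq> 0}"
    then have "lmul b f m \<noteq> 0" by simp
    from lmul_nz[OF this] show "m \<in> ?u ` ?S" by (intro image_eqI[of _ _ "m(b := m b - 1)"]) auto
  qed
  have "nf (lmul b f) = (\<Sum>m\<in>?S. single (nw (?u m)) (lmul b f (?u m)))"
    unfolding nf_superset[OF finite_imageI[OF fin] sup] by (simp add: sum.reindex[OF inj])
  moreover have "wd [b] * nf f = (\<Sum>m\<in>?S. cst (f m) * (wd [b] * wd (nw m)))"
    unfolding nf_def sum_distrib_left
    by (rule sum.cong) (simp_all add: mult_single plus_list_def)
  ultimately have "wd [b] * nf f - nf (lmul b f) = (\<Sum>m\<in>?S. cst (f m) * (wd [b] * wd (nw m) -
     (if par b = 0 \<and> 0 < m b then 0 else cst (esign b m) * wd (nw (?u m)))))"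
    by (auto simp: sum_subtractf[symmetric] lmul_def right_diff_distrib mult.commute fun_upd_idem intro!: sum.cong)
  also have "\<dots> \<in> I" by (intro I_sum I_cst I_mult_nw b)
  finally have 2: "wd [b] * nf f - nf (lmul b f) \<in> I" .
  have 1: "wd [b] * (wd w - nf f) \<in> I"
    by (rule I_left) (use Cons.IH[OF w] b in \<open>auto simp: f_def\<close>)
  have eq: "wd [b] * (wd w - nf f) + (wd [b] * nf f - nf (lmul b f)) = wd (b # w) - nf (lmul b f)"
    by (simp add: right_diff_distrib mult_single plus_list_def)
  show ?case using I_add[OF 1 2] unfolding eq evb .
qed

lemma I_nf:
  assumes "\<forall>w\<in>keys t. set w \<subseteq> set bs" shows "t - nf (ev t) \<in> I"
proof -
  let ?c = "lookup t"
  have t: "t = (\<Sum>w\<in>keys t. cst (?c w) * wd w)"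
    using sum_singles[of t] by simp
  have f: "ev (wd w :: 'b list \<Rightarrow>\<^sub>0 'f) \<in> forms" if "w \<in> keys t" for w
    by (rule ev_forms) (use assms that in simp)
  have "ev t = (\<Sum>w\<in>keys t. fscale (?c w) (ev (wd w)))"
    by (simp add: ev_def act_eq_sum)
  then have "nf (ev t) = (\<Sum>w\<in>keys t. cst (?c w) * nf (ev (wd w)))"
    using f by (simp add: nf_sum forms_scale nf_scale)
  then have "t - nf (ev t) = (\<Sum>w\<in>keys t. cst (?c w) * (wd w - nf (ev (wd w))))"
    by (subst t) (simp add: sum_subtractf right_diff_distrib)
  also have "\<dots> \<in> I" by (intro I_sum I_cst I_word_nf) (use assms in auto)
  finally show ?thesis .
qed

end

section \<open>The super-exterior algebra as the model\<close>

abbreviation deg_part :: "int \<Rightarrow> ('b list \<Rightarrow>\<^sub>0 'f::field) set" where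
  "deg_part k \<equiv> {t. \<forall>w\<in>keys t. int (length w) = k}"

abbreviation par_part :: "('b \<Rightarrow> bit) \<Rightarrow> bit \<Rightarrow> ('b list \<Rightarrow>\<^sub>0 'f::field) set" where
  "par_part pr p \<equiv> {t. \<forall>w\<in>keys t. sum_list (map pr w) = p}"

lemma tensor_presentation:
  fixes par :: "'b \<Rightarrow> bit"
  shows "presentation (tensor_alg B par) {t. \<forall>w\<in>keys t. set w \<subseteq> B} {0 :: 'b list \<Rightarrow>\<^sub>0 'f::field} cst
     deg_part (par_part par) (\<lambda>t. t)"
proof (rule presentation.intro)
  fix x y :: "'b list \<Rightarrow>\<^sub>0 'f"
  assume xy: "x \<in> {t. \<forall>w\<in>keys t. set w \<subseteq> B}" "y \<in> {t. \<forall>w\<in>keys t. set w \<subseteq> B}"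
  then show "x - y \<in> {t. \<forall>w\<in>keys t. set w \<subseteq> B}"
    using keys_diff[of x y] by blast
  show "x * y \<in> {t. \<forall>w\<in>keys t. set w \<subseteq> B}"
  proof (intro CollectI ballI)
    fix w assume "w \<in> keys (x * y)"
    then obtain u v where "w = u @ v" "u \<in> keys x" "v \<in> keys y"
      using keys_mult_list[of x y] by blast
    then show "set w \<subseteq> B" using xy by auto
  qed
next
  show "\<And>c x. x \<in> {t. \<forall>w\<in>keys t. set w \<subseteq> B} \<Longrightarrow>
      c \<odot>\<^bsub>tensor_alg B par\<^esub> x = cst c * x" by (simp add: tensor_alg_def)
  show "zgr (tensor_alg B par) k = (\<lambda>t. t) ` ({t. \<forall>w\<in>keys t. set w \<subseteq> B} \<inter>
      {t. \<forall>w\<in>keys t. int (length w) = k})" for k by (auto simp: tensor_alg_def)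
  show "pgr (tensor_alg B par) k = (\<lambda>t. t) ` ({t. \<forall>w\<in>keys t. set w \<subseteq> B} \<inter>
      {t. \<forall>w\<in>keys t. sum_list (map par w) = k})" for k by (auto simp: tensor_alg_def)
  show "1 \<in> {t. \<forall>w\<in>keys (t :: 'b list \<Rightarrow>\<^sub>0 'f). set w \<subseteq> B}"
    by (simp add: zero_list_def)
qed (simp_all add: tensor_alg_def)

context super_exterior
begin

abbreviation tens :: "('b list \<Rightarrow>\<^sub>0 'f::field_char_0) set" where
  "tens \<equiv> {t. \<forall>w\<in>keys t. set w \<subseteq> set bs}"

lemma tens_closed:
  fixes s t :: "'b list \<Rightarrow>\<^sub>0 'f::field_char_0"
  assumes "s \<in> tens" "t \<in> tens"
  shows "s + t \<in> tens" "s - t \<in> tens" "s * t \<in> tens" "- t \<in> tens" "ksign p q * t \<in> tens"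
proof -
  interpret T: presentation "tensor_alg (set bs) par" tens "{0}" cst
     deg_part "par_part par" "\<lambda>t :: 'b list \<Rightarrow>\<^sub>0 'f. t"
    by (rule tensor_presentation)
  show "s + t \<in> tens" "s - t \<in> tens" "s * t \<in> tens" "- t \<in> tens"
    by (rule T.R_add[OF assms], rule T.R_diff[OF assms], rule T.R_mult[OF assms], rule T.R_minus[OF assms(2)])
  then show "ksign p q * t \<in> tens" using assms(2) by (cases "p = 1 \<and> q = 1") (auto simp: ksign_def)
qed

lemma tens_sum: "(\<And>i. i \<in> I \<Longrightarrow> h i \<in> tens) \<Longrightarrow> (sum h I :: _ \<Rightarrow>\<^sub>0 'f::field_char_0) \<in> tens"
proof (induction I rule: infinite_finite_induct)
  case (insert i I)
  have "h i \<in> tens" by (rule insert.prems) simp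
  moreover have "sum h I \<in> tens" by (rule insert.IH, rule insert.prems) simp
  ultimately show ?case unfolding sum.insert[OF insert.hyps] by (rule tens_closed(1))
qed simp_all

text \<open>
  The relation is bilinear in \<open>u\<close> and \<open>v\<close>, so it follows from the commutation of the operators of
  two letters.
\<close>

lemma act_quadratic_relation:
  assumes u: "\<And>w. w \<in> keys u \<Longrightarrow> \<exists>b\<in>set bs. w = [b] \<and> par b = p"
    and v: "\<And>w. w \<in> keys v \<Longrightarrow> \<exists>c\<in>set bs. w = [c] \<and> par c = q"
  shows "act (u * v + ksign p q * (v * u)) f = 0"
proof -
  have bc: "lmul b (lmul c f) = fscale (- ksign p q) (lmul c (lmul b f))"
    if "b \<in> set bs" "par b = p" "c \<in> set bs" "par c = q" for b c
  proof (cases "b = c")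
    case True
    then show ?thesis using lmul_even_sq[of b f] that by (cases "par b = 0") (auto simp: ksign_def)
  next
    case False
    then show ?thesis using lmul_commute[of b c f] that by (simp add: tau_def)
  qed
  have "act u (act v f) = fscale (- ksign p q) (act v (act u f))"
  proof (rule additive_eqI[of "\<lambda>u. act u (act v f)" "\<lambda>u. fscale (- ksign p q) (act v (act u f))"])
    fix w a assume "w \<in> keys u"
    then obtain b where b: "b \<in> set bs" "w = [b]" "par b = p" using u by blast
    have "lmul b (act v f) = fscale (- ksign p q) (act v (lmul b f))"
    proof (rule additive_eqI[of "\<lambda>v. lmul b (act v f)" "\<lambda>v. fscale (- ksign p q) (act v (lmul b f))"])
      fix w' a' assume "w' \<in> keys v"
      then obtain c where c: "c \<in> set bs" "w' = [c]" "par c = q" using v by blast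
      show "lmul b (act (single w' a') f) =
          fscale (- ksign p q) (act (single w' a') (lmul b f))"
        using bc[OF b(1,3) c(1,3)] by (simp add: c mult.commute)
    qed simp_all
    then show "act (single w a) (act v f) =
        fscale (- ksign p q) (act v (act (single w a) f))"
      by (simp add: b mult.commute)
  qed simp_all
  then show ?thesis by simp
qed

definition quadratic_relations :: "('b list \<Rightarrow>\<^sub>0 'f::field_char_0) set" where
  "quadratic_relations = (let T = tensor_alg (set bs) par in
    {u * v + ksign p q * (v * u) | p q u v. u \<in> zgr T 1 \<inter> pgr T p \<and> v \<in> zgr T 1 \<inter> pgr T q})"

lemma ext_ideal_generated:
  "ext_ideal (set bs) par = Idl\<^bsub>tensor_alg (set bs) par\<^esub> quadratic_relations"
  by (simp add: ext_ideal_def quadratic_relations_def Let_def)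

lemma quadratic_relations_zero:
  assumes "x \<in> (quadratic_relations :: ('b list \<Rightarrow>\<^sub>0 'f::field_char_0) set)"
  shows "act x f = 0" "x \<in> tens"
proof -
  let ?T = "tensor_alg (set bs) par :: ('f, 'b list \<Rightarrow>\<^sub>0 'f) galg"
  obtain p q u v where x: "x = u * v + ksign p q * (v * u)"
    and *: "u \<in> zgr ?T 1" "u \<in> pgr ?T p" "v \<in> zgr ?T 1" "v \<in> pgr ?T q"
    using assms unfolding quadratic_relations_def Let_def by blast
  have 1: "\<exists>b\<in>set bs. w = [b] \<and> par b = p'" if "t \<in> zgr ?T 1" "t \<in> pgr ?T p'" "w \<in> keys t"
    for t p' w
  proof -
    have "length w = 1" "set w \<subseteq> set bs" "sum_list (map par w) = p'"
      using that by (auto simp: tensor_alg_def)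
    then show ?thesis by (auto simp: length_Suc_conv)
  qed
  show "act x f = 0"
    unfolding x by (rule act_quadratic_relation; rule 1; (assumption | rule *))
  have "u \<in> tens" "v \<in> tens" using * by (auto simp: tensor_alg_def)
  then show "x \<in> tens" unfolding x by (intro tens_closed)
qed

lemma genideal_exterior_ideal:
  fixes S :: "('b list \<Rightarrow>\<^sub>0 'f::field_char_0) set"
  defines "I \<equiv> Idl\<^bsub>tensor_alg (set bs) par\<^esub> S"
  assumes S: "S \<subseteq> tens" and rel: "\<And>b c. b \<in> set bs \<Longrightarrow> c \<in> set bs \<Longrightarrow>
      wd [b] * wd [c] + ksign (par b) (par c) * (wd [c] * wd [b]) \<in> I"
  shows "exterior_ideal bs par I" "S \<subseteq> I"
proof -
  let ?T = "tensor_alg (set bs) par :: ('f, 'b list \<Rightarrow>\<^sub>0 'f) galg"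
  interpret T: presentation ?T tens "{0}" cst deg_part "par_part par" "\<lambda>t. t"
    by (rule tensor_presentation)
  have c: "carrier ?T = tens" by (simp add: tensor_alg_def)
  have SI: "S \<subseteq> I" unfolding I_def by (rule ring.genideal_self[OF T.ring]) (use S c in simp)
  then show "S \<subseteq> I" .
  have "ideal I ?T" unfolding I_def by (rule ring.genideal_ideal[OF T.ring]) (use S c in simp)
  then interpret I: ideal I ?T .
  note add = I.additive_subgroup_axioms
  show "exterior_ideal bs par I"
  proof
    show "I \<subseteq> tens" using I.a_subset c by simp
    show "0 \<in> I" using additive_subgroup.zero_closed[OF add] by (simp add: tensor_alg_def)
    show "x + y \<in> I" if "x \<in> I" "y \<in> I" for x y
      using additive_subgroup.a_closed[OF add that] by (simp add: tensor_alg_def)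
    show "r * x \<in> I" if "\<forall>w\<in>keys r. set w \<subseteq> set bs" "x \<in> I" for r x
      using I.I_l_closed[OF that(2), of r] that(1) by (simp add: tensor_alg_def)
    show "x * r \<in> I" if "\<forall>w\<in>keys r. set w \<subseteq> set bs" "x \<in> I" for r x
      using I.I_r_closed[OF that(2), of r] that(1) by (simp add: tensor_alg_def)
  qed (use rel in blast)
qed

lemma ext_ideal_exterior: "exterior_ideal bs par (ext_ideal (set bs) par :: ('b list \<Rightarrow>\<^sub>0 'f::field_char_0) set)"
proof -
  let ?T = "tensor_alg (set bs) par :: ('f, 'b list \<Rightarrow>\<^sub>0 'f) galg"
  have S: "quadratic_relations \<subseteq> (tens :: ('b list \<Rightarrow>\<^sub>0 'f) set)"
    using quadratic_relations_zero(2) by blast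
  have self: "quadratic_relations \<subseteq> (Idl\<^bsub>?T\<^esub> quadratic_relations :: ('b list \<Rightarrow>\<^sub>0 'f) set)"
    by (rule ring.genideal_self[OF presentation.ring[OF tensor_presentation]])
      (use S in \<open>simp add: tensor_alg_def\<close>)
  have rel: "wd [b] * wd [c] + ksign (par b) (par c) * (wd [c] * wd [b]) \<in>
      (quadratic_relations :: ('b list \<Rightarrow>\<^sub>0 'f) set)" if "b \<in> set bs" "c \<in> set bs" for b c
  proof -
    have "wd [b] \<in> zgr ?T 1 \<inter> pgr ?T (par b)" if "b \<in> set bs" for b
      using that by (simp add: tensor_alg_def)
    then show ?thesis using that unfolding quadratic_relations_def Let_def by blast
  qed
  show ?thesis
    unfolding ext_ideal_generated
    by (rule genideal_exterior_ideal(1)[OF S]) (rule subsetD[OF self], rule rel)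
qed

text \<open>
  The tensors that act as zero form a two-sided ideal, which contains the quadratic relations.
\<close>

lemma act_ext_ideal:
  assumes "t \<in> (ext_ideal (set bs) par :: ('b list \<Rightarrow>\<^sub>0 'f::field_char_0) set)"
  shows "act t f = 0" "t \<in> tens"
proof -
  interpret T: presentation "tensor_alg (set bs) par" tens "{0}" cst deg_part "par_part par"
    "\<lambda>t :: 'b list \<Rightarrow>\<^sub>0 'f. t"
    by (rule tensor_presentation)
  let ?K = "{t \<in> tens. \<forall>f :: _ \<Rightarrow> 'f. act t f = 0}"
  have "ideal ((\<lambda>t. t) ` ?K) (tensor_alg (set bs) par)"
  proof (rule T.ideal_image)
    show "x - y \<in> ?K" if "x \<in> ?K" "y \<in> ?K" for x y
      using that tens_closed(2)[of x y] by auto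
    show "r * x \<in> ?K" "x * r \<in> ?K" if "r \<in> tens" "x \<in> ?K" for r x
      using that tens_closed(3)[of r x] tens_closed(3)[of x r] by auto
  qed auto
  then have K: "ideal ?K (tensor_alg (set bs) par)" by simp
  have "ext_ideal (set bs) par \<subseteq> ?K"
    unfolding ext_ideal_generated
    by (rule ring.genideal_minimal[OF T.ring K]) (use quadratic_relations_zero in blast)
  then show "act t f = 0" "t \<in> tens" using assms by auto
qed

text \<open>
  The basis theorem for the super-exterior algebra. A tensor in the kernel of \<open>ev\<close> is congruent to
  its normal form, which is zero.
\<close>

lemma ext_ideal_eq: "ext_ideal (set bs) par = {t \<in> tens. ev t = (0 :: _ \<Rightarrow> 'f::field_char_0)}"
proof -
  interpret J: exterior_ideal bs par "ext_ideal (set bs) par :: ('b list \<Rightarrow>\<^sub>0 'f) set"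
    by (rule ext_ideal_exterior)
  show ?thesis
  proof safe
    fix t :: "'b list \<Rightarrow>\<^sub>0 'f"
    assume "t \<in> ext_ideal (set bs) par"
    from act_ext_ideal[OF this] show "ev t = 0" "\<And>w x. w \<in> keys t \<Longrightarrow> x \<in> set w \<Longrightarrow> x \<in> set bs"
      by (auto simp: ev_def)
  next
    fix t :: "'b list \<Rightarrow>\<^sub>0 'f"
    assume "\<forall>w\<in>keys t. set w \<subseteq> set bs" "ev t = 0"
    from J.I_nf[OF this(1)] this(2) show "t \<in> ext_ideal (set bs) par" by simp
  qed
qed

end

section \<open>The cochain complex as a Koszul complex\<close>

definition ba_gens :: "nat \<Rightarrow> ba_basis list" where
  "ba_gens n = map X [1..<Suc n] @ map Y [1..<Suc n] @ [Z]"

definition ba_par :: "ba_basis \<Rightarrow> bit" where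
  "ba_par b = (case b of X i \<Rightarrow> 0 | Y i \<Rightarrow> 1 | Z \<Rightarrow> 1)"

lemma ba_par_simps [simp]: "ba_par (X i) = 0" "ba_par (Y i) = 1" "ba_par Z = 1"
  by (simp_all add: ba_par_def)

lemma par_ba: "par (ba n) = ba_par"
  by (simp add: ba_def ba_par_def fun_eq_iff)

lemma bas_ba: "bas (ba n) = set (ba_gens n)"
  by (auto simp: ba_def ba_gens_def)

lemma set_ba_gens [simp]:
  "X i \<in> set (ba_gens n) \<longleftrightarrow> i \<in> {1..n}" "Y i \<in> set (ba_gens n) \<longleftrightarrow> i \<in> {1..n}" "Z \<in> set (ba_gens n)"
  by (auto simp: ba_gens_def)

locale heisenberg =
  fixes n :: nat
  assumes n_pos: "1 \<le> n"
begin

sublocale super_exterior "ba_gens n" ba_par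
  by standard (auto simp: ba_gens_def distinct_map inj_on_def)

text \<open>
  Multiplication by \<open>d z = \<Sum> x\<^sub>j y\<^sub>j\<close>; below, the homotopy \<open>h\<close> and the eigenvalue of
  \<open>h \<omega> + \<omega> h\<close> on a monomial.
\<close>

definition omega :: "((ba_basis \<Rightarrow> nat) \<Rightarrow> 'f::field_char_0) \<Rightarrow> (ba_basis \<Rightarrow> nat) \<Rightarrow> 'f" where
  "omega f = (\<Sum>j=1..n. lmul (X j) (lmul (Y j) f))"

definition homot :: "((ba_basis \<Rightarrow> nat) \<Rightarrow> 'f::field_char_0) \<Rightarrow> (ba_basis \<Rightarrow> nat) \<Rightarrow> 'f" where
  "homot f = (\<Sum>j=1..n. pdv (Y j) (pdv (X j) f))"

definition energy :: "(ba_basis \<Rightarrow> nat) \<Rightarrow> nat" where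
  "energy m = (\<Sum>j=1..n. m (Y j) + (1 - m (X j)))"

text \<open>
  The differential in the model is \<open>\<omega> \<partial>/\<partial>z\<close>.
\<close>

definition dmodel :: "((ba_basis \<Rightarrow> nat) \<Rightarrow> 'f::field_char_0) \<Rightarrow> (ba_basis \<Rightarrow> nat) \<Rightarrow> 'f" where
  "dmodel f = omega (pdv Z f)"

text \<open>
  The exponents of \<open>x\<^sub>1 \<cdots> x\<^sub>n z\<^sup>k\<close>.
\<close>

definition topm :: "nat \<Rightarrow> ba_basis \<Rightarrow> nat" where
  "topm k b = (case b of X i \<Rightarrow> if i \<in> {1..n} then 1 else 0 | Y i \<Rightarrow> 0 | Z \<Rightarrow> k)"

lemma topm_simps [simp]:
  "topm k (X i) = (if i \<in> {1..n} then 1 else 0)" "topm k (Y i) = 0" "topm k Z = k"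
  by (simp_all add: topm_def)

lemma tau_simps [simp]:
  "tau (X i) (X j) = - 1" "tau (X i) (Y j) = - 1" "tau (Y i) (X j) = - 1" "tau (Y i) (Y j) = 1"
  "tau Z (X j) = - 1" "tau (X j) Z = - 1" "tau Z (Y j) = 1" "tau (Y j) Z = 1" "tau Z Z = 1"
  by (simp_all add: tau_def ksign_def)

lemma omega_linear [simp]:
  "omega (f + g) = omega f + omega g" "omega (f - g) = omega f - omega g"
  "omega (fscale c f) = fscale c (omega f)" "omega 0 = 0" "omega (- f) = - omega f"
  by (simp_all add: omega_def sum.distrib sum_subtractf vs.scale_sum_right sum_negf)

lemma homot_zero [simp]: "homot 0 = 0"
  by (simp add: homot_def)

lemma dmodel_linear [simp]:
  "dmodel (f + g) = dmodel f + dmodel g" "dmodel (f - g) = dmodel f - dmodel g"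
  "dmodel (fscale c f) = fscale c (dmodel f)" "dmodel 0 = 0" "dmodel (- f) = - dmodel f"
  by (simp_all add: dmodel_def)

lemma omega_forms: "f \<in> forms \<Longrightarrow> omega f \<in> forms"
  unfolding omega_def by (intro forms_sum lmul_forms) auto

lemma homot_forms: "f \<in> forms \<Longrightarrow> homot f \<in> forms"
  unfolding homot_def by (intro forms_sum pdv_forms) auto

lemma lmul_X_sq: "lmul (X i) (lmul (X i) f) = 0"
  by (rule lmul_even_sq) simp

lemma lmul_XX: "i \<in> {1..n} \<Longrightarrow> j \<in> {1..n} \<Longrightarrow> lmul (X i) (lmul (X j) f) = - lmul (X j) (lmul (X i) f)"
  using lmul_commute[of "X i" "X j" f] by (cases "i = j") (auto simp: lmul_X_sq)

lemma lmul_YX: "i \<in> {1..n} \<Longrightarrow> j \<in> {1..n} \<Longrightarrow> lmul (Y i) (lmul (X j) f) = - lmul (X j) (lmul (Y i) f)"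
  using lmul_commute[of "Y i" "X j" f] by auto

lemma lmul_YY: "i \<in> {1..n} \<Longrightarrow> j \<in> {1..n} \<Longrightarrow> lmul (Y i) (lmul (Y j) f) = lmul (Y j) (lmul (Y i) f)"
  using lmul_commute[of "Y i" "Y j" f] by (cases "i = j") auto

lemma lmul_XZ: "i \<in> {1..n} \<Longrightarrow> lmul (X i) (lmul Z f) = - lmul Z (lmul (X i) f)"
  using lmul_commute[of "X i" Z f] by auto

lemma lmul_YZ: "i \<in> {1..n} \<Longrightarrow> lmul (Y i) (lmul Z f) = lmul Z (lmul (Y i) f)"
  using lmul_commute[of "Y i" Z f] by auto

lemma omega_X: assumes "i \<in> {1..n}" shows "omega (lmul (X i) f) = lmul (X i) (omega f)"
  unfolding omega_def lmul_sum
  by (rule sum.cong) (use assms in \<open>simp_all add: lmul_YX lmul_XX[of _ i]\<close>)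

lemma omega_Y: assumes "i \<in> {1..n}" shows "omega (lmul (Y i) f) = - lmul (Y i) (omega f)"
  unfolding omega_def lmul_sum sum_negf[symmetric]
  by (rule sum.cong) (use assms in \<open>simp_all add: lmul_YX lmul_YY[of _ i]\<close>)

lemma omega_Z: "omega (lmul Z f) = - lmul Z (omega f)"
  unfolding omega_def lmul_sum sum_negf[symmetric]
  by (rule sum.cong) (simp_all add: lmul_YZ lmul_XZ)

lemma omega_lmul:
  assumes "b \<in> set (ba_gens n)"
  shows "omega (lmul b f) = fscale (if ba_par b = 0 then 1 else - 1) (lmul b (omega f))"
  by (cases b) (use assms in \<open>simp_all add: omega_X omega_Y omega_Z\<close>)

text \<open>
  Moving \<open>\<omega>\<close> past \<open>x\<^sub>j y\<^sub>j\<close> costs one sign, so that \<open>\<omega>\<^sup>2 = - \<omega>\<^sup>2\<close>.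
\<close>

lemma omega_omega: "omega (omega f) = (0 :: _ \<Rightarrow> 'f::field_char_0)"
proof -
  have "omega (omega f) = (\<Sum>j=1..n. omega (lmul (X j) (lmul (Y j) f)))"
    by (subst (2) omega_def) (rule additive_sum[of omega], simp)
  also have "\<dots> = (\<Sum>j=1..n. - lmul (X j) (lmul (Y j) (omega f)))"
    by (rule sum.cong) (simp_all add: omega_X omega_Y)
  also have "\<dots> = - omega (omega f)"
    by (simp add: sum_negf omega_def[of "omega f"])
  finally have "omega (omega f) m = - omega (omega f) m" for m
    by (metis uminus_apply)
  then show ?thesis by (simp add: fun_eq_iff eq_neg_iff_add_eq_0 flip: mult_2)
qed

lemma pdv_Z_X: "i \<in> {1..n} \<Longrightarrow> pdv Z (lmul (X i) f) = - lmul (X i) (pdv Z f)"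
  using pdv_lmul_commute[of Z "X i" f] by auto

lemma pdv_Z_Y: "i \<in> {1..n} \<Longrightarrow> pdv Z (lmul (Y i) f) = lmul (Y i) (pdv Z f)"
  using pdv_lmul_commute[of Z "Y i" f] by auto

lemma pdv_Z_omega: "pdv Z (omega f) = - omega (pdv Z f)"
  unfolding omega_def pdv_sum sum_negf[symmetric]
  by (rule sum.cong) (simp_all add: pdv_Z_X pdv_Z_Y)

text \<open>
  The Leibniz rule for the product of a letter and a form.
\<close>

lemma dmodel_lmul:
  assumes "b \<in> set (ba_gens n)"
  shows "dmodel (lmul b f) = (if b = Z then omega f else 0) - lmul b (dmodel f)"
  by (cases b) (use assms in \<open>simp_all add: dmodel_def pdv_lmul_odd pdv_Z_X pdv_Z_Y omega_X omega_Y omega_Z\<close>)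

text \<open>
  The representative of \<open>d z\<close> is half the sum of \<open>x\<^sub>i y\<^sub>i - y\<^sub>i x\<^sub>i\<close>, and the two summands act alike.
\<close>

lemma act_d_gen:
  "act (d_gen (ba n) b) f = (if b = Z then omega f else 0)"
proof (cases b)
  case Z
  have "fscale (1 / 2) (lmul (X i) (lmul (Y i) f) - lmul (Y i) (lmul (X i) f)) = lmul (X i) (lmul (Y i) f)"
    if "i \<in> {1..n}" for i
    using that by (simp add: lmul_YX fscale_def fun_eq_iff)
  then show ?thesis
    by (simp add: Z d_gen_ba act_sum omega_def)
qed (simp_all add: d_gen_ba)

lemma dmodel_actw:
  assumes "set w \<subseteq> set (ba_gens n)"
  shows "dmodel (actw w f) = act (d_word (ba n) w) f + fscale ((- 1) ^ length w) (actw w (dmodel f))"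
  using assms
proof (induction w)
  case (Cons b w)
  have "dmodel (actw (b # w) f) = (if b = Z then omega (actw w f) else 0) - lmul b (dmodel (actw w f))"
    using Cons.prems by (simp add: dmodel_lmul)
  moreover have "lmul b (dmodel (actw w f)) =
      lmul b (act (d_word (ba n) w) f) + fscale ((- 1) ^ length w) (lmul b (actw w (dmodel f)))"
    by (subst Cons.IH) (use Cons.prems in simp_all)
  ultimately show ?case by (simp add: act_d_gen fun_eq_iff diff_diff_eq)
qed simp

lemma d_tensor_add: "d_tensor g (s + t) = d_tensor g s + d_tensor g t"
  unfolding d_tensor_def ext_sum_def[of "\<lambda>w c. cst c * d_word g w", symmetric]
  by (rule ext_sum_add) (simp add: single_add distrib_right)

lemma d_tensor_single: "d_tensor g (single w c) = cst c * d_word g w"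
  unfolding d_tensor_def ext_sum_def[of "\<lambda>w c. cst c * d_word g w", symmetric]
  by (rule ext_sum_single) simp

lemma dmodel_act:
  assumes "t \<in> tens" "dmodel f = 0"
  shows "dmodel (act t f) = act (d_tensor (ba n) t) f"
proof (rule additive_eqI[of "\<lambda>t. dmodel (act t f)" "\<lambda>t. act (d_tensor (ba n) t) f"])
  fix w c assume "w \<in> keys t"
  then have "set w \<subseteq> set (ba_gens n)" using assms by auto
  then show "dmodel (act (single w c) f) = act (d_tensor (ba n) (single w c)) f"
    using dmodel_actw[of w f] assms(2) by (simp add: d_tensor_single)
qed (simp_all add: d_tensor_add)

lemma dmodel_vac: "dmodel (basisf (\<lambda>_. 0)) = 0"
proof -
  have "pdv Z (basisf (\<lambda>_. 0)) = (0 :: _ \<Rightarrow> 'a)"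
    by (auto simp: fun_eq_iff pdv_def basisf_def dest: spec[of _ Z])
  then show ?thesis by (simp add: dmodel_def)
qed

lemma ev_d_tensor: "t \<in> tens \<Longrightarrow> ev (d_tensor (ba n) t) = dmodel (ev t)"
  using dmodel_act[OF _ dmodel_vac, of t] by (simp add: ev_def)

lemma d_tensor_tens:
  fixes t :: "ba_basis list \<Rightarrow>\<^sub>0 'f::field_char_0"
  assumes "t \<in> tens" shows "d_tensor (ba n) t \<in> tens"
proof -
  have gen: "d_gen (ba n) b \<in> (tens :: (_ \<Rightarrow>\<^sub>0 'f) set)" for b
    unfolding d_gen_def bas_ba by (intro tens_sum) simp
  have word: "d_word (ba n) w \<in> (tens :: (_ \<Rightarrow>\<^sub>0 'f) set)" if "set w \<subseteq> set (ba_gens n)" for w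
    using that
  proof (induction w)
    case (Cons b w)
    have "wd [b] \<in> (tens :: (_ \<Rightarrow>\<^sub>0 'f) set)" "wd w \<in> (tens :: (_ \<Rightarrow>\<^sub>0 'f) set)" using Cons.prems by auto
    moreover have "d_word (ba n) w \<in> (tens :: (_ \<Rightarrow>\<^sub>0 'f) set)" using Cons by simp
    ultimately show ?case unfolding d_word.simps by (intro tens_closed gen)
  qed simp
  show ?thesis
    unfolding d_tensor_def
  proof (rule tens_sum)
    fix w assume "w \<in> keys t"
    then have "set w \<subseteq> set (ba_gens n)" using assms by blast
    then show "cst (lookup t w) * d_word (ba n) w \<in> tens" by (intro tens_closed(3) word) simp_all
  qed
qed

subsection \<open>The homotopy\<close>

lemma pdv_XX: "i \<in> {1..n} \<Longrightarrow> j \<in> {1..n} \<Longrightarrow> i \<noteq> j \<Longrightarrow> pdv (X i) (lmul (X j) f) = - lmul (X j) (pdv (X i) f)"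
  using pdv_lmul_commute[of "X i" "X j" f] by auto

lemma pdv_XY: "i \<in> {1..n} \<Longrightarrow> j \<in> {1..n} \<Longrightarrow> pdv (X i) (lmul (Y j) f) = - lmul (Y j) (pdv (X i) f)"
  using pdv_lmul_commute[of "X i" "Y j" f] by auto

lemma pdv_YX: "i \<in> {1..n} \<Longrightarrow> j \<in> {1..n} \<Longrightarrow> pdv (Y i) (lmul (X j) f) = - lmul (X j) (pdv (Y i) f)"
  using pdv_lmul_commute[of "Y i" "X j" f] by auto

lemma pdv_YY: "i \<in> {1..n} \<Longrightarrow> j \<in> {1..n} \<Longrightarrow> i \<noteq> j \<Longrightarrow> pdv (Y i) (lmul (Y j) f) = lmul (Y j) (pdv (Y i) f)"
  using pdv_lmul_commute[of "Y i" "Y j" f] by auto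

text \<open>
  Expand both compositions. The terms with indices \<open>j \<noteq> k\<close> cancel, because each derivative
  then commutes or anticommutes with each multiplication. The terms with \<open>j = k\<close> add up to
  \<open>1 + y\<^sub>j \<partial>/\<partial>y\<^sub>j - x\<^sub>j \<partial>/\<partial>x\<^sub>j\<close>, which counts \<open>y\<^sub>j\<close> and the absence of \<open>x\<^sub>j\<close>.
\<close>

lemma homotopy_identity:
  assumes f: "f \<in> forms"
  shows "homot (omega f) + omega (homot f) = (\<lambda>m. of_nat (energy m) * f m)"
proof -
  let ?a = "\<lambda>j k. pdv (Y j) (pdv (X j) (lmul (X k) (lmul (Y k) f)))"
  let ?b = "\<lambda>j k. lmul (X k) (lmul (Y k) (pdv (Y j) (pdv (X j) f)))"
  have off: "?a j k + ?b j k = 0" if "j \<in> {1..n}" "k \<in> {1..n}" "j \<noteq> k" for j k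
    using that by (simp add: pdv_XX pdv_XY pdv_YX pdv_YY)
  have diag: "(?a j j + ?b j j) m = of_nat (m (Y j) + (1 - m (X j))) * f m" if j: "j \<in> {1..n}" for j m
  proof -
    have "pdv (X j) (lmul (X j) (lmul (Y j) f)) = lmul (Y j) f - lmul (X j) (pdv (X j) (lmul (Y j) f))"
      using pdv_lmul_even[of "lmul (Y j) f" "X j"] lmul_forms[OF f] j by simp
    also have "\<dots> = lmul (Y j) f + lmul (X j) (lmul (Y j) (pdv (X j) f))"
      using j by (simp add: pdv_XY)
    finally have "?a j j = pdv (Y j) (lmul (Y j) f) - lmul (X j) (pdv (Y j) (lmul (Y j) (pdv (X j) f)))"
      using j by (simp add: pdv_YX)
    also have "\<dots> = f + lmul (Y j) (pdv (Y j) f) - lmul (X j) (pdv (X j) f) - ?b j j"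
      by (simp add: pdv_lmul_odd)
    finally have "(?a j j + ?b j j) m = f m + lmul (Y j) (pdv (Y j) f) m - lmul (X j) (pdv (X j) f) m"
      by simp
    also have "\<dots> = f m + of_nat (m (Y j)) * f m - of_nat (m (X j)) * f m"
      using f by (simp add: lmul_pdv)
    also have "\<dots> = of_nat (m (Y j) + (1 - m (X j))) * f m"
    proof (cases "f m = 0")
      case False
      then have "m (X j) \<le> 1" using f by (auto simp: forms_def mons_def)
      then show ?thesis by (simp add: of_nat_diff algebra_simps)
    qed simp
    finally show ?thesis .
  qed
  have "homot (omega f) + omega (homot f) = (\<Sum>j=1..n. \<Sum>k=1..n. ?a j k + ?b j k)"
  proof -
    have "homot (omega f) = (\<Sum>j=1..n. \<Sum>k=1..n. ?a j k)"
      by (simp add: homot_def omega_def pdv_sum)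
    moreover have "omega (homot f) = (\<Sum>k=1..n. \<Sum>j=1..n. ?b j k)"
      by (simp add: homot_def omega_def lmul_sum)
    moreover have "\<dots> = (\<Sum>j=1..n. \<Sum>k=1..n. ?b j k)" by (rule sum.swap)
    ultimately show ?thesis by (simp add: sum.distrib)
  qed
  also have "\<dots> = (\<Sum>j=1..n. ?a j j + ?b j j)"
  proof (rule sum.cong)
    fix j assume j: "j \<in> {1..n}"
    have "(\<Sum>k=1..n. ?a j k + ?b j k) = (?a j j + ?b j j) + (\<Sum>k\<in>{1..n}-{j}. ?a j k + ?b j k)"
      by (rule sum.remove) (use j in auto)
    also have "(\<Sum>k\<in>{1..n}-{j}. ?a j k + ?b j k) = 0"
      by (rule sum.neutral) (use off j in auto)
    finally show "(\<Sum>k=1..n. ?a j k + ?b j k) = ?a j j + ?b j j" by (simp only: add_0_right)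
  qed simp
  finally show ?thesis
    by (simp only: fun_eq_iff sum_apply diag[OF _] cong: sum.cong)
      (simp add: diag[simplified] energy_def sum_distrib_right cong: sum.cong)
qed

text \<open>
  Since \<open>\<omega>\<close> raises the exponents of some \<open>x\<^sub>j\<close> and \<open>y\<^sub>j\<close> together, a weight on monomials that
  behaves well under this shift can be moved through \<open>\<omega>\<close>. The weights used are inverse energies and
  projections to homogeneous parts.
\<close>

lemma omega_weight:
  assumes "\<And>m j. j \<in> {1..n} \<Longrightarrow> m (X j) = 1 \<Longrightarrow> 0 < m (Y j) \<Longrightarrow>
    c (m(X j := 0, Y j := m (Y j) - 1)) = d m"
  shows "omega (\<lambda>m. c m * f m) = (\<lambda>m. d m * omega f m)"
proof -
  have "lmul (X j) (lmul (Y j) (\<lambda>m. c m * f m)) m = d m * lmul (X j) (lmul (Y j) f) m" if "j \<in> {1..n}" for j m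
    using assms[OF that, of m] by (cases "m (X j) = 1") (auto simp: lmul_def)
  then show ?thesis by (simp add: fun_eq_iff omega_def sum_apply sum_distrib_left)
qed

lemma energy_step:
  assumes "j \<in> {1..n}" "m (X j) = 1" "0 < m (Y j)"
  shows "energy (m(X j := 0, Y j := m (Y j) - 1)) = energy m"
  unfolding energy_def by (rule sum.cong) (use assms in auto)

lemma omega_topm: "omega f (topm k) = 0"
  by (simp add: omega_def sum_apply lmul_def)

lemma energy_zero_iff:
  assumes "m \<in> mons" shows "energy m = 0 \<longleftrightarrow> m = topm (m Z)"
proof
  assume "energy m = 0"
  then have e: "m (Y j) = 0 \<and> 1 \<le> m (X j)" if "j \<in> {1..n}" for j
    using that by (auto simp: energy_def)
  have "m b = topm (m Z) b" for b
  proof (cases b)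
    case (X i)
    then show ?thesis using assms e[of i]
      by (cases "i \<in> {1..n}") (auto simp: mons_def le_antisym)
  next
    case (Y i)
    then show ?thesis using assms e[of i] by (cases "i \<in> {1..n}") (auto simp: mons_def)
  qed simp
  then show "m = topm (m Z)" by blast
next
  assume "m = topm (m Z)"
  then show "energy m = 0" unfolding energy_def
    by (metis (no_types, lifting) sum.neutral topm_simps add_is_0 diff_self_eq_0)
qed

text \<open>
  Divide \<open>f\<close> by the energy. The quotient is still killed by \<open>\<omega>\<close>, so that by the homotopy identity
  \<open>f\<close> is \<open>\<omega>\<close> times \<open>h\<close> of the quotient.
\<close>

lemma exactness:
  assumes f: "f \<in> forms" "omega f = 0" and e: "\<And>m. f m \<noteq> 0 \<Longrightarrow> energy m \<noteq> 0"
  shows "f \<in> omega ` forms"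
proof -
  \<comment> \<open>Where the energy is zero the form \<open>f\<close> vanishes, so the value of the quotient there does not matter.\<close>
  define g where "g = (\<lambda>m. (1 / of_nat (energy m)) * f m)"
  have g: "g \<in> forms" using f(1) unfolding g_def forms_def
    by (auto intro: rev_finite_subset)
  have "omega g = (\<lambda>m. (1 / of_nat (energy m)) * omega f m)"
    unfolding g_def by (rule omega_weight) (simp add: energy_step[simplified])
  then have og: "omega g = 0" by (simp add: f(2) fun_eq_iff)
  have "f = (\<lambda>m. of_nat (energy m) * g m)" using e by (fastforce simp: g_def fun_eq_iff)
  also have "\<dots> = omega (homot g)" using homotopy_identity[OF g] og by simp
  finally show ?thesis using homot_forms[OF g] by blast
qed

text \<open>
  The antiderivative in \<open>z\<close>. It divides by exponents, which is possible in characteristic \<open>0\<close>.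
\<close>

lemma pdv_Z_surj:
  assumes g: "g \<in> (forms :: (_ \<Rightarrow> 'f::field_char_0) set)" shows "\<exists>f\<in>forms. pdv Z f = g"
proof
  let ?f = "\<lambda>m. (1 / of_nat (m Z)) * lmul Z g m"
  have "lmul Z g \<in> forms" by (rule lmul_forms[OF g]) simp
  then show "?f \<in> forms" unfolding forms_def by (auto intro: rev_finite_subset)
  show "pdv Z ?f = g"
  proof
    fix m
    have "(of_nat (Suc (m Z)) :: 'f) \<noteq> 0" by (rule of_nat_neq_0)
    then show "pdv Z ?f m = g m" by (simp add: pdv_def lmul_def del: of_nat_Suc)
  qed
qed

lemma dmodel_image: "dmodel ` forms = omega ` (forms :: (_ \<Rightarrow> 'f::field_char_0) set)"
proof safe
  fix f :: "_ \<Rightarrow> 'f" assume "f \<in> forms"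
  then show "dmodel f \<in> omega ` forms" by (auto simp: dmodel_def intro: pdv_forms)
next
  fix g :: "_ \<Rightarrow> 'f" assume "g \<in> forms"
  then obtain f where "f \<in> forms" "pdv Z f = g" using pdv_Z_surj by blast
  then show "omega g \<in> dmodel ` forms" by (auto simp: dmodel_def)
qed

lemma dmodel_omega: "dmodel (omega f) = 0"
  by (simp add: dmodel_def pdv_Z_omega omega_omega)

text \<open>
  The terms of a cocycle that are kept when it is reduced modulo coboundaries: those without
  \<open>z\<close>, and the multiples of \<open>x\<^sub>1 \<cdots> x\<^sub>n z\<^sup>k\<close>.
\<close>

definition surviving :: "((ba_basis \<Rightarrow> nat) \<Rightarrow> 'f::field_char_0) \<Rightarrow> (ba_basis \<Rightarrow> nat) \<Rightarrow> 'f" where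
  "surviving f = (\<lambda>m. if m Z = 0 \<or> energy m = 0 then f m else 0)"

text \<open>
  From \<open>\<partial>/\<partial>z (\<omega> f) = - \<omega> (\<partial>/\<partial>z f) = 0\<close> it follows that \<open>\<omega> f\<close> does not involve \<open>z\<close>. Hence \<open>\<omega>\<close> kills the terms of
  \<open>f\<close> with \<open>z\<close>, and \<open>exactness\<close> applies to those of positive energy.
\<close>

lemma cocycle_surviving:
  assumes f: "f \<in> forms" "dmodel f = 0"
  shows "f - surviving f \<in> omega ` forms"
proof -
  let ?c = "\<lambda>m. if m Z = 0 \<or> energy m = 0 then 0 else 1"
  have eq: "f - surviving f = (\<lambda>m. ?c m * f m)" by (auto simp: fun_eq_iff surviving_def)
  have z: "omega f m = 0" if "m Z \<noteq> 0" for m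
  proof -
    have "pdv Z (omega f) = 0" using f(2) by (simp add: pdv_Z_omega dmodel_def)
    then have "pdv Z (omega f) (m(Z := m Z - 1)) = 0" by simp
    then show ?thesis using that by (auto simp: pdv_def of_nat_neq_0 simp del: of_nat_Suc)
  qed
  have "omega (\<lambda>m. ?c m * f m) = (\<lambda>m. ?c m * omega f m)"
    by (rule omega_weight) (auto simp: energy_step[simplified])
  also have "\<dots> = 0" using z by (auto simp: fun_eq_iff)
  finally have "omega (f - surviving f) = 0" using eq by simp
  moreover have "f - surviving f \<in> forms" using f(1)
    by (intro forms_diff) (auto simp: surviving_def intro: forms_restrict)
  moreover have "energy m \<noteq> 0" if "(f - surviving f) m \<noteq> 0" for m using that by (auto simp: surviving_def split: if_splits)
  ultimately show ?thesis by (intro exactness)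
qed

section \<open>Cohomology as cocycles modulo boundaries\<close>

abbreviation exact :: "((ba_basis \<Rightarrow> nat) \<Rightarrow> 'f::field_char_0) set" where
  "exact \<equiv> omega ` forms"

definition cocycles :: "(ba_basis list \<Rightarrow>\<^sub>0 'f::field_char_0) set" where
  "cocycles = {t \<in> tens. dmodel (ev t) = 0}"

definition boundaries :: "(ba_basis list \<Rightarrow>\<^sub>0 'f::field_char_0) set" where
  "boundaries = {t \<in> tens. ev t \<in> exact}"

lemma exact_subspace: "vs.subspace (exact :: (_ \<Rightarrow> 'f::field_char_0) set)"
proof (rule vs.subspaceI)
  show "0 \<in> exact" by (rule image_eqI[of _ _ 0]) simp_all
  fix x y :: "_ \<Rightarrow> 'f" and c
  assume "x \<in> exact"
  then obtain f where f: "x = omega f" "f \<in> forms" by blast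
  show "fscale c x \<in> exact"
    by (rule image_eqI[of _ _ "fscale c f"]) (simp_all add: f forms_scale)
  assume "y \<in> exact"
  then obtain g where g: "y = omega g" "g \<in> forms" by blast
  show "x + y \<in> exact"
    by (rule image_eqI[of _ _ "f + g"]) (use f g in \<open>simp_all add: forms_add\<close>)
qed

lemma exact_forms: "f \<in> exact \<Longrightarrow> f \<in> forms"
  by (auto intro: omega_forms)

lemma exact_actw:
  fixes f :: "_ \<Rightarrow> 'f::field_char_0"
  assumes "set w \<subseteq> set (ba_gens n)" "f \<in> exact" shows "actw w f \<in> exact"
  using assms(1)
proof (induction w)
  case (Cons b w)
  then obtain g where g: "actw w f = omega g" "g \<in> forms" by auto
  let ?c = "if ba_par b = 0 then 1 else - 1 :: 'f"
  have "lmul b (omega g) = fscale (?c * ?c) (lmul b (omega g))" by simp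
  also have "\<dots> = omega (fscale ?c (lmul b g))"
    using omega_lmul[of b g] Cons.prems by (simp only: omega_linear fscale_simps list.set insert_subset)
  finally have "lmul b (omega g) = omega (fscale ?c (lmul b g))" .
  moreover have "fscale ?c (lmul b g) \<in> forms"
    using Cons.prems g(2) by (intro forms_scale lmul_forms) auto
  ultimately show ?case unfolding actw_simps g(1) by (rule image_eqI)
qed (use assms(2) in simp)

lemma exact_act: "t \<in> tens \<Longrightarrow> f \<in> exact \<Longrightarrow> act t f \<in> exact"
  by (rule act_in_subspace[OF exact_subspace]) (auto intro: exact_actw)

lemma ev_tens: "t \<in> tens \<Longrightarrow> ev t \<in> forms"
  by (rule ev_forms) simp

lemma nf_tens: "nf f \<in> tens"
  using keys_nf_bs by blast

text \<open>
  The kernel of \<open>ev\<close> is a two-sided ideal, so the action of a tensor depends on its class only.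
\<close>

lemma act_ev_zero: assumes "t \<in> tens" "ev t = (0 :: _ \<Rightarrow> 'f::field_char_0)" shows "act t f = 0"
  by (rule act_ext_ideal(1)) (use assms ext_ideal_eq in blast)

lemma act_ev_eq:
  assumes "s \<in> tens" "t \<in> tens" "ev s = (ev t :: _ \<Rightarrow> 'f::field_char_0)" shows "act s f = act t f"
  using act_ev_zero[OF tens_closed(2)[OF assms(1,2)], of f] assms(3) by simp

text \<open>
  If \<open>d s\<close> is zero in the exterior algebra then it acts as zero, and the Leibniz rule shows that
  \<open>s\<close> maps cocycles to cocycles.
\<close>

lemma cocycles_mult:
  fixes s t :: "_ \<Rightarrow>\<^sub>0 'f::field_char_0"
  assumes "s \<in> cocycles" "t \<in> cocycles" shows "s * t \<in> cocycles"
proof -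
  have s: "s \<in> tens" "dmodel (ev s) = 0" and t: "t \<in> tens" "dmodel (ev t) = 0"
    using assms by (auto simp: cocycles_def)
  have "ev (d_tensor (ba n) s) = 0" using ev_d_tensor[OF s(1)] s(2) by simp
  then have "act (d_tensor (ba n) s) (ev t) = 0"
    by (intro act_ev_zero d_tensor_tens s(1))
  then have "dmodel (ev (s * t)) = 0" using dmodel_act[OF s(1) t(2)] by simp
  moreover have "s * t \<in> tens" by (rule tens_closed(3)[OF s(1) t(1)])
  ultimately show ?thesis by (simp add: cocycles_def)
qed

text \<open>
  Up to elements that act as zero, \<open>x = d t\<close>, and then \<open>x r = d (t r)\<close>.
\<close>

lemma boundaries_right:
  fixes x r :: "_ \<Rightarrow>\<^sub>0 'f::field_char_0"
  assumes "x \<in> boundaries" "r \<in> cocycles" shows "x * r \<in> boundaries"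
proof -
  have x: "x \<in> tens" "ev x \<in> dmodel ` forms" and r: "r \<in> tens" "dmodel (ev r) = 0"
    using assms by (auto simp: cocycles_def boundaries_def dmodel_image)
  obtain f where f: "f \<in> forms" "ev x = dmodel f" using x(2) by blast
  let ?d = "d_tensor (ba n) (nf f)"
  have "ev ?d = ev x" by (simp add: ev_d_tensor[OF nf_tens] ev_nf[OF f(1)] f(2))
  then have "act x (ev r) = act ?d (ev r)"
    by (intro act_ev_eq x(1) d_tensor_tens nf_tens) simp
  also have "\<dots> = dmodel (act (nf f) (ev r))" by (rule dmodel_act[OF nf_tens r(2), symmetric])
  also have "\<dots> \<in> dmodel ` forms" using act_forms ev_tens[OF r(1)] keys_nf_bs by (intro imageI) blast
  finally have "ev (x * r) \<in> exact" by (simp add: dmodel_image)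
  moreover have "x * r \<in> tens" by (rule tens_closed(3)[OF x(1) r(1)])
  ultimately show ?thesis by (simp add: boundaries_def)
qed

text \<open>
  The cochain algebra is the quotient of the tensor algebra by the kernel of \<open>ev\<close>; passing to
  cocycles and dividing by coboundaries changes the numerator and the denominator only.
\<close>

lemma cohomology_presentation:
  "\<exists>cl. presentation (cohomology (ba n)) cocycles (boundaries :: (_ \<Rightarrow>\<^sub>0 'f::field_char_0) set) cst
     deg_part (par_part ba_par) cl"
proof -
  let ?T = "tensor_alg (set (ba_gens n)) ba_par :: ('f, _) galg"
  let ?J = "ext_ideal (set (ba_gens n)) ba_par :: (ba_basis list \<Rightarrow>\<^sub>0 'f) set"
  let ?d = "d_tensor (ba n) :: (ba_basis list \<Rightarrow>\<^sub>0 'f) \<Rightarrow> _"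
  interpret T: presentation ?T tens "{0}" cst deg_part "par_part ba_par" "\<lambda>t. t"
    by (rule tensor_presentation)
  have J: "t \<in> ?J \<longleftrightarrow> t \<in> tens \<and> ev t = 0" for t using ext_ideal_eq by blast
  define C where "C = quot_alg ?T ((\<lambda>t. t) ` ?J)"
  define cl where "cl = (\<lambda>t. (\<lambda>t. t) ` ?J +>\<^bsub>?T\<^esub> t)"
  have "presentation C tens ?J cst deg_part (par_part ba_par) cl"
    unfolding C_def cl_def
  proof (rule T.quot)
    show "x - y \<in> ?J" if "x \<in> ?J" "y \<in> ?J" for x y
      using that tens_closed(2)[of x y] by (simp add: J)
    show "r * x \<in> ?J" "x * r \<in> ?J" if "r \<in> tens" "x \<in> ?J" for r x
      using that tens_closed(3)[of r x] tens_closed(3)[of x r] act_ev_zero[of x]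
      by (simp_all add: J)
  qed (use J in auto)
  then interpret C: presentation C tens ?J cst deg_part "par_part ba_par" cl .
  have cochains: "cochains (ba n) = C"
    by (simp add: cochains_def ext_alg_def C_def par_ba bas_ba)
  have d_ext: "d_ext (ba n) (cl t) = cl (?d t)" if t: "t \<in> tens" for t
  proof -
    have mem: "t' \<in> cl t \<longleftrightarrow> t' \<in> tens \<and> ev t' = ev t" for t'
    proof -
      have "t' \<in> cl t \<longleftrightarrow> (\<exists>j\<in>?J. t' = j + t)"
        by (auto simp: cl_def a_r_coset_def' tensor_alg_def)
      also have "\<dots> \<longleftrightarrow> t' - t \<in> ?J" by (auto simp: algebra_simps intro: bexI[of _ "t' - t"])
      also have "\<dots> \<longleftrightarrow> t' \<in> tens \<and> ev t' = ev t"
      proof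
        assume "t' - t \<in> ?J"
        then have *: "t' - t \<in> tens" "ev (t' - t) = 0" unfolding J by blast+
        from tens_closed(1)[OF *(1) t] have "t' \<in> tens" by (simp only: diff_add_cancel)
        with *(2) show "t' \<in> tens \<and> ev t' = ev t" by simp
      next
        assume *: "t' \<in> tens \<and> ev t' = ev t"
        from tens_closed(2)[OF conjunct1[OF *] t] * show "t' - t \<in> ?J" unfolding J by simp
      qed
      finally show ?thesis .
    qed
    have "cl (?d t') = cl (?d t)" if "t' \<in> cl t" for t'
    proof -
      have t': "t' \<in> tens" "ev t' = ev t" using that mem by auto
      have "?d t' - ?d t \<in> ?J"
        unfolding J
      proof
        show "?d t' - ?d t \<in> tens" by (intro tens_closed(2) d_tensor_tens t t'(1))
        show "ev (?d t' - ?d t) = 0" by (simp add: ev_d_tensor[OF t] ev_d_tensor[OF t'(1)] t'(2))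
      qed
      then show ?thesis using C.cl_eq[OF d_tensor_tens[OF t'(1)] d_tensor_tens[OF t]] by simp
    qed
    moreover have "t \<in> cl t" using t mem by simp
    ultimately have "(\<Union>t'\<in>cl t. cl (?d t')) = cl (?d t)" by blast
    then show ?thesis by (simp add: d_ext_def cl_def par_ba bas_ba)
  qed
  have sub: "{X \<in> carrier C. d_ext (ba n) X = \<zero>\<^bsub>C\<^esub>} = cl ` cocycles"
  proof -
    have "d_ext (ba n) (cl t) = \<zero>\<^bsub>C\<^esub> \<longleftrightarrow> t \<in> cocycles" if t: "t \<in> tens" for t
    proof -
      have "d_ext (ba n) (cl t) = \<zero>\<^bsub>C\<^esub> \<longleftrightarrow> ?d t \<in> ?J"
        using C.cl_eq[OF d_tensor_tens[OF t] C.R_zero] by (simp only: d_ext[OF t] C.zero_cl diff_zero)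
      then show ?thesis using d_tensor_tens[OF t] ev_d_tensor[OF t] t by (simp add: J cocycles_def)
    qed
    then show ?thesis unfolding C.carrier_eq by (auto simp: cocycles_def)
  qed
  have bd: "d_ext (ba n) ` carrier C = cl ` boundaries"
  proof (intro equalityI subsetI)
    fix X assume "X \<in> d_ext (ba n) ` carrier C"
    then obtain t where t: "t \<in> tens" "X = cl (?d t)" unfolding C.carrier_eq using d_ext by blast
    have "dmodel (ev t) \<in> exact" using ev_tens[OF t(1)] unfolding dmodel_image[symmetric] by (rule imageI)
    then show "X \<in> cl ` boundaries"
      using t d_tensor_tens[OF t(1)] ev_d_tensor[OF t(1)] by (auto simp: boundaries_def)
  next
    fix X assume "X \<in> cl ` boundaries"
    then obtain b where b: "b \<in> tens" "ev b \<in> exact" "X = cl b" by (auto simp: boundaries_def)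
    then obtain f where f: "f \<in> forms" "ev b = dmodel f" unfolding dmodel_image[symmetric] by blast
    have "b - ?d (nf f) \<in> ?J"
      unfolding J
    proof
      show "b - ?d (nf f) \<in> tens" by (rule tens_closed(2)[OF b(1) d_tensor_tens[OF nf_tens]])
      show "ev (b - ?d (nf f)) = 0" by (simp add: ev_d_tensor[OF nf_tens] ev_nf[OF f(1)] f(2))
    qed
    then have "X = d_ext (ba n) (cl (nf f))"
      using C.cl_eq[OF b(1) d_tensor_tens[OF nf_tens]] b(3) d_ext[OF nf_tens] by simp
    then show "X \<in> d_ext (ba n) ` carrier C" unfolding C.carrier_eq using nf_tens by blast
  qed
  have cst_coc: "cst c \<in> cocycles" for c :: 'f
    by (simp add: cocycles_def ev_def dmodel_vac)
  interpret S: presentation "sub_alg C (cl ` cocycles)" cocycles ?J cst deg_part "par_part ba_par" cl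
  proof (rule C.sub)
    show "(1 :: _ \<Rightarrow>\<^sub>0 'f) \<in> cocycles" using cst_coc[of 1] by simp
    show "x - y \<in> cocycles" if "x \<in> cocycles" "y \<in> cocycles" for x y :: "_ \<Rightarrow>\<^sub>0 'f"
      using that tens_closed(2)[of x y] by (simp add: cocycles_def)
    show "x * y \<in> cocycles" if "x \<in> cocycles" "y \<in> cocycles" for x y :: "_ \<Rightarrow>\<^sub>0 'f"
      by (rule cocycles_mult[OF that])
    show "cocycles \<subseteq> (tens :: (_ \<Rightarrow>\<^sub>0 'f) set)" unfolding cocycles_def by blast
    show "?J \<subseteq> cocycles" by (rule subsetI) (simp add: J cocycles_def)
  qed (rule cst_coc)
  have "presentation (quot_alg (sub_alg C (cl ` cocycles)) (cl ` boundaries)) cocycles boundaries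
    cst deg_part (par_part ba_par) (\<lambda>t. cl ` boundaries +>\<^bsub>sub_alg C (cl ` cocycles)\<^esub> cl t)"
  proof (rule S.quot)
    show "boundaries \<subseteq> cocycles" by (auto simp: boundaries_def cocycles_def dmodel_omega)
    show "?J \<subseteq> boundaries" by (rule subsetI) (simp add: J boundaries_def vs.subspace_0[OF exact_subspace])
    show "x - y \<in> boundaries" if "x \<in> boundaries" "y \<in> boundaries" for x y :: "_ \<Rightarrow>\<^sub>0 'f"
      using that tens_closed(2)[of x y] vs.subspace_diff[OF exact_subspace, of "ev x" "ev y"]
      by (simp add: boundaries_def)
    show "r * x \<in> boundaries" if "r \<in> cocycles" "x \<in> boundaries" for r x :: "_ \<Rightarrow>\<^sub>0 'f"
      using that tens_closed(3)[of r x] exact_act[of r "ev x"] by (simp add: boundaries_def cocycles_def)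
    show "x * r \<in> boundaries" if "r \<in> cocycles" "x \<in> boundaries" for r x :: "_ \<Rightarrow>\<^sub>0 'f"
      using boundaries_right that by blast
  qed
  moreover have "cohomology (ba n) = quot_alg (sub_alg C (cl ` cocycles)) (cl ` boundaries)"
    by (simp add: cohomology_def cochains sub bd)
  ultimately show ?thesis by metis
qed

end

section \<open>The algebra with generators \<open>\<xi>\<close>, \<open>\<eta>\<close> as a quotient of the Koszul algebra\<close>

definition g_gens :: "nat \<Rightarrow> gen list" where
  "g_gens n = map Xi [1..<Suc n] @ map Eta [1..<Suc n]"

definition g_par :: "gen \<Rightarrow> bit" where
  "g_par g = (case g of Xi i \<Rightarrow> 0 | Eta i \<Rightarrow> 1)"

fun iota :: "gen \<Rightarrow> ba_basis" where
  "iota (Xi i) = X i" | "iota (Eta i) = Y i"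

lemma g_par_simps [simp]: "g_par (Xi i) = 0" "g_par (Eta i) = 1"
  by (simp_all add: g_par_def)

lemma set_g_gens: "set (g_gens n) = Xi ` {1..n} \<union> Eta ` {1..n}"
  by (auto simp: g_gens_def)

text \<open>
  The generators of \<open>G\<^sub>n\<close> correspond to an initial segment of the ordered generators of the cochain
  algebra. Therefore the signs of both models agree.
\<close>

lemma ba_gens_eq: "ba_gens n = map iota (g_gens n) @ [Z]"
  by (simp add: ba_gens_def g_gens_def)

lemma inj_iota: "inj iota"
proof (rule injI)
  fix g h assume "iota g = iota h" then show "g = h" by (cases g; cases h) auto
qed

lemma iota_eq_iff [simp]: "iota g = iota h \<longleftrightarrow> g = h"
  using inj_iota by (auto dest: injD)

lemma iota_not_Z [simp]: "iota g \<noteq> Z" "Z \<noteq> iota g"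
  by (cases g; simp)+

lemma ba_par_iota [simp]: "ba_par (iota g) = g_par g"
  by (cases g) simp_all

lemma basis_cases: "b = Z \<or> (\<exists>g. b = iota g)"
  by (cases b) (auto intro: exI[of _ "Xi _"] exI[of _ "Eta _"])

lemma iota_gens: "g \<in> set (g_gens n) \<Longrightarrow> iota g \<in> set (ba_gens n)"
  by (simp add: ba_gens_eq)

context heisenberg begin

sublocale G: super_exterior "g_gens n" g_par
  by standard (auto simp: g_gens_def distinct_map inj_on_def)

text \<open>
  The embedding of the model for the letters \<open>\<xi>\<^sub>i\<close>, \<open>\<eta>\<^sub>i\<close> as the functions supported on monomials
  without \<open>z\<close>; \<open>ext_exp\<close> is the embedding of monomials and \<open>theta\<close> the one of free algebras.
\<close>

definition lift :: "((gen \<Rightarrow> nat) \<Rightarrow> 'f::field_char_0) \<Rightarrow> (ba_basis \<Rightarrow> nat) \<Rightarrow> 'f" where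
  "lift f = (\<lambda>m. if m Z = 0 then f (\<lambda>g. m (iota g)) else 0)"

definition ext_exp :: "(gen \<Rightarrow> nat) \<Rightarrow> ba_basis \<Rightarrow> nat" where
  "ext_exp m b = (case b of X i \<Rightarrow> m (Xi i) | Y i \<Rightarrow> m (Eta i) | Z \<Rightarrow> 0)"

definition theta :: "(gen list \<Rightarrow>\<^sub>0 'f::field_char_0) \<Rightarrow> ba_basis list \<Rightarrow>\<^sub>0 'f" where
  "theta t = ext_sum (\<lambda>w c. single (map iota w) c) t"

lemma ext_exp_simps [simp]: "ext_exp m (iota g) = m g" "ext_exp m Z = 0"
  by (cases g; simp add: ext_exp_def) (simp add: ext_exp_def)

lemma ext_exp_restrict: "m Z = 0 \<Longrightarrow> ext_exp (\<lambda>g. m (iota g)) = m"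
  using basis_cases by (auto simp: fun_eq_iff) (metis ext_exp_simps)

lemma ext_exp_mons: assumes "m \<in> mons" shows "(\<lambda>g. m (iota g)) \<in> G.mons"
  using assms unfolding mons_def G.mons_def by (auto simp: ba_gens_eq inj_image_mem_iff[OF inj_iota])

lemma ext_exp_mons': assumes "m \<in> G.mons" shows "ext_exp m \<in> mons"
  unfolding mons_def
proof (intro CollectI conjI allI impI)
  fix b
  show "ext_exp m b = 0" if "b \<notin> set (ba_gens n)"
    using assms that basis_cases[of b] by (auto simp: G.mons_def ba_gens_eq)
  show "ext_exp m b \<le> 1" if "ba_par b = 0"
    using assms that basis_cases[of b] by (auto simp: G.mons_def)
qed

lemma lift_ext_exp [simp]: "lift f (ext_exp m) = f m"
  by (simp add: lift_def)

lemma lift_linear [simp]: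
  "lift (f + g) = lift f + lift g" "lift (f - g) = lift f - lift g"
  "lift (fscale c f) = fscale c (lift f)" "lift 0 = 0" "lift (- f) = - lift f"
  by (auto simp: lift_def fun_eq_iff fscale_def)

lemma lift_eq_0: "lift f = 0 \<Longrightarrow> f = 0"
  using lift_ext_exp[of f] by (metis ext zero_fun_apply)

lemma lift_forms: assumes "f \<in> G.forms" shows "lift f \<in> forms"
proof -
  have "{m. lift f m \<noteq> 0} \<subseteq> ext_exp ` {m. f m \<noteq> 0}"
  proof
    fix m assume "m \<in> {m. lift f m \<noteq> 0}"
    then have "m Z = 0" "f (\<lambda>g. m (iota g)) \<noteq> 0" by (auto simp: lift_def split: if_splits)
    then show "m \<in> ext_exp ` {m. f m \<noteq> 0}" using ext_exp_restrict[of m] by (metis (mono_tags) image_eqI mem_Collect_eq)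
  qed
  moreover have "ext_exp ` {m. f m \<noteq> 0} \<subseteq> mons" using assms ext_exp_mons' by (auto simp: G.forms_def)
  ultimately show ?thesis using assms by (auto simp: forms_def G.forms_def intro: finite_subset)
qed

lemma lift_surj:
  assumes "f \<in> forms" "\<And>m. f m \<noteq> 0 \<Longrightarrow> m Z = 0"
  shows "(\<lambda>m. f (ext_exp m)) \<in> G.forms" "lift (\<lambda>m. f (ext_exp m)) = f"
proof -
  have "{m. f (ext_exp m) \<noteq> 0} \<subseteq> (\<lambda>m g. m (iota g)) ` {m. f m \<noteq> 0}"
  proof
    fix m assume "m \<in> {m. f (ext_exp m) \<noteq> 0}"
    then show "m \<in> (\<lambda>m g. m (iota g)) ` {m. f m \<noteq> 0}"
      by (intro image_eqI[of _ _ "ext_exp m"]) auto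
  qed
  moreover have "m \<in> G.mons" if "f (ext_exp m) \<noteq> 0" for m
    using ext_exp_mons[of "ext_exp m"] assms(1) that by (auto simp: forms_def)
  ultimately show "(\<lambda>m. f (ext_exp m)) \<in> G.forms"
    using assms(1) by (auto simp: forms_def G.forms_def intro: finite_subset)
  show "lift (\<lambda>m. f (ext_exp m)) = f"
    using assms(2) by (force simp: lift_def fun_eq_iff ext_exp_restrict)
qed

lemma lift_lmul:
  assumes "g \<in> set (g_gens n)"
  shows "lift (G.lmul g f) = lmul (iota g) (lift f)"
proof
  fix m
  have pre: "pre (iota g) = iota ` G.pre g"
    unfolding pre_def G.pre_def unfolding ba_gens_eq
    by (subst takeWhile_append1[of "iota g"]) (use assms in \<open>auto simp: takeWhile_map o_def\<close>)
  have es: "esign (iota g) m = (G.esign g (\<lambda>g. m (iota g)) :: 'a)"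
    unfolding esign_def G.esign_def pre
    by (subst prod.reindex) (auto simp: inj_on_def tau_def G.tau_def)
  have upd: "(\<lambda>h. (m(iota g := k)) (iota h)) = (\<lambda>h. m (iota h))(g := k)" for k
    by (auto simp: fun_eq_iff)
  show "lift (G.lmul g f) m = lmul (iota g) (lift f) m"
    unfolding lift_def lmul_def G.lmul_def upd es by simp
qed

lemma theta_add [simp]: "theta (s + t) = theta s + theta t"
  unfolding theta_def by (rule ext_sum_add) (simp add: single_add)

lemma theta_single [simp]: "theta (single w c) = single (map iota w) c"
  unfolding theta_def by (rule ext_sum_single) simp

lemma theta_zero [simp]: "theta 0 = 0"
  by (rule additive_zero[of theta]) simp

lemma theta_minus [simp]: "theta (- t) = - theta t"
  using theta_add[of "- t" t] by (simp add: eq_neg_iff_add_eq_0 del: theta_add)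

lemma theta_diff [simp]: "theta (s - t) = theta s - theta t"
  using theta_add[of s "- t"] by simp

lemma theta_mult [simp]: "theta (s * t) = theta s * theta t"
proof (rule additive_eqI[of "\<lambda>s. theta (s * t)" "\<lambda>s. theta s * theta t"])
  show "theta (single w a * t) = theta (single w a) * theta t" for w a
    by (rule additive_eqI[of "\<lambda>t. theta (single w a * t)"
          "\<lambda>t. theta (single w a) * theta t"])
      (simp_all add: algebra_simps mult_single plus_list_def)
qed (simp_all add: algebra_simps)

lemma theta_one [simp]: "theta 1 = 1"
  using theta_single[of "[]" 1] by (simp del: theta_single)

lemma keys_theta: "keys (theta t) \<subseteq> map iota ` keys t"
proof -
  have "keys (theta t) \<subseteq> (\<Union>w\<in>keys t.
      keys (single (map iota w) (lookup t w)))"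
    unfolding theta_def ext_sum_def by (rule keys_sum)
  then show ?thesis by (auto split: if_splits)
qed

lemma theta_tens: "t \<in> G.tens \<Longrightarrow> theta t \<in> tens"
  using keys_theta[of t] iota_gens by fastforce

lemma lift_actw:
  "set w \<subseteq> set (g_gens n) \<Longrightarrow> lift (G.actw w f) = actw (map iota w) (lift f)"
  by (induction w) (simp_all add: lift_lmul)

lemma lift_act:
  assumes "t \<in> G.tens" shows "lift (G.act t f) = act (theta t) (lift f)"
  by (rule additive_eqI[of "\<lambda>t. lift (G.act t f)" "\<lambda>t. act (theta t) (lift f)"])
    (use assms in \<open>auto simp: lift_actw\<close>)

lemma lift_vac: "lift (G.basisf (\<lambda>_. 0)) = basisf (\<lambda>_. 0)"
proof
  fix m :: "ba_basis \<Rightarrow> nat"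
  have "m = (\<lambda>_. 0) \<longleftrightarrow> m Z = 0 \<and> (\<lambda>g. m (iota g)) = (\<lambda>_. 0)"
    using basis_cases by (auto simp: fun_eq_iff) metis
  then show "lift (G.basisf (\<lambda>_. 0)) m = basisf (\<lambda>_. 0) m"
    by (auto simp: lift_def basisf_def G.basisf_def)
qed

lemma lift_ev: "t \<in> G.tens \<Longrightarrow> lift (G.ev t) = ev (theta t)"
  unfolding G.ev_def ev_def by (simp only: lift_act lift_vac)

definition G_ideal :: "(gen list \<Rightarrow>\<^sub>0 'f::field_char_0) set" where
  "G_ideal = Idl\<^bsub>tensor_alg (set (g_gens n)) g_par\<^esub> (G_relations n)"

lemma G_relations_tens: "G_relations n \<subseteq> (G.tens :: (_ \<Rightarrow>\<^sub>0 'f::field_char_0) set)"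
proof -
  have w: "xi i \<in> (G.tens :: (_ \<Rightarrow>\<^sub>0 'f) set)" "eta i \<in> (G.tens :: (_ \<Rightarrow>\<^sub>0 'f) set)" if "i \<in> {1..n}" for i
    using that by (auto simp: set_g_gens)
  have sum: "(\<Sum>k=1..n. eta k * xi k) \<in> (G.tens :: (_ \<Rightarrow>\<^sub>0 'f) set)"
    by (intro G.tens_sum G.tens_closed w)
  show ?thesis
  proof
    fix r :: "gen list \<Rightarrow>\<^sub>0 'f" assume "r \<in> G_relations n"
    then consider (xx) i j where "r = xi i * xi j + xi j * xi i" "i \<in> {1..n}" "j \<in> {1..n}"
      | (xe) i j where "r = xi i * eta j + eta j * xi i" "i \<in> {1..n}" "j \<in> {1..n}"
      | (ee) i j where "r = eta i * eta j - eta j * eta i" "i \<in> {1..n}" "j \<in> {1..n}"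
      | (s) "r = (\<Sum>k=1..n. eta k * xi k)"
      unfolding G_relations_def by blast
    then show "r \<in> G.tens"
    proof cases
      case xx
      show ?thesis unfolding xx(1) by (intro G.tens_closed w xx)
    next
      case xe
      show ?thesis unfolding xe(1) by (intro G.tens_closed w xe)
    next
      case ee
      show ?thesis unfolding ee(1) by (intro G.tens_closed w ee)
    next
      case s
      show ?thesis unfolding s by (rule sum)
    qed
  qed
qed

lemma G_relations_intros:
  assumes "i \<in> {1..n}" "j \<in> {1..n}"
  shows "xi i * xi j + xi j * xi i \<in> (G_relations n :: (_ \<Rightarrow>\<^sub>0 'f::field_char_0) set)" "xi i * eta j + eta j * xi i \<in> (G_relations n :: (_ \<Rightarrow>\<^sub>0 'f) set)"
    "eta i * eta j - eta j * eta i \<in> (G_relations n :: (_ \<Rightarrow>\<^sub>0 'f) set)"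
  unfolding G_relations_def using assms by blast+

lemma G_ideal_exterior: "exterior_ideal (g_gens n) g_par (G_ideal :: (_ \<Rightarrow>\<^sub>0 'f::field_char_0) set)"
  and G_relations_ideal: "G_relations n \<subseteq> (G_ideal :: (_ \<Rightarrow>\<^sub>0 'f::field_char_0) set)"
proof -
  show sub: "G_relations n \<subseteq> (G_ideal :: (_ \<Rightarrow>\<^sub>0 'f) set)"
    unfolding G_ideal_def
    by (rule ring.genideal_self[OF presentation.ring[OF tensor_presentation]])
      (use G_relations_tens in \<open>simp add: tensor_alg_def\<close>)
  show "exterior_ideal (g_gens n) g_par (G_ideal :: (_ \<Rightarrow>\<^sub>0 'f) set)"
    unfolding G_ideal_def
  proof (rule G.genideal_exterior_ideal(1)[OF G_relations_tens], fold G_ideal_def)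
    fix b c assume bc: "b \<in> set (g_gens n)" "c \<in> set (g_gens n)"
    have "wd [b] * wd [c] + ksign (g_par b) (g_par c) * (wd [c] * wd [b]) \<in> (G_relations n :: (_ \<Rightarrow>\<^sub>0 'f) set)"
    proof (cases b; cases c)
      fix i j assume "b = Xi i" "c = Xi j"
      then show ?thesis using bc G_relations_intros(1)[of i j, where 'f = 'f]
        by (simp add: ksign_def set_g_gens image_iff)
    next
      fix i j assume "b = Xi i" "c = Eta j"
      then show ?thesis using bc G_relations_intros(2)[of i j, where 'f = 'f]
        by (simp add: ksign_def set_g_gens image_iff)
    next
      fix j i assume "b = Eta j" "c = Xi i"
      then show ?thesis using bc G_relations_intros(2)[of i j, where 'f = 'f]
        by (simp add: ksign_def set_g_gens image_iff add.commute)
    next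
      fix i j assume "b = Eta i" "c = Eta j"
      then show ?thesis using bc G_relations_intros(3)[of i j, where 'f = 'f]
        by (simp add: ksign_def set_g_gens image_iff)
    qed
    then show "wd [b] * wd [c] + ksign (g_par b) (g_par c) * (wd [c] * wd [b]) \<in> (G_ideal :: (_ \<Rightarrow>\<^sub>0 'f) set)"
      using sub by blast
  qed
qed

text \<open>
  The last relation of \<open>G\<^sub>n\<close> is \<open>- \<omega>\<close>, as \<open>\<eta>\<^sub>k\<close> and \<open>\<xi>\<^sub>k\<close> anticommute.
\<close>

lemma act_koszul_relation:
  "lift (G.act (\<Sum>k=1..n. eta k * xi k) f) = - omega (lift f)"
proof -
  have "lift (G.act (\<Sum>k=1..n. eta k * xi k) f) = (\<Sum>k=1..n. lift (G.lmul (Eta k) (G.lmul (Xi k) f)))"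
    by (simp add: G.act_sum additive_sum[of lift])
  also have "\<dots> = (\<Sum>k=1..n. - lmul (X k) (lmul (Y k) (lift f)))"
    by (rule sum.cong) (simp_all add: lift_lmul set_g_gens lmul_YX)
  finally show ?thesis by (simp add: omega_def sum_negf)
qed

text \<open>
  Every relation acts as zero or as \<open>- \<omega>\<close>, which gives one inclusion. For the other one let
  \<open>t\<close> evaluate to \<open>\<omega> g\<close>, where \<open>g\<close> may be taken free of \<open>z\<close>, and let \<open>s\<close> be the normal form of \<open>g\<close>. Then
  \<open>t + (\<Sum> \<eta>\<^sub>k \<xi>\<^sub>k) s\<close> evaluates to zero, so it lies in the ideal by normal ordering.
\<close>

lemma G_ideal_eq: "G_ideal = {t \<in> G.tens. ev (theta t) \<in> (exact :: (_ \<Rightarrow> 'f::field_char_0) set)}"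
proof -
  interpret T: presentation "tensor_alg (set (g_gens n)) g_par" G.tens "{0}" cst deg_part "par_part g_par"
    "\<lambda>t :: _ \<Rightarrow>\<^sub>0 'f. t"
    by (rule tensor_presentation)
  interpret I: exterior_ideal "g_gens n" g_par "G_ideal :: (_ \<Rightarrow>\<^sub>0 'f) set" by (rule G_ideal_exterior)
  let ?K = "{t \<in> G.tens. \<forall>f\<in>G.forms. lift (G.act t f) \<in> (exact :: (_ \<Rightarrow> 'f) set)}"
  have "ideal ((\<lambda>t. t) ` ?K) (tensor_alg (set (g_gens n)) g_par)"
  proof (rule T.ideal_image)
    show "0 \<in> ?K" by (simp add: vs.subspace_0[OF exact_subspace])
    show "x - y \<in> ?K" if "x \<in> ?K" "y \<in> ?K" for x y
      using that G.tens_closed(2)[of x y] by (simp add: vs.subspace_diff[OF exact_subspace])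
    show "x * r \<in> ?K" if "r \<in> G.tens" "x \<in> ?K" for r x
      using that G.tens_closed(3)[of x r] G.act_forms[of r] by simp
    show "r * x \<in> ?K" if "r \<in> G.tens" "x \<in> ?K" for r x
    proof -
      have "lift (G.act r (G.act x f)) \<in> exact" if "f \<in> G.forms" for f
        using \<open>x \<in> ?K\<close> that exact_act[OF theta_tens[OF \<open>r \<in> G.tens\<close>]]
        by (simp add: lift_act[OF \<open>r \<in> G.tens\<close>])
      moreover have "r * x \<in> G.tens" by (rule G.tens_closed(3)) (use that in auto)
      ultimately show ?thesis by simp
    qed
  qed auto
  then have K: "ideal ?K (tensor_alg (set (g_gens n)) g_par)" by simp
  have rel: "r \<in> G_relations n \<Longrightarrow> lift (G.act r f) \<in> exact" if f: "f \<in> G.forms" for r and f :: "_ \<Rightarrow> 'f"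
  proof -
    assume r: "r \<in> G_relations n"
    have q: "G.act (wd [b] * wd [c] + ksign (g_par b) (g_par c) * (wd [c] * wd [b])) f = 0"
      if "b \<in> set (g_gens n)" "c \<in> set (g_gens n)" for b c
      by (rule G.act_quadratic_relation) (use that in auto)
    have 0: "G.act r f = 0 \<Longrightarrow> lift (G.act r f) \<in> exact" by (simp add: vs.subspace_0[OF exact_subspace])
    have "lift (G.act (\<Sum>k=1..n. eta k * xi k) f) \<in> exact"
      unfolding act_koszul_relation by (intro vs.subspace_neg[OF exact_subspace] imageI lift_forms f)
    moreover have "G.act (xi i * xi j + xi j * xi i) f = 0" "G.act (xi i * eta j + eta j * xi i) f = 0"
      "G.act (eta i * eta j - eta j * eta i) f = 0" if "i \<in> {1..n}" "j \<in> {1..n}" for i j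
      using q[of "Xi i" "Xi j"] q[of "Xi i" "Eta j"] q[of "Eta i" "Eta j"] that
      by (simp_all add: set_g_gens ksign_def)
    ultimately show ?thesis using r 0 unfolding G_relations_def by blast
  qed
  have "G_ideal \<subseteq> ?K"
    unfolding G_ideal_def
    by (rule ring.genideal_minimal[OF T.ring K]) (use rel G_relations_tens in blast)
  have 1: "t \<in> G.tens" "ev (theta t) \<in> exact" if "t \<in> G_ideal" for t :: "_ \<Rightarrow>\<^sub>0 'f"
  proof -
    have K: "t \<in> ?K" using that \<open>G_ideal \<subseteq> ?K\<close> by blast
    then show t: "t \<in> G.tens" by blast
    have "lift (G.act t (G.basisf (\<lambda>_. 0))) \<in> exact"
      using K G.basisf_forms[OF G.zero_mons] by blast
    then show "ev (theta t) \<in> exact" unfolding lift_ev[OF t, symmetric] G.ev_def .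
  qed
  have 2: "t \<in> G_ideal" if t: "t \<in> G.tens" "ev (theta t) \<in> exact" for t :: "_ \<Rightarrow>\<^sub>0 'f"
  proof -
    obtain g where g: "g \<in> forms" "lift (G.ev t) = omega g" using t(2) unfolding lift_ev[OF t(1)] by blast
    \<comment> \<open>The part of \<open>g\<close> without \<open>z\<close> has the same image under \<open>\<omega>\<close>.\<close>
    define g0 where "g0 = (\<lambda>m. (if m Z = 0 then 1 else 0) * g m)"
    have "g0 = (\<lambda>m. if m Z = 0 then g m else 0)" by (auto simp: g0_def)
    then have g0: "g0 \<in> forms" "\<And>m. g0 m \<noteq> 0 \<Longrightarrow> m Z = 0"
      using forms_restrict[OF g(1), of "\<lambda>m. m Z = 0"] by (auto split: if_splits)
    have "omega g0 = (\<lambda>m. (if m Z = 0 then 1 else 0) * omega g m)"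
      unfolding g0_def by (rule omega_weight) auto
    also have "\<dots> = omega g"
      unfolding g(2)[symmetric] by (auto simp: lift_def)
    finally have og: "omega g0 = lift (G.ev t)" using g(2) by simp
    define h where "h = (\<lambda>m. g0 (ext_exp m))"
    have h: "h \<in> G.forms" "lift h = g0" using lift_surj[of g0] g0 by (simp_all add: h_def)
    let ?r = "\<Sum>k=1..n. eta k * xi k :: _ \<Rightarrow>\<^sub>0 'f"
    let ?s = "G.nf h"
    have s: "?s \<in> G.tens" using G.keys_nf_bs by blast
    have r: "?r \<in> G_ideal" using G_relations_ideal by (auto simp: G_relations_def)
    then have rs: "?r * ?s \<in> G_ideal" using I.I_right[OF _ r] s by blast
    then have rst: "?r * ?s \<in> G.tens" using I.I_sub by blast
    have "lift (G.ev (t + ?r * ?s)) = 0"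
      by (simp add: act_koszul_relation[simplified] G.ev_nf[OF h(1)] h(2) og)
    then have "G.ev (t + ?r * ?s) = 0" by (rule lift_eq_0)
    moreover have "t + ?r * ?s \<in> G.tens" by (rule G.tens_closed(1)[OF t(1) rst])
    ultimately have "t + ?r * ?s \<in> G_ideal" using I.I_nf[of "t + ?r * ?s"] by simp
    from I.I_diff[OF this rs] show ?thesis by simp
  qed
  show ?thesis using 1 2 by blast
qed

lemma G_presentation:
  "\<exists>cl. presentation (G_alg n) G.tens (G_ideal :: (_ \<Rightarrow>\<^sub>0 'f::field_char_0) set) cst deg_part (par_part g_par) cl"
proof -
  let ?T = "tensor_alg (set (g_gens n)) g_par :: ('f, _) galg"
  interpret T: presentation ?T G.tens "{0}" cst deg_part "par_part g_par" "\<lambda>t. t"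
    by (rule tensor_presentation)
  interpret I: exterior_ideal "g_gens n" g_par "G_ideal :: (_ \<Rightarrow>\<^sub>0 'f) set" by (rule G_ideal_exterior)
  have "presentation (quot_alg ?T ((\<lambda>t. t) ` G_ideal)) G.tens G_ideal cst deg_part (par_part g_par)
    (\<lambda>t. (\<lambda>t. t) ` G_ideal +>\<^bsub>?T\<^esub> t)"
    by (rule T.quot) (use I.I_sub I.I_zero I.I_diff I.I_left I.I_right in blast)+
  moreover have "G_alg n = quot_alg ?T ((\<lambda>t. t) ` G_ideal)"
    by (simp add: G_alg_def G_ideal_def set_g_gens g_par_def[abs_def] Let_def)
  ultimately show ?thesis by metis
qed

section \<open>The isomorphism\<close>

text \<open>
  The form \<open>\<Sum> v\<^sub>k x\<^sub>1 \<cdots> x\<^sub>n z\<^sup>k\<close>, and below the cocycle attached to a pair in \<open>G\<^sub>n \<oplus> V\<close>.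
\<close>

definition top_form :: "(nat \<Rightarrow>\<^sub>0 'f::field_char_0) \<Rightarrow> (ba_basis \<Rightarrow> nat) \<Rightarrow> 'f" where
  "top_form v = (\<lambda>m. if m = topm (m Z) \<and> 1 \<le> m Z then lookup v (m Z) else 0)"

definition rep :: "(gen list \<Rightarrow>\<^sub>0 'f::field_char_0) \<Rightarrow> (nat \<Rightarrow>\<^sub>0 'f) \<Rightarrow> ba_basis list \<Rightarrow>\<^sub>0 'f" where
  "rep s v = theta s + nf (top_form v)"

abbreviation V_carrier :: "(nat \<Rightarrow>\<^sub>0 'f::zero) set" where
  "V_carrier \<equiv> {v. \<forall>i\<in>keys v. 1 \<le> i}"

text \<open>
  On \<open>forms\<close> this is the ideal generated by \<open>x\<^sub>1 \<cdots> x\<^sub>n\<close>.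
\<close>

definition full :: "((ba_basis \<Rightarrow> nat) \<Rightarrow> 'f::field_char_0) set" where
  "full = {f. \<forall>m. f m \<noteq> 0 \<longrightarrow> (\<forall>j\<in>{1..n}. m (X j) = 1)}"

lemma fullD: "f \<in> full \<Longrightarrow> f m \<noteq> 0 \<Longrightarrow> j \<in> {1..n} \<Longrightarrow> m (X j) = 1"
  by (auto simp: full_def)

lemma topm_mons: "topm k \<in> mons"
  unfolding mons_def
proof (intro CollectI conjI allI impI)
  fix b
  show "topm k b = 0" if "b \<notin> set (ba_gens n)" using that by (cases b) auto
  show "topm k b \<le> 1" if "ba_par b = 0" using that by (cases b) auto
qed

lemma nw_topm: "nw (topm k) = map X [1..<Suc n] @ replicate k Z"
proof -
  have x: "concat (map (\<lambda>b. replicate (topm k b) b) (map X is)) = map X is" if "set is \<subseteq> {1..n}" for "is"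
    using that by (induction "is") auto
  have y: "concat (map (\<lambda>b. replicate (topm k b) b) (map Y is)) = []" for "is"
    by (induction "is") auto
  have sub: "set [1..<Suc n] \<subseteq> {1..n}" by auto
  show ?thesis
    unfolding nw_def unfolding ba_gens_def map_append concat_append
    by (simp only: x[OF sub] y) simp
qed

lemma top_form_linear [simp]:
  "top_form (v + w) = top_form v + top_form w" "top_form (v - w) = top_form v - top_form w" "top_form (Poly_Mapping.map ((*) c) v) = fscale c (top_form v)"
  "top_form 0 = 0"
proof -
  have map: "lookup (Poly_Mapping.map ((*) c) v) k = c * lookup v k" for k
    by (simp add: Poly_Mapping.map.rep_eq when_def)
  show "top_form (Poly_Mapping.map ((*) c) v) = fscale c (top_form v)"
    by (rule ext) (simp add: top_form_def fscale_def map)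
qed (rule ext, simp add: top_form_def lookup_add lookup_minus)+

lemma top_form_nz: "top_form v m \<noteq> 0 \<Longrightarrow> m = topm (m Z)" "top_form v m \<noteq> 0 \<Longrightarrow> m Z \<in> keys v"
  by (auto simp: top_form_def in_keys_iff split: if_splits)

lemma top_form_topm: "top_form v (topm k) = (if 1 \<le> k then lookup v k else 0)"
  by (simp add: top_form_def)

lemma top_form_forms [simp]: "top_form v \<in> forms"
proof -
  have "{m. top_form v m \<noteq> 0} \<subseteq> topm ` keys v" using top_form_nz[of v] by blast
  moreover have "m \<in> mons" if "top_form v m \<noteq> 0" for m using top_form_nz(1)[OF that] topm_mons by metis
  ultimately show ?thesis by (auto simp: forms_def intro: finite_subset)
qed

lemma top_form_full: "top_form v \<in> full"
  unfolding full_def using top_form_nz(1)[of v] by (auto) (metis atLeastAtMost_iff One_nat_def topm_simps(1))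

lemma full_subspace: "vs.subspace (full :: (_ \<Rightarrow> 'f::field_char_0) set)"
proof (rule vs.subspaceI)
  show "x + y \<in> full" if "x \<in> full" "y \<in> full" for x y :: "_ \<Rightarrow> 'f"
  proof -
    have "x m \<noteq> 0 \<or> y m \<noteq> 0" if "(x + y) m \<noteq> 0" for m using that by auto
    then show ?thesis using that unfolding full_def by blast
  qed
qed (auto simp: full_def fscale_def)

text \<open>
  Every term of \<open>\<omega>\<close> contributes a further \<open>x\<^sub>j\<close>.
\<close>

lemma full_omega: assumes "f \<in> full" shows "omega f = 0"
proof -
  have "lmul (X j) (lmul (Y j) f) m = 0" if j: "j \<in> {1..n}" for j m
  proof (rule ccontr)
    assume nz: "lmul (X j) (lmul (Y j) f) m \<noteq> 0"
    then have "m (X j) = 1" using lmul_nz(2)[OF nz] by simp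
    with fullD[OF assms lmul_nz(3)[OF lmul_nz(3)[OF nz]] j] show False by simp
  qed
  then show ?thesis by (simp add: omega_def fun_eq_iff sum_apply)
qed

lemma full_lmul: assumes "f \<in> full" shows "lmul b f \<in> full"
  unfolding full_def
proof (intro CollectI allI impI ballI)
  fix m j assume nz: "lmul b f m \<noteq> 0" and j: "j \<in> {1..n}"
  have "(m(b := m b - 1)) (X j) = 1" by (rule fullD[OF assms lmul_nz(3)[OF nz] j])
  then show "m (X j) = 1" using lmul_nz(2)[OF nz] by (cases "b = X j") auto
qed

lemma full_act: "f \<in> full \<Longrightarrow> act t f \<in> full"
proof (rule act_in_subspace[OF full_subspace])
  fix w assume "f \<in> full"
  then show "actw w f \<in> full" by (induction w) (simp_all add: full_lmul)
qed

text \<open>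
  A multiple of \<open>x\<^sub>1 \<cdots> x\<^sub>n\<close> is killed by \<open>\<omega>\<close>, and without the terms \<open>x\<^sub>1 \<cdots> x\<^sub>n z\<^sup>k\<close> it has none of
  energy zero. This is why the second summand of the cohomology multiplies trivially.
\<close>

lemma exact_full:
  assumes "f \<in> forms" "f \<in> full" "\<And>k. f (topm k) = 0" shows "f \<in> exact"
proof (rule exactness[OF assms(1) full_omega[OF assms(2)]])
  fix m assume nz: "f m \<noteq> 0"
  then have "m \<in> mons" using assms(1) by (auto simp: forms_def)
  then show "energy m \<noteq> 0" using energy_zero_iff[of m] assms(3) nz by metis
qed

lemma act_top_full: assumes "f \<in> forms" shows "act (nf (top_form v)) f \<in> full"
proof (rule act_in_subspace[OF full_subspace])
  fix w assume "w \<in> keys (nf (top_form v))"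
  then obtain m0 where "top_form v m0 \<noteq> 0" "w = nw m0" using keys_nf by blast
  then obtain k where w: "w = nw (topm k)" using top_form_nz(1) by metis
  show "actw w f \<in> full"
    unfolding full_def
  proof (intro CollectI allI impI ballI)
    fix m j assume nz: "actw w f m \<noteq> 0" and j: "j \<in> {1..n}"
    have "count_list w (X j) = 1" using count_nw[OF topm_mons, of k "X j"] j by (simp add: w)
    then have "1 \<le> m (X j)" using actw_support[OF nz] by auto
    moreover have "actw w f \<in> forms" unfolding w by (rule actw_forms[OF set_nw assms])
    then have "m (X j) \<le> 1" using nz by (auto simp: forms_def mons_def)
    ultimately show "m (X j) = 1" by simp
  qed
qed

lemma topm_iota: "topm k (iota g) = topm l (iota g)"
  by (cases g) simp_all

lemma nonempty_word_letter:
  assumes "t \<in> G.tens" "[] \<notin> keys t" "w \<in> keys (theta t)"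
  shows "\<exists>g. 1 \<le> count_list w (iota g)"
proof -
  obtain u where u: "u \<in> keys t" "w = map iota u" using keys_theta assms(3) by blast
  then obtain g u' where "u = g # u'" using assms(2) by (cases u) auto
  then show ?thesis using u by (intro exI[of _ g]) simp
qed

text \<open>
  In the product each exponent vector is that of some \<open>x\<^sub>1 \<cdots> x\<^sub>n z\<^sup>k\<close> with at least one more \<open>x\<^sub>i\<close> or \<open>y\<^sub>i\<close>.
\<close>

lemma act_theta_top_form:
  assumes "t \<in> G.tens" "[] \<notin> keys t"
  shows "act (theta t) (top_form v) \<in> (exact :: (_ \<Rightarrow> 'f::field_char_0) set)"
proof (rule exact_full)
  show "act (theta t) (top_form v) \<in> forms" using act_forms[OF _ top_form_forms] theta_tens[OF assms(1)] by blast
  show "act (theta t) (top_form v) \<in> full" by (rule full_act[OF top_form_full])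
  show "act (theta t) (top_form v) (topm k) = 0" for k
  proof (rule ccontr)
    assume "act (theta t) (top_form v) (topm k) \<noteq> 0"
    from act_support[OF this] obtain w m' where w: "w \<in> keys (theta t)" "top_form v m' \<noteq> 0"
      "topm k = (\<lambda>b. m' b + count_list w b)" by blast
    obtain g where g: "1 \<le> count_list w (iota g)" using nonempty_word_letter[OF assms w(1)] by blast
    have "m' (iota g) = topm k (iota g)" using top_form_nz(1)[OF w(2)] topm_iota by metis
    then show False using fun_cong[OF w(3), of "iota g"] g by simp
  qed
qed

lemma act_top_form:
  assumes "f \<in> forms" "\<And>m. f m \<noteq> 0 \<Longrightarrow> \<exists>g. g \<in> set (g_gens n) \<and> 1 \<le> m (iota g)"
  shows "act (nf (top_form v)) f \<in> (exact :: (_ \<Rightarrow> 'f::field_char_0) set)"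
proof (rule exact_full)
  show "act (nf (top_form v)) f \<in> forms" using act_forms[OF _ assms(1)] keys_nf_bs by blast
  show "act (nf (top_form v)) f \<in> full" by (rule act_top_full[OF assms(1)])
  show "act (nf (top_form v)) f (topm k) = 0" for k
  proof (rule ccontr)
    assume "act (nf (top_form v)) f (topm k) \<noteq> 0"
    from act_support[OF this] obtain w m' where w: "w \<in> keys (nf (top_form v))" "f m' \<noteq> 0"
      "topm k = (\<lambda>b. m' b + count_list w b)" by blast
    obtain g where g: "1 \<le> m' (iota g)" using assms(2)[OF w(2)] by blast
    obtain m0 where "top_form v m0 \<noteq> 0" "w = nw m0" using keys_nf w(1) by blast
    then obtain l where "w = nw (topm l)" using top_form_nz(1) by metis
    then have "count_list w (iota g) = topm k (iota g)" using count_nw[OF topm_mons] topm_iota by metis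
    then show False using fun_cong[OF w(3), of "iota g"] g by simp
  qed
qed

lemma ev_theta_forms: "t \<in> G.tens \<Longrightarrow> ev (theta t) \<in> forms"
  by (rule ev_tens[OF theta_tens])

lemma rep_tens: "s \<in> G.tens \<Longrightarrow> rep s v \<in> tens"
  unfolding rep_def by (rule tens_closed(1)[OF theta_tens nf_tens])

lemma ev_rep: "ev (rep s v) = ev (theta s) + top_form v"
  by (simp add: rep_def ev_nf)

lemma rep_add: "rep (s + t) (v + w) = rep s v + rep t w"
  by (simp add: rep_def nf_add)

lemma rep_diff: "rep (s - t) (v - w) = rep s v - rep t w"
  by (simp add: rep_def nf_diff)

lemma rep_scale: "rep (cst c * s) (Poly_Mapping.map ((*) c) v) = cst c * rep s v"
  by (simp add: rep_def nf_scale distrib_left)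

lemma rep_cocycle: assumes "s \<in> G.tens" shows "rep s v \<in> cocycles"
proof -
  have "pdv Z (ev (theta s)) = 0"
    unfolding lift_ev[OF assms, symmetric] by (auto simp: pdv_def lift_def)
  moreover have "pdv Z (top_form v) \<in> full"
    using top_form_full[of v] pdv_nz(2)[of Z "top_form v"] unfolding full_def by fastforce
  ultimately have "dmodel (ev (rep s v)) = 0" by (simp add: dmodel_def ev_rep full_omega)
  then show ?thesis using rep_tens[OF assms] by (simp add: cocycles_def)
qed

text \<open>
  A multiple of \<open>\<omega>\<close> has coefficient zero at \<open>x\<^sub>1 \<cdots> x\<^sub>n z\<^sup>k\<close>, so \<open>v = 0\<close>, and then \<open>G_ideal_eq\<close> applies.
\<close>

lemma rep_boundary:
  assumes s: "s \<in> G.tens" and v: "v \<in> V_carrier"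
  shows "rep s v \<in> boundaries \<longleftrightarrow> s \<in> G_ideal \<and> v = 0"
proof
  assume "rep s v \<in> boundaries"
  then have e: "ev (theta s) + top_form v \<in> exact" by (simp add: boundaries_def ev_rep)
  have "lookup v k = 0" for k
  proof (cases "1 \<le> k")
    case True
    obtain g where "ev (theta s) + top_form v = omega g" using e by blast
    then have "(ev (theta s) + top_form v) (topm k) = 0" by (simp add: omega_topm)
    moreover have "ev (theta s) (topm k) = 0"
      unfolding lift_ev[OF s, symmetric] using True by (simp add: lift_def)
    ultimately show ?thesis using True by (simp add: top_form_topm)
  next
    case False
    then show ?thesis using v by (auto simp: in_keys_iff)
  qed
  then have "v = 0" by (intro poly_mapping_eqI) simp
  then show "s \<in> G_ideal \<and> v = 0" using e s by (simp add: G_ideal_eq)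
next
  assume "s \<in> G_ideal \<and> v = 0"
  then show "rep s v \<in> boundaries" using rep_tens[OF s] by (simp add: boundaries_def ev_rep G_ideal_eq)
qed

text \<open>
  Split \<open>s\<close> and \<open>s'\<close> into a constant and a part of positive degree. Only the constants have a
  product with the \<open>V\<close> components that is not a coboundary.
\<close>

lemma rep_mult:
  fixes s s' :: "gen list \<Rightarrow>\<^sub>0 'f::field_char_0"
  assumes s: "s \<in> G.tens" and s': "s' \<in> G.tens"
  shows "rep s v * rep s' v' - rep (s * s') (Poly_Mapping.map ((*) (lookup s [])) v'
    + Poly_Mapping.map ((*) (lookup s' [])) v) \<in> boundaries"
proof -
  have plus: "\<exists>r. t = cst (lookup t []) + r \<and> r \<in> G.tens \<and> [] \<notin> keys r"
    if t: "t \<in> G.tens" for t :: "gen list \<Rightarrow>\<^sub>0 'f"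
  proof (intro exI conjI)
    show "t = cst (lookup t []) + (t - cst (lookup t []))" by simp
    show "t - cst (lookup t []) \<in> G.tens" by (rule G.tens_closed(2)[OF t]) simp
    show "[] \<notin> keys (t - cst (lookup t []))"
      by (simp add: in_keys_iff lookup_minus)
  qed
  let ?e = "lookup s []" and ?e' = "lookup s' []"
  obtain r where r: "s = cst ?e + r" "r \<in> G.tens" "[] \<notin> keys r" using plus[OF s] by blast
  obtain r' where r': "s' = cst ?e' + r'" "r' \<in> G.tens" "[] \<notin> keys r'" using plus[OF s'] by blast
  have A: "act (theta s) (top_form v') - fscale ?e (top_form v') \<in> exact"
    using act_theta_top_form[OF r(2,3), of v'] by (subst r(1)) simp
  have B: "act (nf (top_form v)) (ev (theta s')) - fscale ?e' (top_form v) \<in> exact"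
  proof -
    have "ev (theta (cst ?e')) = fscale ?e' (basisf (\<lambda>_. 0))" by (simp add: ev_def)
    then have "act (nf (top_form v)) (ev (theta s')) =
        fscale ?e' (ev (nf (top_form v))) + act (nf (top_form v)) (ev (theta r'))"
      by (subst r'(1)) (simp add: ev_def)
    moreover have "act (nf (top_form v)) (ev (theta r')) \<in> exact"
    proof (rule act_top_form[OF ev_theta_forms[OF r'(2)]])
      fix m assume nz: "ev (theta r') m \<noteq> 0"
      obtain w where w: "w \<in> keys (theta r')" "mset w = mset (nw m)"
        using ev_support[OF nz] theta_tens[OF r'(2)] by blast
      obtain g where g: "1 \<le> count_list w (iota g)" using nonempty_word_letter[OF r'(2,3) w(1)] by blast
      have "m \<in> mons" using ev_theta_forms[OF r'(2)] nz by (auto simp: forms_def)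
      then have m: "m (iota g) = count_list w (iota g)"
        using w(2) count_nw[of m "iota g"] by (metis count_mset)
      moreover have "iota g \<in> set (ba_gens n)" using m g \<open>m \<in> mons\<close> by (auto simp: mons_def)
      then have "g \<in> set (g_gens n)" by (auto simp: ba_gens_eq)
      ultimately show "\<exists>g. g \<in> set (g_gens n) \<and> 1 \<le> m (iota g)" using g by auto
    qed
    ultimately show ?thesis by (simp add: ev_nf)
  qed
  have C: "act (nf (top_form v)) (top_form v') \<in> exact"
  proof (rule act_top_form[OF top_form_forms])
    fix m assume "top_form v' m \<noteq> 0"
    then have "m = topm (m Z)" by (rule top_form_nz)
    then have "m (iota (Xi 1)) = 1" using n_pos by (metis atLeastAtMost_iff iota.simps(1) order_refl topm_simps(1))
    then show "\<exists>g. g \<in> set (g_gens n) \<and> 1 \<le> m (iota g)"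
      using n_pos by (intro exI[of _ "Xi 1"]) (auto simp: set_g_gens)
  qed
  let ?v = "Poly_Mapping.map ((*) ?e) v' + Poly_Mapping.map ((*) ?e') v"
  have "ev (rep s v * rep s' v' - rep (s * s') ?v) =
      (act (theta s) (top_form v') - fscale ?e (top_form v')) + (act (nf (top_form v)) (ev (theta s')) - fscale ?e' (top_form v))
      + act (nf (top_form v)) (top_form v')"
    by (simp add: ev_rep) (simp add: rep_def fun_eq_iff)
  also have "\<dots> \<in> exact" by (intro vs.subspace_add[OF exact_subspace] A B C)
  finally show ?thesis
    using tens_closed(2)[OF tens_closed(3)[OF rep_tens[OF s, of v] rep_tens[OF s', of v']]
        rep_tens[OF G.tens_closed(3)[OF s s']]] by (simp add: boundaries_def)
qed

definition zero_part :: "((ba_basis \<Rightarrow> nat) \<Rightarrow> 'f::field_char_0) \<Rightarrow> (gen \<Rightarrow> nat) \<Rightarrow> 'f" where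
  "zero_part f = (\<lambda>m. f (ext_exp m))"

definition top_coeffs :: "((ba_basis \<Rightarrow> nat) \<Rightarrow> 'f::field_char_0) \<Rightarrow> nat \<Rightarrow>\<^sub>0 'f" where
  "top_coeffs f = Abs_poly_mapping (\<lambda>k. if 1 \<le> k then f (topm k) else 0)"

lemma lookup_top_coeffs:
  assumes "f \<in> forms" shows "lookup (top_coeffs f) k = (if 1 \<le> k then f (topm k) else 0)"
proof -
  have "{k. (if 1 \<le> k then f (topm k) else 0) \<noteq> 0} \<subseteq> (\<lambda>m. m Z) ` {m. f m \<noteq> 0}"
    by (auto split: if_splits intro!: image_eqI[of _ _ "topm _"])
  then have "finite {k. (if 1 \<le> k then f (topm k) else 0) \<noteq> 0}"
    using assms finite_imageI unfolding forms_def by (blast intro: finite_subset)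
  then show ?thesis unfolding top_coeffs_def by (subst lookup_Abs_poly_mapping) auto
qed

text \<open>
  By \<open>cocycle_surviving\<close> only the terms without \<open>z\<close> and those at \<open>x\<^sub>1 \<cdots> x\<^sub>n z\<^sup>k\<close> matter; \<open>s\<close> represents the
  former, \<open>v\<close> lists the latter.
\<close>

lemma cocycle_rep:
  assumes z: "z \<in> (cocycles :: (_ \<Rightarrow>\<^sub>0 'f::field_char_0) set)"
  defines "s \<equiv> G.nf (zero_part (ev z))" and "v \<equiv> top_coeffs (ev z)"
  shows "s \<in> G.tens" "v \<in> V_carrier" "z - rep s v \<in> boundaries"
proof -
  let ?f = "ev z"
  have f: "?f \<in> forms" "dmodel ?f = 0" and zt: "z \<in> tens"
    using z ev_tens[of z] by (auto simp: cocycles_def)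
  let ?g = "\<lambda>m. if m Z = 0 then ?f m else 0"
  have f0: "?g \<in> forms" by (rule forms_restrict[OF f(1)])
  have zp: "zero_part ?f = (\<lambda>m. ?g (ext_exp m))" by (simp add: zero_part_def)
  have zpf: "zero_part ?f \<in> G.forms" "lift (zero_part ?f) = ?g"
    unfolding zp by (rule lift_surj[OF f0], metis (mono_tags))+
  show s: "s \<in> G.tens" unfolding s_def using G.keys_nf_bs by blast
  show "v \<in> V_carrier" unfolding v_def by (auto simp: in_keys_iff lookup_top_coeffs[OF f(1)] split: if_splits)
  have "ev (theta s) = ?g"
  proof -
    have "G.ev s = zero_part ?f" unfolding s_def by (rule G.ev_nf[OF zpf(1)])
    then show ?thesis unfolding lift_ev[OF s, symmetric] using zpf(2) by simp
  qed
  then have "ev (rep s v) m = surviving ?f m" for m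
    using energy_zero_iff[of m] f(1) energy_zero_iff[OF topm_mons]
    by (cases "m \<in> mons")
      (auto simp: ev_rep surviving_def top_form_def v_def lookup_top_coeffs[OF f(1)] forms_def topm_mons intro: ccontr)
  then have "ev (rep s v) = surviving ?f" by (rule ext)
  then have "ev (z - rep s v) \<in> exact" using cocycle_surviving[OF f] by simp
  then show "z - rep s v \<in> boundaries"
    using tens_closed(2)[OF zt rep_tens[OF s]] by (simp add: boundaries_def)
qed

lemma nw_ext_exp: "nw (ext_exp m) = map iota (G.nw m)"
proof -
  have "concat (map (\<lambda>b. replicate (ext_exp m b) b) (map iota gs)) =
      map iota (concat (map (\<lambda>g. replicate (m g) g) gs))" for gs
    by (induction gs) auto
  then show ?thesis unfolding nw_def G.nw_def unfolding ba_gens_eq by simp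
qed

text \<open>
  With \<open>P\<close> a condition on the size or on the total parity of a multiset of letters, this and the
  following lemma treat both gradings.
\<close>

lemma rep_homogeneous:
  assumes "\<And>w. w \<in> keys s \<Longrightarrow> P (mset (map iota w))"
    and "\<And>i. i \<in> keys v \<Longrightarrow> P (mset (nw (topm i)))"
    and w: "w \<in> keys (rep s v)"
  shows "P (mset w)"
proof -
  consider "w \<in> keys (theta s)" | "w \<in> keys (nf (top_form v))"
    using w Poly_Mapping.keys_add[of "theta s" "nf (top_form v)"] by (auto simp: rep_def)
  then show ?thesis
  proof cases
    case 1
    then show ?thesis using assms(1) keys_theta by blast
  next
    case 2
    then obtain m where "top_form v m \<noteq> 0" "w = nw m" using keys_nf by blast
    then show ?thesis using top_form_nz assms(2) by metis
  qed
qed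

lemma cocycle_rep_homogeneous:
  assumes z: "z \<in> cocycles" and P: "\<And>w. w \<in> keys z \<Longrightarrow> P (mset w)"
  shows "w \<in> keys (G.nf (zero_part (ev z))) \<Longrightarrow> P (mset (map iota w))"
    and "i \<in> keys (top_coeffs (ev z)) \<Longrightarrow> P (mset (nw (topm i)))"
proof -
  have zt: "z \<in> tens" using z by (simp add: cocycles_def)
  have *: "P (mset (nw m))" if "ev z m \<noteq> 0" for m
    using ev_support[OF that] zt P by fastforce
  {
    assume "w \<in> keys (G.nf (zero_part (ev z)))"
    then obtain m where "w = G.nw m" "ev z (ext_exp m) \<noteq> 0"
      using G.keys_nf by (fastforce simp: zero_part_def)
    then show "P (mset (map iota w))" using * nw_ext_exp by metis
  }
  {
    assume "i \<in> keys (top_coeffs (ev z))"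
    then have "ev z (topm i) \<noteq> 0"
      using lookup_top_coeffs[OF ev_tens[OF zt]] by (auto simp: in_keys_iff split: if_splits)
    then show "P (mset (nw (topm i)))" by (rule *)
  }
qed

lemma length_nw_topm: "length (nw (topm i)) = n + i"
  by (simp add: nw_topm)

lemma parity_nw_topm: "sum_list (map ba_par (nw (topm i))) = of_nat i"
proof -
  have "sum_list (map ba_par (map X is)) = 0" for "is" by (induction "is") simp_all
  then show ?thesis
    by (simp only: nw_topm map_append sum_list_append map_replicate sum_list_replicate) simp
qed

lemma ba_par_comp_iota: "ba_par \<circ> iota = g_par"
  by (simp add: fun_eq_iff)

text \<open>
  The ideal generated by the elements of positive degree consists of the classes without constant
  term. The constant term of a class is well defined, because the relations have none.
\<close>

lemma aug_G:
  assumes "presentation (G_alg n) G.tens (G_ideal :: (_ \<Rightarrow>\<^sub>0 'f::field_char_0) set) cst deg_part (par_part g_par) cl"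
    and t: "t \<in> G.tens"
  shows "aug (G_alg n) (cl t) = lookup t []"
proof -
  let ?A = "G_alg n :: ('f, (gen list \<Rightarrow>\<^sub>0 'f) set) galg"
  interpret P: presentation ?A G.tens "G_ideal :: (_ \<Rightarrow>\<^sub>0 'f) set" cst deg_part "par_part g_par" cl
    by fact
  interpret R: ring ?A by (rule P.ring)
  let ?pos = "\<Union>k\<in>{0<..}. zgr ?A k"
  let ?I = "Idl\<^bsub>?A\<^esub> ?pos"
  let ?N = "{t \<in> G.tens. lookup t [] = (0 :: 'f)}"
  have mult_nil: "lookup (s * t) [] = lookup s [] * lookup t []"
    for s t :: "gen list \<Rightarrow>\<^sub>0 'f"
  proof (rule additive_eqI[of "\<lambda>s. lookup (s * t) []" "\<lambda>s. lookup s [] * lookup t []"])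
    show "lookup (single w a * t) [] =
        lookup (single w a) [] * lookup t []" for w a
      by (rule additive_eqI[of "\<lambda>t. lookup (single w a * t) []"
          "\<lambda>t. lookup (single w a) [] * lookup t []"])
        (auto simp: lookup_add algebra_simps mult_single plus_list_def lookup_single when_def)
  qed (simp_all add: lookup_add algebra_simps)
  have posc: "?pos \<subseteq> carrier ?A" by (auto simp: P.zgr_eq P.carrier_eq)
  have nil_not: "lookup r [] = 0" if "r \<in> G_ideal" for r :: "_ \<Rightarrow>\<^sub>0 'f"
  proof -
    from that have r: "r \<in> G.tens" "ev (theta r) \<in> exact" by (auto simp: G_ideal_eq)
    obtain g where g: "ev (theta r) = omega g" using r(2) by blast
    have "omega g (\<lambda>_. 0) = 0" by (simp add: omega_def sum_apply lmul_def)
    moreover have "ev (theta r) (\<lambda>_. 0) = G.ev r (\<lambda>_. 0)"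
      unfolding lift_ev[OF r(1), symmetric] by (simp add: lift_def)
    moreover have "G.ev r (\<lambda>_. 0) = lookup r []"
    proof (rule additive_eqI[of "\<lambda>r. G.ev r (\<lambda>_. 0)" "\<lambda>r. lookup r []"])
      show "G.ev (single w a) (\<lambda>_. 0) = lookup (single w a) []" for w a
        by (cases w) (simp_all add: G.ev_def fscale_def G.basisf_def G.lmul_def lookup_single)
    qed (simp_all add: lookup_add)
    ultimately show ?thesis using g by simp
  qed
  have NI: "cl ` ?N = ?I"
  proof
    have "ideal (cl ` ?N) ?A"
    proof (rule P.ideal_image)
      show "x - y \<in> ?N" if "x \<in> ?N" "y \<in> ?N" for x y
        using that G.tens_closed(2)[of x y] by (simp add: lookup_minus)
      show "r * x \<in> ?N" "x * r \<in> ?N" if "r \<in> G.tens" "x \<in> ?N" for r x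
        using that G.tens_closed(3)[of r x] G.tens_closed(3)[of x r] by (simp_all add: mult_nil)
    qed auto
    moreover have "?pos \<subseteq> cl ` ?N"
    proof
      fix x assume "x \<in> ?pos"
      then obtain k s where s: "0 < k" "s \<in> G.tens" "s \<in> deg_part k" "x = cl s"
        by (auto simp: P.zgr_eq)
      then have "[] \<notin> keys s" by auto
      then show "x \<in> cl ` ?N" using s by (auto simp: in_keys_iff)
    qed
    ultimately show "?I \<subseteq> cl ` ?N" by (rule R.genideal_minimal)
  next
    interpret I: ideal ?I ?A by (rule R.genideal_ideal[OF posc])
    have word: "cl (single w a) \<in> ?I" if "w \<noteq> []" "set w \<subseteq> set (g_gens n)" for w a
    proof -
      have "cl (single w a) \<in> zgr ?A (int (length w))"
        unfolding P.zgr_eq using that by (intro imageI) simp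
      then show ?thesis using that R.genideal_self[OF posc] by fastforce
    qed
    have sums: "(\<Sum>w\<in>S. single w (h w)) \<in> G.tens \<and> cl (\<Sum>w\<in>S. single w (h w)) \<in> ?I"
      if "finite S" "\<And>w. w \<in> S \<Longrightarrow> w \<noteq> [] \<and> set w \<subseteq> set (g_gens n)" for S and h :: "_ \<Rightarrow> 'f"
      using that
    proof (induction S rule: finite_induct)
      case empty
      show ?case using additive_subgroup.zero_closed[OF I.additive_subgroup_axioms] by (simp add: P.zero_cl)
    next
      case (insert w S)
      have 1: "(\<Sum>w\<in>S. single w (h w)) \<in> G.tens" "cl (\<Sum>w\<in>S. single w (h w)) \<in> ?I"
        using insert by auto
      have 2: "single w (h w) \<in> G.tens" using insert.prems[of w] by simp
      have 3: "cl (single w (h w)) \<in> ?I" by (rule word) (use insert.prems in auto)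
      from additive_subgroup.a_closed[OF I.additive_subgroup_axioms 3 1(2)] P.R_add[OF 2 1(1)]
      show ?case unfolding sum.insert[OF insert.hyps] by (simp only: P.add_cl[OF 2 1(1)] simp_thms)
    qed
    show "cl ` ?N \<subseteq> ?I"
    proof
      fix x assume "x \<in> cl ` ?N"
      then obtain s where s: "s \<in> G.tens" "lookup s [] = 0" "x = cl s" by blast
      have "[] \<notin> keys s" using s(2) by (simp add: in_keys_iff)
      then have "cl (\<Sum>w\<in>keys s. single w (lookup s w)) \<in> ?I"
        by (intro conjunct2[OF sums]) (use s(1) in auto)
      then show "x \<in> ?I" unfolding sum_singles s(3) .
    qed
  qed
  have mem: "cl t \<ominus>\<^bsub>?A\<^esub> c \<odot>\<^bsub>?A\<^esub> \<one>\<^bsub>?A\<^esub> \<in> ?I \<longleftrightarrow> c = lookup t []" for c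
  proof -
    have c: "cst c \<in> G.tens" by simp
    have d: "t - cst c \<in> G.tens" by (rule G.tens_closed(2)[OF t c])
    have "c \<odot>\<^bsub>?A\<^esub> \<one>\<^bsub>?A\<^esub> = cl (cst c)"
      by (simp add: P.one_cl P.smult_cl[OF P.R_one])
    then have "cl t \<ominus>\<^bsub>?A\<^esub> c \<odot>\<^bsub>?A\<^esub> \<one>\<^bsub>?A\<^esub> = cl (t - cst c)"
      by (simp only: P.minus_cl[OF t c])
    also have "\<dots> \<in> ?I \<longleftrightarrow> lookup (t - cst c) [] = 0"
    proof
      assume "cl (t - cst c) \<in> ?I"
      then obtain s where s: "s \<in> G.tens" "lookup s [] = 0" "cl (t - cst c) = cl s"
        unfolding NI[symmetric] by blast
      then have "t - cst c - s \<in> G_ideal" using P.cl_eq[OF d s(1)] by simp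
      from nil_not[OF this] s(2) show "lookup (t - cst c) [] = 0" by (simp add: lookup_minus)
    next
      assume "lookup (t - cst c) [] = 0"
      then show "cl (t - cst c) \<in> ?I" unfolding NI[symmetric] using d by blast
    qed
    also have "\<dots> \<longleftrightarrow> c = lookup t []" by (auto simp: lookup_minus)
    finally show ?thesis .
  qed
  show ?thesis unfolding aug_def mem by simp
qed

text \<open>
  The isomorphism sends the class of \<open>rep s v\<close> to the pair of the class of \<open>s\<close> and \<open>v\<close>.
\<close>

theorem cohomology_iso:
  "galg_iso (cohomology (ba n) :: ('f::field_char_0, _) galg) (dsum (G_alg n) (V_alg n))"
proof -
  let ?H = "cohomology (ba n) :: ('f, (ba_basis list \<Rightarrow>\<^sub>0 'f) set set) galg"
  let ?D = "dsum (G_alg n) (V_alg n) :: ('f, _) galg"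
  obtain cl where "presentation ?H cocycles boundaries cst deg_part (par_part ba_par) cl"
    using cohomology_presentation by blast
  then interpret H: presentation ?H cocycles boundaries cst deg_part "par_part ba_par" cl .
  obtain cg where cg: "presentation (G_alg n) G.tens (G_ideal :: (_ \<Rightarrow>\<^sub>0 'f) set) cst deg_part (par_part g_par) cg"
    using G_presentation by blast
  then interpret A: presentation "G_alg n" G.tens "G_ideal :: (_ \<Rightarrow>\<^sub>0 'f) set" cst deg_part "par_part g_par" cg .
  \<comment> \<open>The representatives of a class differ by a coboundary, so by \<open>rep_boundary\<close> the pair is unique.\<close>
  define \<phi> where "\<phi> x = (SOME p. \<exists>s\<in>G.tens. \<exists>v\<in>V_carrier. p = (cg s, v) \<and> x = cl (rep s v))" for x
  have uniq: "cg s = cg s' \<and> v = v'" if "cl (rep s v) = cl (rep s' v')"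
    "s \<in> G.tens" "s' \<in> G.tens" "v \<in> V_carrier" "v' \<in> V_carrier" for s s' v v'
  proof -
    have "rep (s - s') (v - v') \<in> boundaries"
      using that(1) unfolding rep_diff H.cl_eq[OF rep_cocycle[OF that(2)] rep_cocycle[OF that(3)]] .
    moreover have "s - s' \<in> G.tens" by (rule G.tens_closed(2)[OF that(2,3)])
    moreover have "v - v' \<in> V_carrier" using that(4,5) keys_diff[of v v'] by blast
    ultimately show ?thesis using rep_boundary A.cl_eq[OF that(2,3)] by fastforce
  qed
  have phi: "\<phi> (cl (rep s v)) = (cg s, v)" if "s \<in> G.tens" "v \<in> V_carrier" for s v
  proof -
    have "\<exists>p. \<exists>s'\<in>G.tens. \<exists>v'\<in>V_carrier. p = (cg s', v') \<and> cl (rep s v) = cl (rep s' v')"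
      using that by blast
    from someI_ex[OF this] obtain s' v' where *: "s' \<in> G.tens" "v' \<in> V_carrier"
      "\<phi> (cl (rep s v)) = (cg s', v')" "cl (rep s v) = cl (rep s' v')"
      unfolding \<phi>_def by blast
    from uniq[OF *(4) that(1) *(1) that(2) *(2)] *(3) show ?thesis by simp
  qed
  define S V where "S z = G.nf (zero_part (ev z))" and "V z = top_coeffs (ev z)" for z :: "_ \<Rightarrow>\<^sub>0 'f"
  have repr: "S z \<in> G.tens" "V z \<in> V_carrier" "cl z = cl (rep (S z) (V z))" if z: "z \<in> cocycles" for z
  proof -
    note r = cocycle_rep[OF z, folded S_def V_def]
    show "S z \<in> G.tens" "V z \<in> V_carrier" by (rule r)+
    show "cl z = cl (rep (S z) (V z))" unfolding H.cl_eq[OF z rep_cocycle[OF r(1)]] by (rule r(3))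
  qed
  have carrier: "\<exists>s\<in>G.tens. \<exists>v\<in>V_carrier. x = cl (rep s v)" if x: "x \<in> carrier ?H" for x
  proof -
    obtain z where "z \<in> cocycles" "x = cl z" using x unfolding H.carrier_eq by blast
    then show ?thesis using repr[of z] by blast
  qed
  have rep_carrier: "cl (rep s v) \<in> carrier ?H" if "s \<in> G.tens" for s v
    unfolding H.carrier_eq by (intro imageI rep_cocycle that)
  have carrier_D: "carrier ?D = cg ` G.tens \<times> V_carrier"
    by (simp add: dsum_def A.carrier_eq V_alg_def)
  have map_V: "Poly_Mapping.map ((*) c) v \<in> V_carrier" if "v \<in> V_carrier" for c :: 'f and v
    using that by (auto simp: in_keys_iff Poly_Mapping.map.rep_eq when_def split: if_splits)
  have add_V: "v + w \<in> V_carrier" if "v \<in> V_carrier" "w \<in> V_carrier" for v w :: "nat \<Rightarrow>\<^sub>0 'f"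
    using that Poly_Mapping.keys_add[of v w] by blast
  have hom: "\<phi> \<in> ring_hom ?H ?D"
  proof (rule ring_hom_memI)
    fix x assume "x \<in> carrier ?H"
    then obtain s v where "s \<in> G.tens" "v \<in> V_carrier" "x = cl (rep s v)" using carrier by blast
    then show "\<phi> x \<in> carrier ?D" using phi unfolding carrier_D by auto
  next
    fix x y assume "x \<in> carrier ?H" "y \<in> carrier ?H"
    then obtain s v s' v' where x: "s \<in> G.tens" "v \<in> V_carrier" "x = cl (rep s v)"
      and y: "s' \<in> G.tens" "v' \<in> V_carrier" "y = cl (rep s' v')" using carrier by blast
    let ?v = "Poly_Mapping.map ((*) (lookup s [])) v' + Poly_Mapping.map ((*) (lookup s' [])) v"
    have ss: "s * s' \<in> G.tens" by (rule G.tens_closed(3)[OF x(1) y(1)])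
    have vv: "?v \<in> V_carrier" by (intro add_V map_V x y)
    have "x \<otimes>\<^bsub>?H\<^esub> y = cl (rep s v * rep s' v')"
      unfolding x(3) y(3) by (intro H.mult_cl rep_cocycle x y)
    also have "\<dots> = cl (rep (s * s') ?v)"
      unfolding H.cl_eq[OF H.R_mult[OF rep_cocycle[OF x(1)] rep_cocycle[OF y(1)]] rep_cocycle[OF ss]]
      by (rule rep_mult[OF x(1) y(1)])
    finally have "\<phi> (x \<otimes>\<^bsub>?H\<^esub> y) = (cg (s * s'), ?v)" using phi[OF ss vv] by simp
    then show "\<phi> (x \<otimes>\<^bsub>?H\<^esub> y) = \<phi> x \<otimes>\<^bsub>?D\<^esub> \<phi> y"
      unfolding x(3) y(3) phi[OF x(1,2)] phi[OF y(1,2)]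
      by (simp add: dsum_def A.mult_cl[OF x(1) y(1)] aug_G[OF cg x(1)] aug_G[OF cg y(1)] V_alg_def)
    have s2: "s + s' \<in> G.tens" by (rule G.tens_closed(1)[OF x(1) y(1)])
    have "x \<oplus>\<^bsub>?H\<^esub> y = cl (rep (s + s') (v + v'))"
      unfolding x(3) y(3) rep_add by (intro H.add_cl rep_cocycle x y)
    then have "\<phi> (x \<oplus>\<^bsub>?H\<^esub> y) = (cg (s + s'), v + v')" using phi[OF s2 add_V[OF x(2) y(2)]] by simp
    then show "\<phi> (x \<oplus>\<^bsub>?H\<^esub> y) = \<phi> x \<oplus>\<^bsub>?D\<^esub> \<phi> y"
      unfolding x(3) y(3) phi[OF x(1,2)] phi[OF y(1,2)]
      by (simp add: dsum_def A.add_cl[OF x(1) y(1)] V_alg_def)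
  next
    have one: "rep 1 0 = (1 :: _ \<Rightarrow>\<^sub>0 'f)" by (simp add: rep_def)
    have "\<phi> \<one>\<^bsub>?H\<^esub> = (cg 1, 0)"
      using phi[OF A.R_one, of 0] by (simp add: H.one_cl one)
    then show "\<phi> \<one>\<^bsub>?H\<^esub> = \<one>\<^bsub>?D\<^esub>" by (simp add: dsum_def A.one_cl V_alg_def)
  qed
  have bij: "bij_betw \<phi> (carrier ?H) (carrier ?D)"
  proof (rule bij_betw_imageI)
    show "inj_on \<phi> (carrier ?H)"
    proof (rule inj_onI)
      fix x y assume "x \<in> carrier ?H" "y \<in> carrier ?H" and eq: "\<phi> x = \<phi> y"
      then obtain s v s' v' where x: "s \<in> G.tens" "v \<in> V_carrier" "x = cl (rep s v)"
        and y: "s' \<in> G.tens" "v' \<in> V_carrier" "y = cl (rep s' v')" using carrier by blast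
      have "cg s = cg s'" "v = v'" using eq unfolding x(3) y(3) phi[OF x(1,2)] phi[OF y(1,2)] by auto
      then have "s - s' \<in> G_ideal" using A.cl_eq[OF x(1) y(1)] by simp
      then have "rep (s - s') (v - v') \<in> boundaries"
        using rep_boundary[OF G.tens_closed(2)[OF x(1) y(1)], of "v - v'"] \<open>v = v'\<close> by simp
      then show "x = y" unfolding x(3) y(3) H.cl_eq[OF rep_cocycle[OF x(1)] rep_cocycle[OF y(1)]] rep_diff .
    qed
    show "\<phi> ` carrier ?H = carrier ?D"
    proof
      show "\<phi> ` carrier ?H \<subseteq> carrier ?D" using ring_hom_closed[OF hom] by blast
      show "carrier ?D \<subseteq> \<phi> ` carrier ?H"
      proof
        fix p assume "p \<in> carrier ?D"
        then obtain s v where "s \<in> G.tens" "v \<in> V_carrier" "p = (cg s, v)" unfolding carrier_D by auto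
        then show "p \<in> \<phi> ` carrier ?H" using phi[of s v] rep_carrier[of s v] by (metis imageI)
      qed
    qed
  qed
  have smult: "\<phi> (c \<odot>\<^bsub>?H\<^esub> x) = c \<odot>\<^bsub>?D\<^esub> \<phi> x" if xH: "x \<in> carrier ?H" for c x
  proof -
    obtain s v where x: "s \<in> G.tens" "v \<in> V_carrier" "x = cl (rep s v)" using carrier[OF xH] by blast
    have cs: "cst c * s \<in> G.tens" by (rule G.tens_closed(3)[OF _ x(1)]) simp
    have "c \<odot>\<^bsub>?H\<^esub> x = cl (rep (cst c * s) (Poly_Mapping.map ((*) c) v))"
      unfolding x(3) rep_scale by (intro H.smult_cl rep_cocycle x)
    then have "\<phi> (c \<odot>\<^bsub>?H\<^esub> x) = (cg (cst c * s), Poly_Mapping.map ((*) c) v)"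
      using phi[OF cs map_V[OF x(2)]] by simp
    then show ?thesis unfolding x(3) phi[OF x(1,2)]
      by (simp add: dsum_def A.smult_cl[OF x(1)] V_alg_def)
  qed
  have graded: "\<phi> ` cl ` (cocycles \<inter> {z. \<forall>w\<in>keys z. P (mset w)}) =
      cg ` (G.tens \<inter> {s. \<forall>w\<in>keys s. P (mset (map iota w))}) \<times>
      (V_carrier \<inter> {v :: nat \<Rightarrow>\<^sub>0 'f. \<forall>i\<in>keys v. P (mset (nw (topm i)))})" for P
  proof (intro equalityI subsetI)
    fix p assume "p \<in> \<phi> ` cl ` (cocycles \<inter> {z. \<forall>w\<in>keys z. P (mset w)})"
    then obtain z where z: "z \<in> cocycles" "\<forall>w\<in>keys z. P (mset w)" "p = \<phi> (cl z)" by blast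
    note rz = repr[OF z(1)]
    have "p = (cg (S z), V z)" unfolding z(3) rz(3) by (rule phi[OF rz(1,2)])
    moreover have "\<forall>w\<in>keys (S z). P (mset (map iota w))" "\<forall>i\<in>keys (V z). P (mset (nw (topm i)))"
      unfolding S_def V_def using cocycle_rep_homogeneous[OF z(1), of P] z(2) by blast+
    ultimately show "p \<in> cg ` (G.tens \<inter> {s. \<forall>w\<in>keys s. P (mset (map iota w))}) \<times>
        (V_carrier \<inter> {v :: nat \<Rightarrow>\<^sub>0 'f. \<forall>i\<in>keys v. P (mset (nw (topm i)))})" using rz(1,2) by blast
  next
    fix p assume "p \<in> cg ` (G.tens \<inter> {s. \<forall>w\<in>keys s. P (mset (map iota w))}) \<times>
      (V_carrier \<inter> {v :: nat \<Rightarrow>\<^sub>0 'f. \<forall>i\<in>keys v. P (mset (nw (topm i)))})"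
    then obtain s v where sv: "s \<in> G.tens" "\<forall>w\<in>keys s. P (mset (map iota w))" "v \<in> V_carrier"
      "\<forall>i\<in>keys v. P (mset (nw (topm i)))" "p = (cg s, v)" by blast
    have "P (mset w)" if "w \<in> keys (rep s v)" for w
      by (rule rep_homogeneous[OF _ _ that]) (use sv(2,4) in blast)+
    then have "rep s v \<in> cocycles \<inter> {z. \<forall>w\<in>keys z. P (mset w)}" using rep_cocycle[OF sv(1)] by blast
    moreover have "p = \<phi> (cl (rep s v))" unfolding sv(5) by (rule phi[OF sv(1,3), symmetric])
    ultimately show "p \<in> \<phi> ` cl ` (cocycles \<inter> {z. \<forall>w\<in>keys z. P (mset w)})" by blast
  qed
  have zgr: "\<phi> ` zgr ?H k = zgr ?D k" for k
  proof -
    have "zgr (V_alg n :: ('f, _) galg) k = V_carrier \<inter> {v. \<forall>i\<in>keys v. int n + int i = k}"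
      by (auto simp: V_alg_def)
    then show ?thesis using graded[of "\<lambda>M. int (size M) = k"]
      by (simp add: dsum_def H.zgr_eq A.zgr_eq length_nw_topm)
  qed
  have pgr: "\<phi> ` pgr ?H p = pgr ?D p" for p
  proof -
    have "pgr (V_alg n :: ('f, _) galg) p = V_carrier \<inter> {v. \<forall>i\<in>keys v. of_nat i = p}"
      by (auto simp: V_alg_def)
    moreover have "sum_mset (image_mset ba_par (mset w)) = sum_list (map ba_par w)" for w
      by (simp add: sum_mset_sum_list flip: mset_map)
    ultimately show ?thesis using graded[of "\<lambda>M. sum_mset (image_mset ba_par M) = p"]
      by (simp only: dsum_def H.pgr_eq A.pgr_eq parity_nw_topm map_map ba_par_comp_iota galg.simps)
  qed
  have "\<phi> \<in> ring_iso ?H ?D" using hom bij by (simp add: ring_iso_def)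
  then show ?thesis unfolding galg_iso_def using smult zgr pgr by blast
qed

end

section \<open>Dimensions\<close>

lemma adapted_basis:
  fixes U N :: "('k \<Rightarrow> 'f::field) set"
  assumes U: "vs.subspace U" and N: "vs.subspace N" "N \<subseteq> U" and fin: "finite S" "U \<subseteq> vs.span S"
  shows "\<exists>B C. finite B \<and> finite C \<and> B \<inter> C = {} \<and> vs.independent (B \<union> C) \<and> vs.span B = N \<and>
    vs.span (B \<union> C) = U \<and> card B = vs.dim N \<and> card B + card C = vs.dim U"
proof -
  obtain B where B: "B \<subseteq> N" "vs.independent B" "N \<subseteq> vs.span B" "card B = vs.dim N"
    using vs.basis_exists by blast
  have sB: "vs.span B = N" using B N(1) vs.span_minimal by blast
  obtain B' where B': "B \<subseteq> B'" "B' \<subseteq> U" "vs.independent B'" "U \<subseteq> vs.span B'"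
    using vs.maximal_independent_subset_extend[of B U] B N(2) by blast
  have sU: "vs.span B' = U" using B' U vs.span_minimal by blast
  have fB': "finite B'" using vs.independent_span_bound[OF fin(1) B'(3)] B'(2) fin(2) by blast
  have "card B' = vs.dim U" using vs.dim_span_eq_card_independent[OF B'(3)] sU by simp
  then have "card B + card (B' - B) = vs.dim U"
    using B'(1) fB' card_mono[OF fB' B'(1)] by (simp add: card_Diff_subset finite_subset)
  moreover have "B \<union> (B' - B) = B'" using B'(1) by blast
  ultimately show ?thesis using B B' sB sU fB'
    by (intro exI[of _ B] exI[of _ "B' - B"]) (auto intro: finite_subset)
qed

text \<open>
  The space \<open>L ` U\<close> grows from \<open>L ` N\<close> by adding, one at a time, the basis vectors of a complement of
  \<open>N\<close> in \<open>U\<close>. With \<open>P\<close> a notion of dimension this computes the dimension of a quotient.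
\<close>

lemma quotient_induct:
  fixes U N :: "('k \<Rightarrow> 'f::field) set" and L :: "('k \<Rightarrow> 'f) \<Rightarrow> 'a"
  assumes U: "vs.subspace U" and N: "vs.subspace N" "N \<subseteq> U" and fin: "finite S" "U \<subseteq> vs.span S"
    and ker: "\<And>f g. f \<in> U \<Longrightarrow> g \<in> U \<Longrightarrow> L f = L g \<longleftrightarrow> f - g \<in> N"
    and base: "P 0 (L ` N)"
    and step: "\<And>d c X. vs.subspace X \<Longrightarrow> X \<subseteq> U \<Longrightarrow> c \<in> U \<Longrightarrow> L c \<notin> L ` X \<Longrightarrow> P d (L ` X) \<Longrightarrow>
      P (Suc d) (L ` {x. \<exists>k. x - fscale k c \<in> X})"
  shows "P (vs.dim U - vs.dim N) (L ` U)"
proof -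
  obtain B C where *: "finite B" "finite C" "B \<inter> C = {}" "vs.independent (B \<union> C)" "vs.span B = N"
    "vs.span (B \<union> C) = U" "card B = vs.dim N" "card B + card C = vs.dim U"
    using adapted_basis[OF U N fin] by blast
  have "C' \<subseteq> C \<Longrightarrow> P (card C') (L ` vs.span (B \<union> C'))" if "finite C'" for C'
    using that
  proof (induction C' rule: finite_induct)
    case empty
    then show ?case using base *(5) by simp
  next
    case (insert c C')
    have "c \<notin> B \<union> C'" "insert c (B \<union> C') \<subseteq> B \<union> C" using insert *(3) by auto
    then have c: "c \<notin> vs.span (B \<union> C')"
      using vs.independent_mono[OF *(4)] vs.independent_insert[of c "B \<union> C'"] by metis
    have sub: "vs.span (B \<union> C') \<subseteq> U" "c \<in> U"
      using insert.prems *(6) vs.span_mono[of "B \<union> C'" "B \<union> C"] vs.span_base[of c "B \<union> C"] by auto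
    have nin: "L c \<notin> L ` vs.span (B \<union> C')"
    proof
      assume "L c \<in> L ` vs.span (B \<union> C')"
      then obtain x where x: "x \<in> vs.span (B \<union> C')" "L c = L x" by blast
      then have "c - x \<in> vs.span B" using ker[OF sub(2), of x] sub(1) *(5) by blast
      then have "c - x \<in> vs.span (B \<union> C')" using vs.span_mono[of B "B \<union> C'"] by blast
      then have "(c - x) + x \<in> vs.span (B \<union> C')" using x(1) by (rule vs.span_add)
      then show False using c by simp
    qed
    have "P (Suc (card C')) (L ` vs.span (insert c (B \<union> C')))"
      unfolding vs.span_insert using insert by (intro step vs.subspace_span sub nin) auto
    then show ?case using insert.hyps by simp
  qed
  from this[OF *(2) order_refl] show ?thesis using *(6-8) by (metis add_diff_cancel_left')
qed

lemma dim_mono_subspace: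
  fixes U N :: "('k \<Rightarrow> 'f::field) set"
  assumes "vs.subspace U" "vs.subspace N" "N \<subseteq> U" "finite S" "U \<subseteq> vs.span S"
  shows "vs.dim N \<le> vs.dim U"
  using adapted_basis[OF assms] by (metis le_add1)

lemma rank_nullity:
  fixes U :: "('k \<Rightarrow> 'f::field) set" and h :: "('k \<Rightarrow> 'f) \<Rightarrow> 'l \<Rightarrow> 'f"
  assumes U: "vs.subspace U" and fin: "finite S" "U \<subseteq> vs.span S"
    and add: "\<And>f g. h (f + g) = h f + h g" and scale: "\<And>c f. h (fscale c f) = fscale c (h f)"
  shows "vs.dim (h ` U) + vs.dim {f \<in> U. h f = 0} = vs.dim U"
proof -
  let ?N = "{f \<in> U. h f = 0}"
  let ?P = "\<lambda>d X. \<exists>B. vs.independent B \<and> finite B \<and> card B = d \<and> vs.span B = X"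
  have h0: "h 0 = 0" by (rule additive_zero[of h]) (rule add)
  have diff: "h (f - g) = h f - h g" for f g using add[of "f - g" g] by simp
  have N: "vs.subspace ?N" "?N \<subseteq> U"
    using U by (auto simp: vs.subspace_def h0 add scale)
  have "?P (vs.dim U - vs.dim ?N) (h ` U)"
  proof (rule quotient_induct[OF U N fin])
    show "h f = h g \<longleftrightarrow> f - g \<in> ?N" if "f \<in> U" "g \<in> U" for f g
      using vs.subspace_diff[OF U that] by (simp add: diff)
    have "h ` ?N = {0}" using vs.subspace_0[OF N(1)] h0 by force
    then show "?P 0 (h ` ?N)" using vs.independent_empty by (intro exI[of _ "{}"]) simp
  next
    fix d c X assume nin: "h c \<notin> h ` X" and "?P d (h ` X)"
    then obtain B where B: "vs.independent B" "finite B" "card B = d" "vs.span B = h ` X" by blast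
    have "vs.span (insert (h c) B) = h ` {x. \<exists>k. x - fscale k c \<in> X}"
    proof (intro equalityI subsetI)
      fix y assume "y \<in> vs.span (insert (h c) B)"
      then obtain k x where x: "x \<in> X" "y - fscale k (h c) = h x" unfolding vs.span_insert B(4) by blast
      then have "y = h (x + fscale k c)" by (simp add: add scale diff_eq_eq)
      then show "y \<in> h ` {x. \<exists>k. x - fscale k c \<in> X}" using x(1) by (auto intro!: image_eqI exI[of _ k])
    next
      fix y assume "y \<in> h ` {x. \<exists>k. x - fscale k c \<in> X}"
      then obtain k x where x: "x - fscale k c \<in> X" "y = h x" by blast
      have "h x - fscale k (h c) \<in> h ` X" using imageI[OF x(1), of h] by (simp add: diff scale)
      then show "y \<in> vs.span (insert (h c) B)" unfolding vs.span_insert B(4) x(2) by blast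
    qed
    moreover have "h c \<notin> B" using nin B(4) vs.span_base by metis
    ultimately show "?P (Suc d) (h ` {x. \<exists>k. x - fscale k c \<in> X})"
      using B nin by (intro exI[of _ "insert (h c) B"]) (simp add: vs.independent_insertI)
  qed
  then have "vs.dim (h ` U) = vs.dim U - vs.dim ?N" by (metis vs.dim_span_eq_card_independent)
  then show ?thesis using dim_mono_subspace[OF U N fin] by simp
qed

text \<open>
  Transfers dimensions from spaces of functions to subspaces of an abstract algebra.
\<close>

lemma dimension_quotient:
  fixes U N :: "('k \<Rightarrow> 'f::field) set" and L :: "('k \<Rightarrow> 'f) \<Rightarrow> 'a" and K :: "'f \<Rightarrow> 'a"
  assumes R: "ring R" and U: "vs.subspace U" and N: "vs.subspace N" "N \<subseteq> U"
    and fin: "finite S" "U \<subseteq> vs.span S"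
    and closed: "\<And>f. f \<in> U \<Longrightarrow> L f \<in> carrier R"
    and add: "\<And>f g. f \<in> U \<Longrightarrow> g \<in> U \<Longrightarrow> L (f + g) = L f \<oplus>\<^bsub>R\<^esub> L g"
    and scale: "\<And>c f. f \<in> U \<Longrightarrow> L (fscale c f) = K c \<otimes>\<^bsub>R\<^esub> L f"
    and ker: "\<And>f g. f \<in> U \<Longrightarrow> g \<in> U \<Longrightarrow> L f = L g \<longleftrightarrow> f - g \<in> N"
  shows "ring.dimension R (vs.dim U - vs.dim N) (range K) (L ` U)"
proof -
  interpret ring R by (rule R)
  have U0: "0 \<in> U" by (rule vs.subspace_0[OF U])
  have L0: "L 0 = \<zero>\<^bsub>R\<^esub>"
  proof -
    have "L 0 \<oplus>\<^bsub>R\<^esub> L 0 = L 0" using add[OF U0 U0] by simp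
    then show ?thesis using closed[OF U0] by (metis add.l_cancel_one)
  qed
  show ?thesis
  proof (rule quotient_induct[OF U N fin ker])
    have "L x = L 0" if "x \<in> N" for x using ker[of x 0] that N(2) U0 by auto
    then have "L ` N = {\<zero>\<^bsub>R\<^esub>}" using vs.subspace_0[OF N(1)] unfolding L0 by auto
    then show "dimension 0 (range K) (L ` N)" using zero_dim by simp
  next
    fix d c X assume X: "vs.subspace X" "X \<subseteq> U" and c: "c \<in> U" "L c \<notin> L ` X"
      and IH: "dimension d (range K) (L ` X)"
    have L: "L (fscale k c + x) = K k \<otimes>\<^bsub>R\<^esub> L c \<oplus>\<^bsub>R\<^esub> L x" if "x \<in> X" for k x
      using that X(2) c(1) vs.subspace_scale[OF U c(1), of k] by (subst add) (auto simp: scale)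
    have "L ` {x. \<exists>k. x - fscale k c \<in> X} = line_extension (range K) (L c) (L ` X)"
    proof (intro equalityI subsetI)
      fix y assume "y \<in> L ` {x. \<exists>k. x - fscale k c \<in> X}"
      then obtain k x where x: "x - fscale k c \<in> X" "y = L x" by blast
      have "y = K k \<otimes>\<^bsub>R\<^esub> L c \<oplus>\<^bsub>R\<^esub> L (x - fscale k c)" using L[OF x(1), of k] x(2) by simp
      then show "y \<in> line_extension (range K) (L c) (L ` X)"
        unfolding line_extension_mem_iff using x(1) by blast
    next
      fix y assume "y \<in> line_extension (range K) (L c) (L ` X)"
      then obtain k x where x: "x \<in> X" "y = K k \<otimes>\<^bsub>R\<^esub> L c \<oplus>\<^bsub>R\<^esub> L x"
        unfolding line_extension_mem_iff by blast
      have "y = L (fscale k c + x)" unfolding x(2) L[OF x(1)] ..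
      then show "y \<in> L ` {x. \<exists>k. x - fscale k c \<in> X}" using x(1) by (auto intro!: image_eqI exI[of _ k])
    qed
    then show "dimension (Suc d) (range K) (L ` {x. \<exists>k. x - fscale k c \<in> X})"
      using Suc_dim[OF closed[OF c(1)] c(2) IH] by simp
  qed
qed

definition supported :: "'k set \<Rightarrow> ('k \<Rightarrow> 'f::field) set" where
  "supported P = {f. \<forall>m. f m \<noteq> 0 \<longrightarrow> m \<in> P}"

lemma supported_subspace: "vs.subspace (supported P :: ('k \<Rightarrow> 'f::field) set)"
  by (auto simp: vs.subspace_def supported_def fscale_def) (metis add.right_neutral)

lemma supported_dim:
  fixes P :: "'k set"
  assumes "finite P"
  shows "vs.dim (supported P :: ('k \<Rightarrow> 'f::field) set) = card P"
    "\<exists>S. finite S \<and> (supported P :: ('k \<Rightarrow> 'f) set) \<subseteq> vs.span S"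
proof -
  let ?e = "\<lambda>m m'. if m' = m then 1 else 0 :: 'f"
  have inj: "inj_on ?e P" by (rule inj_onI) (metis zero_neq_one)
  have eval: "(\<Sum>x\<in>P. fscale (c x) (?e x)) m = (if m \<in> P then c m else 0)" for c :: "'k \<Rightarrow> 'f" and m
    using assms by (simp add: sum_apply fscale_def if_distrib[of "(*) _"] cong: if_cong)
  have span: "f \<in> vs.span (?e ` P)" if "f \<in> supported P" for f
  proof -
    have "f = (\<Sum>x\<in>P. fscale (f x) (?e x))" using that unfolding fun_eq_iff eval by (auto simp: supported_def)
    also have "\<dots> \<in> vs.span (?e ` P)" by (intro vs.span_sum vs.span_scale vs.span_base imageI)
    finally show ?thesis .
  qed
  have ind: "vs.independent (?e ` P)"
  proof (rule vs.independent_if_scalars_zero)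
    fix c x assume s: "(\<Sum>x\<in>?e ` P. fscale (c x) x) = 0" and "x \<in> ?e ` P"
    then obtain m where m: "m \<in> P" "x = ?e m" by blast
    have "(\<Sum>y\<in>P. fscale (c (?e y)) (?e y)) = 0" using s by (simp add: sum.reindex[OF inj])
    then have "(if m \<in> P then c (?e m) else 0) = 0" using eval[of "\<lambda>y. c (?e y)" m] by simp
    then show "c x = 0" using m by simp
  qed (use assms in simp)
  have "?e ` P \<subseteq> supported P" by (auto simp: supported_def split: if_splits)
  then have "vs.span (?e ` P) = supported P" using span vs.span_minimal[OF _ supported_subspace] by blast
  then show "vs.dim (supported P :: ('k \<Rightarrow> 'f) set) = card P"
    using vs.dim_span_eq_card_independent[OF ind] card_image[OF inj] by simp
  show "\<exists>S. finite S \<and> (supported P :: ('k \<Rightarrow> 'f) set) \<subseteq> vs.span S"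
    using span assms by (intro exI[of _ "?e ` P"]) auto
qed

text \<open>
  A monomial in \<open>A\<close> is given by the set of its factors \<open>x\<^sub>i\<close> and the list of the exponents of the
  \<open>y\<^sub>i\<close>.
\<close>

lemma card_subset_exponents:
  fixes n d :: nat
  defines "E \<equiv> {(S, l). S \<subseteq> {1..n} \<and> length l = n \<and> card S + sum_list (l :: nat list) = d}"
  shows "finite E" "int (card E) = sdim (int d) n n"
proof -
  let ?A = "\<lambda>i. {S. S \<subseteq> {1..n} \<and> card S = d - i}" and ?B = "\<lambda>i. {l :: nat list. length l = n \<and> sum_list l = i}"
  have E: "E = (\<Union>i\<in>{0..d}. ?A i \<times> ?B i)"
    by (auto simp: E_def)
  have finB: "finite (?B i)" for i
  proof (rule finite_subset)
    show "?B i \<subseteq> {l. set l \<subseteq> {0..i} \<and> length l = n}" by (auto intro: member_le_sum_list)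
    show "finite {l. set l \<subseteq> {0..i} \<and> length l = n}" by (rule finite_lists_length_eq) simp
  qed
  have fin: "finite (?A i \<times> ?B i)" for i using finB[of i] by simp
  then show "finite E" unfolding E by blast
  have "card E = (\<Sum>i=0..d. card (?A i \<times> ?B i))"
    unfolding E by (rule card_UN_disjoint) (use fin in auto)
  also have "\<dots> = (\<Sum>i=0..d. (n choose (d - i)) * ((n + i - 1) choose i))"
    by (rule sum.cong) (simp_all add: card_cartesian_product n_subsets card_length_sum_list add.commute)
  finally show "int (card E) = sdim (int d) n n" by (simp add: sdim_def)
qed

context heisenberg begin

definition mon_degree :: "(ba_basis \<Rightarrow> nat) \<Rightarrow> nat" where
  "mon_degree m = length (nw m)"

lemma mon_degree_eq: "mon_degree m = (\<Sum>j=1..n. m (X j) + m (Y j)) + m Z"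
proof -
  have len: "length (concat (map (\<lambda>b. replicate (m b) b) (map F js))) = sum_list (map (\<lambda>j. m (F j)) js)"
    for F :: "nat \<Rightarrow> ba_basis" and js by (induction js) auto
  have "sum_list (map f [1..<Suc n]) = (\<Sum>j=1..n. f j)" for f :: "nat \<Rightarrow> nat"
    by (simp only: interv_sum_list_conv_sum_set_nat set_upt atLeastLessThanSuc_atLeastAtMost)
  then show ?thesis
    unfolding mon_degree_def nw_def unfolding ba_gens_def
    by (simp only: map_append concat_append length_append len) (simp add: sum.distrib)
qed

definition koszul_mons :: "int \<Rightarrow> (ba_basis \<Rightarrow> nat) set" where
  "koszul_mons k = {m \<in> mons. m Z = 0 \<and> int (mon_degree m) = k}"

lemma card_koszul_mons: "finite (koszul_mons k)" "int (card (koszul_mons k)) = sdim k n n"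
proof -
  let ?E = "\<lambda>d. {(S, l). S \<subseteq> {1..n} \<and> length l = n \<and> card S + sum_list (l :: nat list) = d}"
  let ?to = "\<lambda>m. ({i \<in> {1..n}. m (X i) = 1}, map (\<lambda>i. m (Y i)) [1..<Suc n])"
  let ?of = "\<lambda>(S, l) b. case b of X i \<Rightarrow> if i \<in> S then 1 else 0
    | Y i \<Rightarrow> if i \<in> {1..n} then l ! (i - 1) else 0 | Z \<Rightarrow> 0"
  have bij: "bij_betw ?to (koszul_mons (int d)) (?E d)" for d
  proof (rule bij_betw_byWitness[where f' = ?of])
    show "\<forall>m\<in>koszul_mons (int d). ?of (?to m) = m"
    proof
      fix m assume "m \<in> koszul_mons (int d)"
      then have m: "m \<in> mons" "m Z = 0" by (auto simp: koszul_mons_def)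
      have "?of (?to m) b = m b" for b
      proof (cases b)
        case (X i)
        then show ?thesis using m by (cases "i \<in> {1..n}") (auto simp: mons_def le_Suc_eq dest: spec[of _ "X i"])
      next
        case (Y i)
        then show ?thesis using m by (auto simp: mons_def simp del: upt_Suc)
      qed (use m in simp)
      then show "?of (?to m) = m" by (rule ext)
    qed
    have sum1: "(\<Sum>j=1..n. (if j \<in> S then 1 else 0)) = card S" if "S \<subseteq> {1..n}" for S
      using that by (simp add: sum.If_cases Int_absorb1)
    have sumX: "(\<Sum>j=1..n. m (X j)) = card {i \<in> {1..n}. m (X i) = 1}" if "m \<in> mons" for m
    proof -
      have "m (X j) = (if j \<in> {i \<in> {1..n}. m (X i) = 1} then 1 else 0)" if "j \<in> {1..n}" for j
        using \<open>m \<in> mons\<close> that by (auto simp: mons_def le_Suc_eq dest: spec[of _ "X j"])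
      then have "(\<Sum>j=1..n. m (X j)) = (\<Sum>j=1..n. (if j \<in> {i \<in> {1..n}. m (X i) = 1} then 1 else 0))"
        by (rule sum.cong[OF refl])
      also have "\<dots> = card {i \<in> {1..n}. m (X i) = 1}" by (rule sum1) auto
      finally show ?thesis .
    qed
    have sumY: "(\<Sum>j=1..n. f j) = sum_list (map f [1..<Suc n])" for f :: "nat \<Rightarrow> nat"
      by (simp only: interv_sum_list_conv_sum_set_nat set_upt atLeastLessThanSuc_atLeastAtMost)
    show "?to ` koszul_mons (int d) \<subseteq> ?E d"
    proof
      fix p assume "p \<in> ?to ` koszul_mons (int d)"
      then obtain m where p: "p = ?to m" and m: "m \<in> mons" "m Z = 0" "mon_degree m = d" by (auto simp: koszul_mons_def)
      have "card {i \<in> {1..n}. m (X i) = 1} + sum_list (map (\<lambda>i. m (Y i)) [1..<Suc n]) = d"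
        using m(2,3) unfolding mon_degree_eq sum.distrib sumX[OF m(1)] sumY[of "\<lambda>j. m (Y j)"] by simp
      then show "p \<in> ?E d" unfolding p by (auto simp del: upt_Suc)
    qed
    show "\<forall>p\<in>?E d. ?to (?of p) = p"
    proof
      fix p assume "p \<in> ?E d"
      then obtain S l where p: "p = (S, l)" "S \<subseteq> {1..n}" "length l = n" by auto
      have "map (\<lambda>i. if i \<in> {1..n} then l ! (i - 1) else 0) [1..<Suc n] = l"
        by (rule nth_equalityI) (use p in \<open>auto simp del: upt_Suc\<close>)
      then show "?to (?of p) = p" using p by (auto simp del: upt_Suc)
    qed
    show "?of ` ?E d \<subseteq> koszul_mons (int d)"
    proof
      fix m assume "m \<in> ?of ` ?E d"
      then obtain S l where m: "m = ?of (S, l)" and p: "S \<subseteq> {1..n}" "length l = n" "card S + sum_list l = d"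
        by auto
      have v: "m (X i) = (if i \<in> S then 1 else 0)" "m (Y i) = (if i \<in> {1..n} then l ! (i - 1) else 0)" "m Z = 0" for i
        by (simp_all add: m)
      have "map (\<lambda>i. if i \<in> {1..n} then l ! (i - 1) else 0) [1..<Suc n] = l"
        by (rule nth_equalityI) (use p in \<open>auto simp del: upt_Suc\<close>)
      then have "(\<Sum>j=1..n. m (Y j)) = sum_list l" unfolding v(2) sumY by (rule arg_cong)
      then have "mon_degree m = d" unfolding mon_degree_eq sum.distrib v(1,3) using sum1[OF p(1)] p(3) by simp
      moreover have "m \<in> mons"
        unfolding mons_def
      proof (intro CollectI conjI allI impI)
        fix b
        show "m b = 0" if "b \<notin> set (ba_gens n)" using that p(1) v by (cases b) auto
        show "m b \<le> 1" if "ba_par b = 0" using that v by (cases b) auto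
      qed
      ultimately show "m \<in> koszul_mons (int d)" using v(3) by (simp add: koszul_mons_def)
    qed
  qed
  have "finite (koszul_mons k) \<and> int (card (koszul_mons k)) = sdim k n n"
  proof (cases "k < 0")
    case True
    then have "koszul_mons k = {}" by (auto simp: koszul_mons_def)
    then show ?thesis using True by (simp add: sdim_def)
  next
    case False
    then obtain d where d: "k = int d" by (metis nonneg_int_cases not_less)
    show ?thesis unfolding d
      using bij_betw_finite[OF bij[of d]] bij_betw_same_card[OF bij[of d]] card_subset_exponents[of n d] by simp
  qed
  then show "finite (koszul_mons k)" "int (card (koszul_mons k)) = sdim k n n" by auto
qed

abbreviation koszul :: "int \<Rightarrow> ((ba_basis \<Rightarrow> nat) \<Rightarrow> 'f::field_char_0) set" where
  "koszul k \<equiv> supported (koszul_mons k)"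

lemma koszul_forms: "koszul k \<subseteq> forms"
proof
  fix f :: "_ \<Rightarrow> 'a" assume f: "f \<in> koszul k"
  then have "{m. f m \<noteq> 0} \<subseteq> koszul_mons k" by (auto simp: supported_def)
  then show "f \<in> forms" using card_koszul_mons(1)[of k] by (auto simp: forms_def koszul_mons_def intro: finite_subset)
qed

lemma mon_degree_step:
  assumes "j \<in> {1..n}" "m (X j) = 1" "0 < m (Y j)"
  shows "mon_degree (m(X j := 0, Y j := m (Y j) - 1)) + 2 = mon_degree m"
proof -
  let ?m = "m(X j := 0, Y j := m (Y j) - 1)"
  have split: "(\<Sum>i=1..n. f i) = f j + (\<Sum>i\<in>{1..n} - {j}. f i)" for f :: "nat \<Rightarrow> nat"
    by (rule sum.remove) (use assms in auto)
  have "(\<Sum>i\<in>{1..n} - {j}. ?m (X i) + ?m (Y i)) = (\<Sum>i\<in>{1..n} - {j}. m (X i) + m (Y i))"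
    by (rule sum.cong) auto
  then have "(\<Sum>i=1..n. ?m (X i) + ?m (Y i)) + 2 = (\<Sum>i=1..n. m (X i) + m (Y i))"
    unfolding split using assms by simp
  then show ?thesis by (simp add: mon_degree_eq)
qed

lemma omega_degree:
  "omega (\<lambda>m. (if m Z = 0 \<and> int (mon_degree m) = k - 2 then 1 else 0) * f m) =
    (\<lambda>m. (if m Z = 0 \<and> int (mon_degree m) = k then 1 else 0) * omega f m)"
proof (rule omega_weight)
  fix m :: "ba_basis \<Rightarrow> nat" and j assume "j \<in> {1..n}" "m (X j) = 1" "0 < m (Y j)"
  from mon_degree_step[OF this] show "(if (m(X j := 0, Y j := m (Y j) - 1)) Z = 0 \<and>
      int (mon_degree (m(X j := 0, Y j := m (Y j) - 1))) = k - 2 then 1 else 0) =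
    (if m Z = 0 \<and> int (mon_degree m) = k then 1 else 0 :: 'a)" by auto
qed

text \<open>
  A preimage under \<open>\<omega>\<close> of an element of \<open>A\<^sub>k\<close> can be projected to \<open>A\<^bsub>k-2\<^esub>\<close>, as \<open>\<omega>\<close> has degree \<open>2\<close>.
\<close>

lemma exact_koszul: "exact \<inter> koszul k = omega ` (koszul (k - 2) :: (_ \<Rightarrow> 'f::field_char_0) set)"
proof (intro equalityI subsetI)
  fix f :: "_ \<Rightarrow> 'f" assume f: "f \<in> exact \<inter> koszul k"
  then obtain g where g: "g \<in> forms" "f = omega g" by blast
  let ?g = "\<lambda>m. (if m Z = 0 \<and> int (mon_degree m) = k - 2 then 1 else 0) * g m"
  have "omega ?g = f" unfolding omega_degree using f g(2) by (auto simp: fun_eq_iff supported_def koszul_mons_def)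
  moreover have "?g \<in> koszul (k - 2)"
    using g(1) by (auto simp: supported_def koszul_mons_def forms_def split: if_splits)
  ultimately show "f \<in> omega ` koszul (k - 2)" by blast
next
  fix f :: "_ \<Rightarrow> 'f" assume "f \<in> omega ` koszul (k - 2)"
  then obtain g where g: "g \<in> koszul (k - 2)" "f = omega g" by blast
  have "g = (\<lambda>m. (if m Z = 0 \<and> int (mon_degree m) = k - 2 then 1 else 0) * g m)"
    using g(1) by (auto simp: fun_eq_iff supported_def koszul_mons_def)
  then have "f = (\<lambda>m. (if m Z = 0 \<and> int (mon_degree m) = k then 1 else 0) * omega g m)"
    using omega_degree[of k g] g(2) by simp
  then have "f m \<noteq> 0 \<Longrightarrow> m Z = 0 \<and> int (mon_degree m) = k" for m
    using fun_cong[of f _ m] by (auto split: if_splits)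
  moreover have "f \<in> exact" using g koszul_forms by blast
  moreover from this have "f m \<noteq> 0 \<Longrightarrow> m \<in> mons" for m using exact_forms[of f] by (auto simp: forms_def)
  ultimately show "f \<in> exact \<inter> koszul k" by (auto simp: supported_def koszul_mons_def)
qed

lemma mon_degree_topm: "mon_degree (topm i) = n + i"
  by (simp add: mon_degree_def length_nw_topm)

text \<open>
  Rank and nullity of \<open>\<omega>\<close> on \<open>A\<^sub>k\<close>. By \<open>exactness\<close> the kernel is \<open>\<omega> A\<^bsub>k-2\<^esub>\<close>, to which the line of
  \<open>x\<^sub>1 \<cdots> x\<^sub>n\<close> is added if \<open>k = n\<close>.
\<close>

lemma dim_exact_rec:
  "int (vs.dim (omega ` koszul k :: (_ \<Rightarrow> 'f::field_char_0) set)) +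
    int (vs.dim (omega ` koszul (k - 2) :: (_ \<Rightarrow> 'f) set)) + kdelta k (int n) = sdim k n n"
proof -
  let ?A = "koszul k :: (_ \<Rightarrow> 'f) set" and ?W = "omega ` koszul (k - 2) :: (_ \<Rightarrow> 'f) set"
  let ?N = "{f \<in> ?A. omega f = 0}"
  note fin = card_koszul_mons(1)[of k]
  obtain S where S: "finite S" "?A \<subseteq> vs.span S" using supported_dim(2)[OF fin] by blast
  have rn: "vs.dim (omega ` ?A) + vs.dim ?N = card (koszul_mons k)"
    using rank_nullity[OF supported_subspace S, of omega] supported_dim(1)[OF fin, where 'f = 'f] by simp
  have W: "vs.subspace ?W" "?W = exact \<inter> ?A"
    unfolding exact_koszul[symmetric] by (auto intro: vs.subspace_inter exact_subspace supported_subspace)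
  have WN: "?W \<subseteq> ?N" unfolding W(2) by (auto simp: omega_omega)
  let ?t = "basisf (topm 0) :: _ \<Rightarrow> 'f"
  have dimN: "int (vs.dim ?N) = int (vs.dim ?W) + kdelta k (int n)"
  proof (cases "k = int n")
    case False
    have "?N \<subseteq> ?W"
    proof
      fix f assume f: "f \<in> ?N"
      have "f \<in> exact"
      proof (rule exactness)
        show "f \<in> forms" "omega f = 0" using f koszul_forms by auto
        fix m assume "f m \<noteq> 0"
        then have "m \<in> mons" "m Z = 0" "int (mon_degree m) = k" using f by (auto simp: supported_def koszul_mons_def)
        then show "energy m \<noteq> 0" using energy_zero_iff[of m] mon_degree_topm[of 0] False by auto
      qed
      then show "f \<in> ?W" using f W(2) by blast
    qed
    then have "?N = ?W" using WN by blast
    then show ?thesis using False by (simp add: kdelta_def)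
  next
    case True
    have t: "?t \<in> ?A" "omega ?t = 0" "?t \<notin> ?W"
    proof -
      show "?t \<in> ?A" using topm_mons mon_degree_topm[of 0] True by (auto simp: supported_def basisf_def koszul_mons_def)
      show "omega ?t = 0" by (rule full_omega) (auto simp: full_def basisf_def split: if_splits)
      have "?t (topm 0) = 1" by (simp add: basisf_def)
      then show "?t \<notin> ?W" using omega_topm by (metis imageE zero_neq_one)
    qed
    have sp: "vs.span (insert ?t ?W) = ?N"
    proof (rule vs.span_unique)
      show "insert ?t ?W \<subseteq> ?N" using t WN by auto
      show "vs.subspace ?N"
        using supported_subspace[of "koszul_mons k", where 'f = 'f] by (auto simp: vs.subspace_def)
      fix S assume S: "insert ?t ?W \<subseteq> S" "vs.subspace S"
      show "?N \<subseteq> S"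
      proof
        fix f assume f: "f \<in> ?N"
        let ?g = "f - fscale (f (topm 0)) ?t"
        have gA: "?g \<in> ?A" using f t(1) supported_subspace by (auto intro: vs.subspace_diff vs.subspace_scale)
        have "?g \<in> exact"
        proof (rule exactness)
          show "?g \<in> forms" using gA koszul_forms by blast
          show "omega ?g = 0" using f t(2) by simp
          fix m assume nz: "?g m \<noteq> 0"
          then have "m \<in> mons" "m Z = 0" using gA by (auto simp: supported_def koszul_mons_def)
          moreover have "m \<noteq> topm 0" using nz by (auto simp: fscale_def basisf_def)
          ultimately show "energy m \<noteq> 0" using energy_zero_iff[of m] by auto
        qed
        then have "?g \<in> S" using gA W(2) S(1) by blast
        moreover have "fscale (f (topm 0)) ?t \<in> S" using S by (intro vs.subspace_scale) auto
        ultimately have "?g + fscale (f (topm 0)) ?t \<in> S" using S(2) by (intro vs.subspace_add)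
        then show "f \<in> S" by simp
      qed
    qed
    obtain B where B: "B \<subseteq> ?W" "vs.independent B" "?W \<subseteq> vs.span B" "card B = vs.dim ?W"
      using vs.basis_exists by blast
    have sB: "vs.span B = ?W" using B W(1) vs.span_minimal by blast
    have fB: "finite B" using vs.independent_span_bound[OF S(1) B(2)] B(1) W(2) S(2) by blast
    have "vs.independent (insert ?t B)" using vs.independent_insertI[OF _ B(2)] t(3) sB by simp
    moreover have "vs.span (insert ?t B) = ?N"
      unfolding sp[symmetric] vs.span_insert sB vs.span_eq_iff[THEN iffD2, OF W(1)] ..
    ultimately have "vs.dim ?N = card (insert ?t B)" using vs.dim_span_eq_card_independent by metis
    also have "\<dots> = Suc (vs.dim ?W)" using fB B(1,4) t(3) by (subst card_insert_disjoint) auto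
    finally show ?thesis using True by (simp add: kdelta_def)
  qed
  show ?thesis using rn dimN card_koszul_mons(2)[of k] by linarith
qed

text \<open>
  The recursion is unrolled until the degree is negative.
\<close>

lemma dim_exact:
  "int (vs.dim (omega ` koszul (k - 2) :: (_ \<Rightarrow> 'f::field_char_0) set)) =
    (\<Sum>i=1..nat (k div 2). (- 1) ^ (i - 1) * (sdim (k - 2 * int i) n n - kdelta (k - 2 * int i) (int n)))"
proof -
  define r where "r k = int (vs.dim (omega ` koszul k :: (_ \<Rightarrow> 'f) set))" for k
  define g where "g k = sdim k n n - kdelta k (int n)" for k
  have rec: "r k = g k - r (k - 2)" for k
    using dim_exact_rec[of k, where 'f = 'f] by (simp add: r_def g_def)
  have neg: "r k = 0" if "k < 0" for k
  proof -
    have "koszul_mons k = {}" using that by (auto simp: koszul_mons_def)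
    then have "(koszul k :: (_ \<Rightarrow> 'f) set) = {0}" by (auto simp: supported_def fun_eq_iff)
    then have "omega ` koszul k = ({0} :: (_ \<Rightarrow> 'f) set)" by simp
    moreover have "vs.dim (vs.span ({} :: ((ba_basis \<Rightarrow> nat) \<Rightarrow> 'f) set)) = card ({} :: ((ba_basis \<Rightarrow> nat) \<Rightarrow> 'f) set)"
      by (rule vs.dim_span_eq_card_independent[OF vs.independent_empty])
    ultimately show ?thesis by (simp add: r_def)
  qed
  have "r (k - 2) = (\<Sum>i=1..N. (- 1) ^ (i - 1) * g (k - 2 * int i)) + (- 1) ^ N * r (k - 2 - 2 * int N)" for N
  proof (induction N)
    case (Suc N)
    have "g (k - 2 * int (Suc N)) = r (k - 2 - 2 * int N) + r (k - 2 - 2 * int (Suc N))"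
      using rec[of "k - 2 - 2 * int N"] by (simp add: algebra_simps)
    then show ?case using Suc by (simp add: algebra_simps)
  qed simp
  note expand = this[of "nat (k div 2)"]
  have "k < 2 + 2 * (k div 2)" "k div 2 \<le> int (nat (k div 2))" by (presburger, linarith)
  then have "k - 2 - 2 * int (nat (k div 2)) < 0" by linarith
  then have "r (k - 2) = (\<Sum>i=1..nat (k div 2). (- 1) ^ (i - 1) * g (k - 2 * int i))"
    unfolding expand by (simp only: neg mult_zero_right add_0_right)
  then show ?thesis by (simp add: r_def g_def)
qed

definition top_mons :: "int \<Rightarrow> (ba_basis \<Rightarrow> nat) set" where
  "top_mons k = {topm i | i. 1 \<le> i \<and> int (n + i) = k}"

lemma card_top_mons: "finite (top_mons k)" "card (top_mons k) = (if k > int n then 1 else 0)"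
proof -
  have "top_mons k = (if k > int n then {topm (nat (k - int n))} else {})"
  proof (cases "k > int n")
    case True
    then have "1 \<le> i \<and> int (n + i) = k \<longleftrightarrow> i = nat (k - int n)" for i by auto
    then show ?thesis using True by (simp add: top_mons_def)
  qed (auto simp: top_mons_def)
  then show "finite (top_mons k)" "card (top_mons k) = (if k > int n then 1 else 0)" by auto
qed

text \<open>
  The classes in degree \<open>k\<close> are represented by \<open>A\<^sub>k\<close> and, if \<open>k > n\<close>, by \<open>x\<^sub>1 \<cdots> x\<^sub>n z\<^bsup>k-n\<^esup>\<close>. By
  \<open>exact_koszul\<close> the coboundaries among them are \<open>\<omega> A\<^bsub>k-2\<^esub>\<close>.
\<close>

lemma cohomology_dimension:
  defines "H \<equiv> cohomology (ba n) :: ('f::field_char_0, _) galg"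
  shows "\<exists>d. ring.dimension H d (scalars H) (zgr H k) \<and>
    int d = sdim k n n + (if k > int n then 1 else 0) -
      int (vs.dim (omega ` koszul (k - 2) :: (_ \<Rightarrow> 'f) set))"
proof -
  obtain cl where "presentation H cocycles boundaries cst deg_part (par_part ba_par) cl"
    using cohomology_presentation unfolding H_def by blast
  then interpret H: presentation H cocycles boundaries cst deg_part "par_part ba_par" cl .
  let ?P = "koszul_mons k \<union> top_mons k"
  let ?U = "supported ?P :: (_ \<Rightarrow> 'f) set" and ?N = "omega ` koszul (k - 2) :: (_ \<Rightarrow> 'f) set"
  let ?L = "\<lambda>f. cl (nf f)" and ?K = "\<lambda>c. cl (cst c)"
  have fin: "finite ?P" using card_koszul_mons(1) card_top_mons(1) by simp
  have disj: "koszul_mons k \<inter> top_mons k = {}" by (auto simp: koszul_mons_def top_mons_def)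
  have P: "m \<in> mons \<and> int (mon_degree m) = k" if "m \<in> ?P" for m
    using that topm_mons mon_degree_topm by (auto simp: koszul_mons_def top_mons_def)
  obtain S where S: "finite S" "?U \<subseteq> vs.span S" using supported_dim(2)[OF fin] by blast
  have Uf: "f \<in> forms" if "f \<in> ?U" for f
  proof -
    have "{m. f m \<noteq> 0} \<subseteq> ?P" using that by (auto simp: supported_def)
    then show ?thesis using P fin finite_subset unfolding forms_def by blast
  qed
  have Uc: "nf f \<in> cocycles" if f: "f \<in> ?U" for f
  proof -
    have "pdv Z f \<in> full"
      unfolding full_def
    proof (intro CollectI allI impI ballI)
      fix m j assume nz: "pdv Z f m \<noteq> 0" and j: "j \<in> {1..n}"
      have "m(Z := Suc (m Z)) \<in> ?P" using pdv_nz(2)[OF nz] f by (auto simp: supported_def)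
      then obtain i where "m(Z := Suc (m Z)) = topm i" by (auto simp: koszul_mons_def top_mons_def)
      from fun_cong[OF this, of "X j"] show "m (X j) = 1" using j by simp
    qed
    then have "dmodel (ev (nf f)) = 0" by (simp add: dmodel_def ev_nf[OF Uf[OF f]] full_omega)
    then show ?thesis using nf_tens by (simp add: cocycles_def)
  qed
  have N: "vs.subspace ?N" "?N = exact \<inter> koszul k"
    unfolding exact_koszul[symmetric] by (auto intro: vs.subspace_inter exact_subspace supported_subspace)
  have NU: "?N \<subseteq> ?U" unfolding N(2) by (auto simp: supported_def)
  have exN: "f \<in> exact \<longleftrightarrow> f \<in> ?N" if f: "f \<in> ?U" for f
  proof
    assume e: "f \<in> exact"
    then have "f (topm i) = 0" for i by (auto simp: omega_topm)
    then have "f m \<noteq> 0 \<Longrightarrow> m \<in> koszul_mons k" for m using f by (auto simp: supported_def top_mons_def)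
    then show "f \<in> ?N" unfolding N(2) using e by (auto simp: supported_def)
  qed (auto simp: N(2))
  have dim: "ring.dimension H (vs.dim ?U - vs.dim ?N) (range ?K) (?L ` ?U)"
  proof (rule dimension_quotient[OF H.ring supported_subspace N(1) NU S])
    show "?L f \<in> carrier H" if "f \<in> ?U" for f unfolding H.carrier_eq using Uc[OF that] by blast
    show "?L (f + g) = ?L f \<oplus>\<^bsub>H\<^esub> ?L g" if "f \<in> ?U" "g \<in> ?U" for f g
      using that by (simp add: nf_add Uf H.add_cl Uc)
    show "?L (fscale c f) = ?K c \<otimes>\<^bsub>H\<^esub> ?L f" if "f \<in> ?U" for c f
      using that by (simp add: nf_scale Uf H.mult_cl Uc H.R_sc)
    show "?L f = ?L g \<longleftrightarrow> f - g \<in> ?N" if fg: "f \<in> ?U" "g \<in> ?U" for f g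
    proof -
      have d: "f - g \<in> ?U" by (rule vs.subspace_diff[OF supported_subspace fg])
      have "?L f = ?L g \<longleftrightarrow> nf (f - g) \<in> boundaries"
        using fg by (simp add: H.cl_eq Uc nf_diff Uf)
      also have "\<dots> \<longleftrightarrow> f - g \<in> exact"
        using ev_nf[OF Uf[OF d]] nf_tens[of "f - g"] by (simp add: boundaries_def)
      finally show ?thesis using exN[OF d] by simp
    qed
  qed
  have img: "?L ` ?U = zgr H k"
  proof (intro equalityI subsetI)
    fix x assume "x \<in> ?L ` ?U"
    then obtain f where f: "f \<in> ?U" "x = ?L f" by blast
    have "nf f \<in> deg_part k"
    proof (intro CollectI ballI)
      fix w assume "w \<in> keys (nf f)"
      then obtain m where "f m \<noteq> 0" "w = nw m" using keys_nf by blast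
      then show "int (length w) = k" using P[of m] f(1) by (auto simp: supported_def mon_degree_def)
    qed
    then show "x \<in> zgr H k" unfolding H.zgr_eq using Uc[OF f(1)] f(2) by blast
  next
    fix x assume "x \<in> zgr H k"
    then obtain z where z: "z \<in> cocycles" "z \<in> deg_part k" "x = cl z" unfolding H.zgr_eq by blast
    have zt: "z \<in> tens" "ev z \<in> forms" "dmodel (ev z) = 0" using z(1) ev_tens[of z] by (auto simp: cocycles_def)
    have U: "surviving (ev z) \<in> ?U"
      unfolding supported_def
    proof (intro CollectI allI impI)
      fix m assume nz: "surviving (ev z) m \<noteq> 0"
      then have nz': "ev z m \<noteq> 0" and c: "m Z = 0 \<or> energy m = 0" by (auto simp: surviving_def split: if_splits)
      have mm: "m \<in> mons" using zt(2) nz' by (auto simp: forms_def)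
      obtain w where w: "w \<in> keys z" "mset w = mset (nw m)" using ev_support[OF nz'] zt(1) by blast
      have "int (length w) = k" using z(2) w(1) by blast
      then have dk: "int (mon_degree m) = k" using mset_eq_length[OF w(2)] by (simp add: mon_degree_def)
      show "m \<in> ?P"
      proof (cases "m Z = 0")
        case True
        then show ?thesis using mm dk by (simp add: koszul_mons_def)
      next
        case False
        then have "m = topm (m Z)" using c energy_zero_iff[OF mm] by simp
        then have "m \<in> top_mons k" using False dk mon_degree_topm[of "m Z"] unfolding top_mons_def
          by (metis (mono_tags, lifting) CollectI One_nat_def Suc_leI neq0_conv)
        then show ?thesis by simp
      qed
    qed
    have "z - nf (surviving (ev z)) \<in> boundaries"
      using cocycle_surviving[OF zt(2,3)] ev_nf[OF Uf[OF U]] tens_closed(2)[OF zt(1) nf_tens]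
      by (simp add: boundaries_def)
    then have "x = ?L (surviving (ev z))" unfolding z(3) H.cl_eq[OF z(1) Uc[OF U]] .
    then show "x \<in> ?L ` ?U" using U by blast
  qed
  have sc: "scalars H = range ?K"
    unfolding scalars_def H.one_cl by (simp add: H.smult_cl[OF H.R_one])
  have dimU: "vs.dim ?U = card (koszul_mons k) + (if k > int n then 1 else 0)"
    using supported_dim(1)[OF fin, where 'f = 'f] card_Un_disjoint[OF card_koszul_mons(1) card_top_mons(1) disj]
      card_top_mons(2) by simp
  have "vs.dim ?N \<le> vs.dim ?U"
    using adapted_basis[OF supported_subspace N(1) NU S] by (metis le_add1)
  then have "int (vs.dim ?U - vs.dim ?N) = sdim k n n + (if k > int n then 1 else 0) - int (vs.dim ?N)"
    using dimU card_koszul_mons(2)[of k] by simp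
  then show ?thesis using dim unfolding img sc by blast
qed

end

lemma sum_kdelta:
  assumes "1 \<le> n" shows "(\<Sum>i=1..k - 1. kdelta (k - i) (int n)) = (if k > int n then 1 else 0)"
proof -
  have "(\<Sum>i=1..k - 1. kdelta (k - i) (int n)) = (\<Sum>i=1..k - 1. if i = k - int n then 1 else 0)"
    by (rule sum.cong) (auto simp: kdelta_def)
  also have "\<dots> = (if k > int n then 1 else 0)" using assms by (simp add: sum.delta)
  finally show ?thesis .
qed

theorem theorem3p2:
  fixes n :: nat
    and H :: "('f::{alg_closed_field, field_char_0}, (ba_basis list \<Rightarrow>\<^sub>0 'f) set set) galg"
  assumes "n \<ge> 1"
  defines "H \<equiv> cohomology (ba n)"
  shows "galg_iso H (dsum (G_alg n) (V_alg n)) \<and>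
    (\<forall>k::int. \<exists>d::nat. ring.dimension H d (scalars H) (zgr H k) \<and>
       int d = sdim k n n - sdim (k - 2) n n
         + (\<Sum>i=2..nat (k div 2). (- 1) ^ i * (sdim (k - 2 * int i) n n - kdelta (k - 2 * int i) (int n)))
         + (\<Sum>i=1..k - 1. kdelta (k - i) (int n))
         + kdelta (k - 2) (int n))"
proof (intro conjI allI)
  interpret heisenberg n by standard (rule assms(1))
  show "galg_iso H (dsum (G_alg n) (V_alg n))"
    unfolding H_def by (rule cohomology_iso)
  fix k :: int
  let ?g = "\<lambda>i. sdim (k - 2 * int i) n n - kdelta (k - 2 * int i) (int n)" and ?N = "nat (k div 2)"
  have sums: "(\<Sum>i=1..?N. (- 1) ^ (i - 1) * ?g i) =
      sdim (k - 2) n n - kdelta (k - 2) (int n) - (\<Sum>i=2..?N. (- 1) ^ i * ?g i)"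
  proof (cases "1 \<le> ?N")
    case True
    have "(\<Sum>i=1..?N. (- 1) ^ (i - 1) * ?g i) = ?g 1 + (\<Sum>i=Suc 1..?N. (- 1) ^ (i - 1) * ?g i)"
      using sum.atLeast_Suc_atMost[OF True, of "\<lambda>i. (- 1) ^ (i - 1) * ?g i"] by simp
    also have "(\<Sum>i=Suc 1..?N. (- 1) ^ (i - 1) * ?g i) = (\<Sum>i=2..?N. - ((- 1) ^ i * ?g i))"
    proof (rule sum.cong)
      fix i assume "i \<in> {2..?N}"
      then obtain j where "i = Suc j" by (cases i) auto
      then show "(- 1) ^ (i - 1) * ?g i = - ((- 1) ^ i * ?g i)" by simp
    qed (simp add: numeral_2_eq_2)
    finally show ?thesis by (simp add: sum_negf)
  next
    \<comment> \<open>No term \<open>i = 1\<close> to split off: the degree \<open>k - 2\<close> is negative and its contribution zero.\<close>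
    case False
    then have "k < 2" by linarith
    then show ?thesis using False assms(1) by (simp add: sdim_def kdelta_def)
  qed
  show "\<exists>d. ring.dimension H d (scalars H) (zgr H k) \<and>
       int d = sdim k n n - sdim (k - 2) n n + (\<Sum>i=2..?N. (- 1) ^ i * ?g i)
         + (\<Sum>i=1..k - 1. kdelta (k - i) (int n)) + kdelta (k - 2) (int n)"
  proof -
    obtain d where d: "ring.dimension H d (scalars H) (zgr H k)"
      "int d = sdim k n n + (if k > int n then 1 else 0)
        - int (vs.dim (omega ` koszul (k - 2) :: (_ \<Rightarrow> 'f) set))"
      using cohomology_dimension[of k, where 'f = 'f] unfolding H_def by blast
    have "int d = sdim k n n - sdim (k - 2) n n + (\<Sum>i=2..?N. (- 1) ^ i * ?g i)
         + (\<Sum>i=1..k - 1. kdelta (k - i) (int n)) + kdelta (k - 2) (int n)"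
      using d(2) sums unfolding dim_exact sum_kdelta[OF assms(1)] by linarith
    then show ?thesis using d(1) by blast
  qed
qed

end
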